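(* Let $\mathbf{E}$ be a category with finite colimits. The functor $\mathrm{colim}: Graph/|\mathbf{E}| \to \mathbf{E}$, which sends a finite diagram in $\mathbf{E}$ to its colimit and a compatible graph morphism to the induced arrow between colimits, extends (by applying colimit to cospans, so that a discrete diagram $\{A_i\}_{i\in I}$ goes to $\sum_{i\in I}A_i$ and the class of a cospan of diagrams $X\to D\leftarrow Y$ goes to the class of the cospan $\mathrm{colim}(X)\to \mathrm{colim}(D)\leftarrow \mathrm{colim}(Y)$) to a functor $$\mathrm{colim}: Cspn(Graph/|\mathbf{E}|)\to cospan(\mathbf{E})$$ which preserves the wscc structure.
   Context: **Diagrams.** $Graph$ is the category of finite (directed) graphs and graph morphisms. $|\mathbf{E}|$ is the underlying (possibly infinite) graph of $\mathbf{E}$. $Graph/|\mathbf{E}|$ is the category whose objects are (finite) diagrams in $\mathbf{E}$, i.e. graph morphisms $D: G\to|\mathbf{E}|$ with $G$ a finite graph, and whose morphisms from $D:G\to|\mathbf{E}|$ to $D':G'\to|\mathbf{E}|$ are compatible graph morphisms, i.e. graph morphisms $\phi:G\to G'$ with $D'\phi=D$. Finite colimits in $Graph/|\mathbf{E}|$ are calculated as in $Graph$ and are unrelated to colimits in $\mathbf{E}$. A diagram is discrete if its parametrizing graph has no arrows; it is then a finite family $\{A_i\}_{i\in I}$ of objects of $\mathbf{E}$. The colimit of a diagram $D:G\to|\mathbf{E}|$ is the universal cocone: arrows $q_g: D(g)\to C$ ($g$ a vertex of $G$) with $q_{h}\cdot D(\alpha)=q_{g}$ for each arrow $\alpha:g\to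 h$ of $G$. A choice of colimits in $\mathbf{E}$ is assumed fixed. **Cospans.** For a category $\mathbf{C}$ with finite colimits, $cospan(\mathbf{C})$ is the category whose objects are those of $\mathbf{C}$, and whose arrows from $A$ to $B$ are isomorphism classes of cospans $\alpha_1:A\to R\leftarrow B:\alpha_2$, with composition by pushout. Such an arrow is written $(\alpha_1,\alpha_2):A\leftrightarrow B$. For an arrow $f:A\to B$ of $\mathbf{C}$, put $\vec f=(f,1_B):A\leftrightarrow B$ and $f^{o}=(1_B,f):B\leftrightarrow A$. The category $cospan(\mathbf{C})$ is symmetric monoidal with tensor given by the sum $+$ in $\mathbf{C}$ and unit the initial object $0$. $Cspn(Graph/|\mathbf{E}|)$ is the full subcategory of $cospan(Graph/|\mathbf{E}|)$ whose objects are the discrete diagrams in $\mathbf{E}$. **wscc structure.** A commutative separable algebra in a symmetric monoidal category with tensor $\otimes$ and unit $I$ is an object $A$ with arrows $!:I\to A$, $\nabla:A\otimes A\to A$, $\text{¡}:A\to I$, $\Delta:A\to A\otimes A$ such that $(A,\nabla,!)$ is a commutative monoid, $(A,\Delta,\text{¡})$ is a cocommutative comonoid, and $$(1_A\otimes\nabla)(\Delta\otimes 1_A)=\Delta\nabla=(\nabla\otimes 1_A)(1_A\otimes\Delta),\qquad \nabla\Delta=1_A .$$ A wscc (well-supported compact closed) category is a symmetric monoidal category in which each object has a commutative separable algebra structure. The wscc structure on $cospan(\mathbf{C})$ consists of the symmetric monoidal structure above and, for each object $A$, with $!_A:0\to A$ the unique arrow and $\nabla_A:A+A\to A$ the codiagonal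 in $\mathbf{C}$, the cospans $!=\vec{!_A}:0\leftrightarrow A$, $\nabla=\vec{\nabla_A}:A+A\leftrightarrow A$, $\text{¡}=(!_A)^{o}:A\leftrightarrow 0$, $\Delta=(\nabla_A)^{o}:A\leftrightarrow A+A$. Applied to $\mathbf{C}=\mathbf{E}$ this gives the wscc structure of $cospan(\mathbf{E})$; applied to $\mathbf{C}=Graph/|\mathbf{E}|$ and restricted to discrete diagrams (which are closed under finite sums) it gives the wscc structure of $Cspn(Graph/|\mathbf{E}|)$. A functor between wscc categories preserves the wscc structure if it preserves the symmetric monoidal structure (up to the canonical coherent isomorphisms, here those of the form $\mathrm{colim}(X+Y)\cong\mathrm{colim}(X)+\mathrm{colim}(Y)$ and $\mathrm{colim}(\{\})\cong 0$) and, modulo these isomorphisms, sends the structure arrows $!,\nabla,\text{¡},\Delta$ of each object to those of its image. *)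

theory Defs
  imports "HOL-Library.FuncSet" "HOL-Library.Infinite_Typeclass"
begin

section \<open>Categories and functors\<close>

record ('o, 'a) cat =
  Ob :: "'o set"
  Ar :: "'a set"
  Dom :: "'a \<Rightarrow> 'o"
  Cod :: "'a \<Rightarrow> 'o"
  ident :: "'o \<Rightarrow> 'a"
  comp :: "'a \<Rightarrow> 'a \<Rightarrow> 'a"  (infixr "\<cdot>\<index>" 70)  (* g \<cdot> f is "first f, then g" *)

definition Hom :: "('o, 'a, 'z) cat_scheme \<Rightarrow> 'o \<Rightarrow> 'o \<Rightarrow> 'a set" where
  "Hom C A B = {f \<in> Ar C. Dom C f = A \<and> Cod C f = B}"

locale category =
  fixes C :: "('o, 'a, 'z) cat_scheme" (structure)
  assumes Dom_in: "f \<in> Ar C \<Longrightarrow> Dom C f \<in> Ob C"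
    and Cod_in: "f \<in> Ar C \<Longrightarrow> Cod C f \<in> Ob C"
    and ident_in: "A \<in> Ob C \<Longrightarrow> ident C A \<in> Hom C A A"
    and comp_in: "f \<in> Hom C A B \<Longrightarrow> g \<in> Hom C B D \<Longrightarrow> g \<cdot> f \<in> Hom C A D"
    and comp_ident: "f \<in> Hom C A B \<Longrightarrow> f \<cdot> ident C A = f"
    and ident_comp: "f \<in> Hom C A B \<Longrightarrow> ident C B \<cdot> f = f"
    and comp_assoc: "f \<in> Hom C A B \<Longrightarrow> g \<in> Hom C B D \<Longrightarrow> h \<in> Hom C D E
      \<Longrightarrow> (h \<cdot> g) \<cdot> f = h \<cdot> (g \<cdot> f)"

definition inverse_ar :: "('o, 'a, 'z) cat_scheme \<Rightarrow> 'a \<Rightarrow> 'a \<Rightarrow> bool" where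
  "inverse_ar C f g \<longleftrightarrow> f \<in> Ar C \<and> g \<in> Hom C (Cod C f) (Dom C f) \<and>
     g \<cdot>\<^bsub>C\<^esub> f = ident C (Dom C f) \<and> f \<cdot>\<^bsub>C\<^esub> g = ident C (Cod C f)"

definition iso :: "('o, 'a, 'z) cat_scheme \<Rightarrow> 'a \<Rightarrow> bool" where
  "iso C f \<longleftrightarrow> (\<exists>g. inverse_ar C f g)"

definition inv_ar :: "('o, 'a, 'z) cat_scheme \<Rightarrow> 'a \<Rightarrow> 'a" where
  "inv_ar C f = (THE g. inverse_ar C f g)"

record ('o, 'a, 'p, 'b) cat_map =
  obj_map :: "'o \<Rightarrow> 'p"
  ar_map :: "'a \<Rightarrow> 'b"

locale cat_functor = S: category C + T: category D
  for C :: "('o, 'a, 'z) cat_scheme" and D :: "('p, 'b, 'y) cat_scheme"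
    and F :: "('o, 'a, 'p, 'b) cat_map" +
  assumes obj_in: "A \<in> Ob C \<Longrightarrow> obj_map F A \<in> Ob D"
    and ar_in: "f \<in> Hom C A B \<Longrightarrow> ar_map F f \<in> Hom D (obj_map F A) (obj_map F B)"
    and map_ident: "A \<in> Ob C \<Longrightarrow> ar_map F (ident C A) = ident D (obj_map F A)"
    and map_comp: "f \<in> Hom C A B \<Longrightarrow> g \<in> Hom C B E
      \<Longrightarrow> ar_map F (g \<cdot>\<^bsub>C\<^esub> f) = ar_map F g \<cdot>\<^bsub>D\<^esub> ar_map F f"

definition full_sub :: "('o, 'a, 'z) cat_scheme \<Rightarrow> 'o set \<Rightarrow> ('o, 'a, 'z) cat_scheme" where
  "full_sub C P = C\<lparr>Ob := Ob C \<inter> P, Ar := {f \<in> Ar C. Dom C f \<in> P \<and> Cod C f \<in> P}\<rparr>"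


section \<open>Well-supported compact closed categories\<close>

record ('o, 'a) smc = "('o, 'a) cat" +
  tens :: "'o \<Rightarrow> 'o \<Rightarrow> 'o"  (infixr "\<otimes>\<index>" 75)
  tens_ar :: "'a \<Rightarrow> 'a \<Rightarrow> 'a"  (infixr "\<boxtimes>\<index>" 75)
  tunit :: "'o"
  assoc :: "'o \<Rightarrow> 'o \<Rightarrow> 'o \<Rightarrow> 'a"  (* (A \<otimes> B) \<otimes> D \<rightarrow> A \<otimes> (B \<otimes> D) *)
  lunit :: "'o \<Rightarrow> 'a"
  runit :: "'o \<Rightarrow> 'a"
  symm :: "'o \<Rightarrow> 'o \<Rightarrow> 'a"

record ('o, 'a) wscc = "('o, 'a) smc" +
  bang :: "'o \<Rightarrow> 'a"
  nabla :: "'o \<Rightarrow> 'a"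
  cobang :: "'o \<Rightarrow> 'a"
  delta :: "'o \<Rightarrow> 'a"

locale symmetric_monoidal_category = category C
  for C :: "('o, 'a, 'z) smc_scheme" (structure) +
  assumes tunit_in: "tunit C \<in> Ob C"
    and tens_in: "A \<in> Ob C \<Longrightarrow> B \<in> Ob C \<Longrightarrow> A \<otimes> B \<in> Ob C"
    and tens_ar_in: "f \<in> Hom C A B \<Longrightarrow> g \<in> Hom C A' B' \<Longrightarrow> f \<boxtimes> g \<in> Hom C (A \<otimes> A') (B \<otimes> B')"
    and tens_ident: "A \<in> Ob C \<Longrightarrow> B \<in> Ob C \<Longrightarrow> ident C A \<boxtimes> ident C B = ident C (A \<otimes> B)"
    and tens_comp: "f \<in> Hom C A B \<Longrightarrow> g \<in> Hom C B D \<Longrightarrow> f' \<in> Hom C A' B' \<Longrightarrow> g' \<in> Hom C B' D'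
      \<Longrightarrow> (g \<cdot> f) \<boxtimes> (g' \<cdot> f') = (g \<boxtimes> g') \<cdot> (f \<boxtimes> f')"
    and assoc_in: "A \<in> Ob C \<Longrightarrow> B \<in> Ob C \<Longrightarrow> D \<in> Ob C
      \<Longrightarrow> assoc C A B D \<in> Hom C ((A \<otimes> B) \<otimes> D) (A \<otimes> (B \<otimes> D)) \<and> iso C (assoc C A B D)"
    and lunit_in: "A \<in> Ob C \<Longrightarrow> lunit C A \<in> Hom C (tunit C \<otimes> A) A \<and> iso C (lunit C A)"
    and runit_in: "A \<in> Ob C \<Longrightarrow> runit C A \<in> Hom C (A \<otimes> tunit C) A \<and> iso C (runit C A)"
    and symm_in: "A \<in> Ob C \<Longrightarrow> B \<in> Ob C \<Longrightarrow> symm C A B \<in> Hom C (A \<otimes> B) (B \<otimes> A)"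
    and assoc_natural: "f \<in> Hom C A A' \<Longrightarrow> g \<in> Hom C B B' \<Longrightarrow> h \<in> Hom C D D'
      \<Longrightarrow> assoc C A' B' D' \<cdot> ((f \<boxtimes> g) \<boxtimes> h) = (f \<boxtimes> (g \<boxtimes> h)) \<cdot> assoc C A B D"
    and lunit_natural: "f \<in> Hom C A B \<Longrightarrow> lunit C B \<cdot> (ident C (tunit C) \<boxtimes> f) = f \<cdot> lunit C A"
    and runit_natural: "f \<in> Hom C A B \<Longrightarrow> runit C B \<cdot> (f \<boxtimes> ident C (tunit C)) = f \<cdot> runit C A"
    and symm_natural: "f \<in> Hom C A A' \<Longrightarrow> g \<in> Hom C B B'
      \<Longrightarrow> symm C A' B' \<cdot> (f \<boxtimes> g) = (g \<boxtimes> f) \<cdot> symm C A B"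
    and pentagon: "A \<in> Ob C \<Longrightarrow> B \<in> Ob C \<Longrightarrow> D \<in> Ob C \<Longrightarrow> E \<in> Ob C
      \<Longrightarrow> assoc C A B (D \<otimes> E) \<cdot> assoc C (A \<otimes> B) D E
        = (ident C A \<boxtimes> assoc C B D E) \<cdot> assoc C A (B \<otimes> D) E \<cdot> (assoc C A B D \<boxtimes> ident C E)"
    and triangle: "A \<in> Ob C \<Longrightarrow> B \<in> Ob C
      \<Longrightarrow> (ident C A \<boxtimes> lunit C B) \<cdot> assoc C A (tunit C) B = runit C A \<boxtimes> ident C B"
    and hexagon: "A \<in> Ob C \<Longrightarrow> B \<in> Ob C \<Longrightarrow> D \<in> Ob C
      \<Longrightarrow> assoc C B D A \<cdot> symm C A (B \<otimes> D) \<cdot> assoc C A B D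
        = (ident C B \<boxtimes> symm C A D) \<cdot> assoc C B A D \<cdot> (symm C A B \<boxtimes> ident C D)"
    and symm_symm: "A \<in> Ob C \<Longrightarrow> B \<in> Ob C \<Longrightarrow> symm C B A \<cdot> symm C A B = ident C (A \<otimes> B)"

locale wscc_category = symmetric_monoidal_category W
  for W :: "('o, 'a, 'z) wscc_scheme" (structure) +
  assumes bang_in: "A \<in> Ob W \<Longrightarrow> bang W A \<in> Hom W (tunit W) A"
    and nabla_in: "A \<in> Ob W \<Longrightarrow> nabla W A \<in> Hom W (A \<otimes> A) A"
    and cobang_in: "A \<in> Ob W \<Longrightarrow> cobang W A \<in> Hom W A (tunit W)"
    and delta_in: "A \<in> Ob W \<Longrightarrow> delta W A \<in> Hom W A (A \<otimes> A)"
    and nabla_assoc: "A \<in> Ob W \<Longrightarrow>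
      nabla W A \<cdot> (nabla W A \<boxtimes> ident W A)
        = nabla W A \<cdot> (ident W A \<boxtimes> nabla W A) \<cdot> assoc W A A A"
    and nabla_lunit: "A \<in> Ob W \<Longrightarrow> nabla W A \<cdot> (bang W A \<boxtimes> ident W A) = lunit W A"
    and nabla_runit: "A \<in> Ob W \<Longrightarrow> nabla W A \<cdot> (ident W A \<boxtimes> bang W A) = runit W A"
    and nabla_comm: "A \<in> Ob W \<Longrightarrow> nabla W A \<cdot> symm W A A = nabla W A"
    and delta_assoc: "A \<in> Ob W \<Longrightarrow>
      assoc W A A A \<cdot> (delta W A \<boxtimes> ident W A) \<cdot> delta W A
        = (ident W A \<boxtimes> delta W A) \<cdot> delta W A"
    and delta_lunit: "A \<in> Ob W \<Longrightarrow>
      lunit W A \<cdot> (cobang W A \<boxtimes> ident W A) \<cdot> delta W A = ident W A"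
    and delta_runit: "A \<in> Ob W \<Longrightarrow>
      runit W A \<cdot> (ident W A \<boxtimes> cobang W A) \<cdot> delta W A = ident W A"
    and delta_comm: "A \<in> Ob W \<Longrightarrow> symm W A A \<cdot> delta W A = delta W A"
    and frobenius_left: "A \<in> Ob W \<Longrightarrow>
      (ident W A \<boxtimes> nabla W A) \<cdot> assoc W A A A \<cdot> (delta W A \<boxtimes> ident W A) = delta W A \<cdot> nabla W A"
    and frobenius_right: "A \<in> Ob W \<Longrightarrow>
      (nabla W A \<boxtimes> ident W A) \<cdot> inv_ar W (assoc W A A A) \<cdot> (ident W A \<boxtimes> delta W A)
        = delta W A \<cdot> nabla W A"
    and separable: "A \<in> Ob W \<Longrightarrow> nabla W A \<cdot> delta W A = ident W A"

text \<open>A functor \<open>F\<close> between wscc categories which preserves the wscc structure modulo the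
  isomorphisms \<open>\<mu> A B : FA \<otimes> FB \<rightarrow> F(A \<otimes> B)\<close> and \<open>\<eta> : I \<rightarrow> FI\<close>.\<close>

locale wscc_functor = cat_functor V W F + V: wscc_category V + W: wscc_category W
  for V :: "('o, 'a, 'z) wscc_scheme" and W :: "('p, 'b, 'y) wscc_scheme"
    and F :: "('o, 'a, 'p, 'b) cat_map"
    and \<mu> :: "'o \<Rightarrow> 'o \<Rightarrow> 'b" and \<eta> :: "'b" +
  assumes mu_in: "A \<in> Ob V \<Longrightarrow> B \<in> Ob V
      \<Longrightarrow> \<mu> A B \<in> Hom W (obj_map F A \<otimes>\<^bsub>W\<^esub> obj_map F B) (obj_map F (A \<otimes>\<^bsub>V\<^esub> B)) \<and> iso W (\<mu> A B)"
    and eta_in: "\<eta> \<in> Hom W (tunit W) (obj_map F (tunit V)) \<and> iso W \<eta>"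
    and mu_natural: "f \<in> Hom V A A' \<Longrightarrow> g \<in> Hom V B B'
      \<Longrightarrow> ar_map F (f \<boxtimes>\<^bsub>V\<^esub> g) \<cdot>\<^bsub>W\<^esub> \<mu> A B = \<mu> A' B' \<cdot>\<^bsub>W\<^esub> (ar_map F f \<boxtimes>\<^bsub>W\<^esub> ar_map F g)"
    and map_assoc: "A \<in> Ob V \<Longrightarrow> B \<in> Ob V \<Longrightarrow> D \<in> Ob V
      \<Longrightarrow> ar_map F (assoc V A B D) \<cdot>\<^bsub>W\<^esub> \<mu> (A \<otimes>\<^bsub>V\<^esub> B) D
            \<cdot>\<^bsub>W\<^esub> (\<mu> A B \<boxtimes>\<^bsub>W\<^esub> ident W (obj_map F D))
        = \<mu> A (B \<otimes>\<^bsub>V\<^esub> D) \<cdot>\<^bsub>W\<^esub> (ident W (obj_map F A) \<boxtimes>\<^bsub>W\<^esub> \<mu> B D)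
            \<cdot>\<^bsub>W\<^esub> assoc W (obj_map F A) (obj_map F B) (obj_map F D)"
    and map_lunit: "A \<in> Ob V
      \<Longrightarrow> ar_map F (lunit V A) \<cdot>\<^bsub>W\<^esub> \<mu> (tunit V) A \<cdot>\<^bsub>W\<^esub> (\<eta> \<boxtimes>\<^bsub>W\<^esub> ident W (obj_map F A))
        = lunit W (obj_map F A)"
    and map_runit: "A \<in> Ob V
      \<Longrightarrow> ar_map F (runit V A) \<cdot>\<^bsub>W\<^esub> \<mu> A (tunit V) \<cdot>\<^bsub>W\<^esub> (ident W (obj_map F A) \<boxtimes>\<^bsub>W\<^esub> \<eta>)
        = runit W (obj_map F A)"
    and map_symm: "A \<in> Ob V \<Longrightarrow> B \<in> Ob V
      \<Longrightarrow> ar_map F (symm V A B) \<cdot>\<^bsub>W\<^esub> \<mu> A B = \<mu> B A \<cdot>\<^bsub>W\<^esub> symm W (obj_map F A) (obj_map F B)"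
    and map_bang: "A \<in> Ob V \<Longrightarrow> ar_map F (bang V A) \<cdot>\<^bsub>W\<^esub> \<eta> = bang W (obj_map F A)"
    and map_nabla: "A \<in> Ob V \<Longrightarrow> ar_map F (nabla V A) \<cdot>\<^bsub>W\<^esub> \<mu> A A = nabla W (obj_map F A)"
    and map_cobang: "A \<in> Ob V \<Longrightarrow> ar_map F (cobang V A) = \<eta> \<cdot>\<^bsub>W\<^esub> cobang W (obj_map F A)"
    and map_delta: "A \<in> Ob V \<Longrightarrow> ar_map F (delta V A) = \<mu> A A \<cdot>\<^bsub>W\<^esub> delta W (obj_map F A)"


section \<open>Sums and pushouts\<close>

definition is_initial :: "('o, 'a, 'z) cat_scheme \<Rightarrow> 'o \<Rightarrow> bool" where
  "is_initial C Z \<longleftrightarrow> Z \<in> Ob C \<and> (\<forall>B \<in> Ob C. \<exists>!h. h \<in> Hom C Z B)"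

definition is_sum :: "('o, 'a, 'z) cat_scheme \<Rightarrow> 'i set \<Rightarrow> ('i \<Rightarrow> 'o) \<Rightarrow> 'o \<Rightarrow> ('i \<Rightarrow> 'a) \<Rightarrow> bool" where
  "is_sum C I A P q \<longleftrightarrow> P \<in> Ob C \<and> (\<forall>i \<in> I. q i \<in> Hom C (A i) P) \<and>
     (\<forall>B \<in> Ob C. \<forall>f. (\<forall>i \<in> I. f i \<in> Hom C (A i) B) \<longrightarrow>
        (\<exists>!h. h \<in> Hom C P B \<and> (\<forall>i \<in> I. h \<cdot>\<^bsub>C\<^esub> q i = f i)))"

definition is_binary_sum :: "('o, 'a, 'z) cat_scheme \<Rightarrow> 'o \<Rightarrow> 'o \<Rightarrow> 'o \<Rightarrow> 'a \<Rightarrow> 'a \<Rightarrow> bool" where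
  "is_binary_sum C A B P i j \<longleftrightarrow> P \<in> Ob C \<and> i \<in> Hom C A P \<and> j \<in> Hom C B P \<and>
     (\<forall>X f g. f \<in> Hom C A X \<and> g \<in> Hom C B X \<longrightarrow>
        (\<exists>!h. h \<in> Hom C P X \<and> h \<cdot>\<^bsub>C\<^esub> i = f \<and> h \<cdot>\<^bsub>C\<^esub> j = g))"

definition is_pushout :: "('o, 'a, 'z) cat_scheme \<Rightarrow> 'a \<Rightarrow> 'a \<Rightarrow> 'a \<Rightarrow> 'a \<Rightarrow> bool" where
  "is_pushout C f g i j \<longleftrightarrow> f \<in> Ar C \<and> g \<in> Ar C \<and> Dom C f = Dom C g \<and>
     (\<exists>P. i \<in> Hom C (Cod C f) P \<and> j \<in> Hom C (Cod C g) P \<and> i \<cdot>\<^bsub>C\<^esub> f = j \<cdot>\<^bsub>C\<^esub> g \<and>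
       (\<forall>X u v. u \<in> Hom C (Cod C f) X \<and> v \<in> Hom C (Cod C g) X \<and> u \<cdot>\<^bsub>C\<^esub> f = v \<cdot>\<^bsub>C\<^esub> g \<longrightarrow>
          (\<exists>!h. h \<in> Hom C P X \<and> h \<cdot>\<^bsub>C\<^esub> i = u \<and> h \<cdot>\<^bsub>C\<^esub> j = v)))"

record ('o, 'a) sum_choice =
  zero_ob :: "'o"
  sum_ob :: "'o \<Rightarrow> 'o \<Rightarrow> 'o"
  inj1 :: "'o \<Rightarrow> 'o \<Rightarrow> 'a"
  inj2 :: "'o \<Rightarrow> 'o \<Rightarrow> 'a"

definition chosen_sums :: "('o, 'a, 'z) cat_scheme \<Rightarrow> ('o, 'a) sum_choice \<Rightarrow> bool" where
  "chosen_sums C S \<longleftrightarrow> is_initial C (zero_ob S) \<and>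
     (\<forall>A \<in> Ob C. \<forall>B \<in> Ob C. is_binary_sum C A B (sum_ob S A B) (inj1 S A B) (inj2 S A B))"

definition from_zero :: "('o, 'a, 'z) cat_scheme \<Rightarrow> ('o, 'a) sum_choice \<Rightarrow> 'o \<Rightarrow> 'a" where
  "from_zero C S A = (THE h. h \<in> Hom C (zero_ob S) A)"

definition copair :: "('o, 'a, 'z) cat_scheme \<Rightarrow> ('o, 'a) sum_choice \<Rightarrow> 'a \<Rightarrow> 'a \<Rightarrow> 'a" where
  "copair C S f g = (THE h. h \<in> Hom C (sum_ob S (Dom C f) (Dom C g)) (Cod C f) \<and>
     h \<cdot>\<^bsub>C\<^esub> inj1 S (Dom C f) (Dom C g) = f \<and> h \<cdot>\<^bsub>C\<^esub> inj2 S (Dom C f) (Dom C g) = g)"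

definition codiag :: "('o, 'a, 'z) cat_scheme \<Rightarrow> ('o, 'a) sum_choice \<Rightarrow> 'o \<Rightarrow> 'a" where
  "codiag C S A = copair C S (ident C A) (ident C A)"

definition sum_ar :: "('o, 'a, 'z) cat_scheme \<Rightarrow> ('o, 'a) sum_choice \<Rightarrow> 'a \<Rightarrow> 'a \<Rightarrow> 'a" where
  "sum_ar C S f g = copair C S (inj1 S (Cod C f) (Cod C g) \<cdot>\<^bsub>C\<^esub> f) (inj2 S (Cod C f) (Cod C g) \<cdot>\<^bsub>C\<^esub> g)"

definition sum_assoc :: "('o, 'a, 'z) cat_scheme \<Rightarrow> ('o, 'a) sum_choice \<Rightarrow> 'o \<Rightarrow> 'o \<Rightarrow> 'o \<Rightarrow> 'a" where
  "sum_assoc C S A B D =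
     copair C S
       (copair C S (inj1 S A (sum_ob S B D)) (inj2 S A (sum_ob S B D) \<cdot>\<^bsub>C\<^esub> inj1 S B D))
       (inj2 S A (sum_ob S B D) \<cdot>\<^bsub>C\<^esub> inj2 S B D)"

definition sum_lunit :: "('o, 'a, 'z) cat_scheme \<Rightarrow> ('o, 'a) sum_choice \<Rightarrow> 'o \<Rightarrow> 'a" where
  "sum_lunit C S A = copair C S (from_zero C S A) (ident C A)"

definition sum_runit :: "('o, 'a, 'z) cat_scheme \<Rightarrow> ('o, 'a) sum_choice \<Rightarrow> 'o \<Rightarrow> 'a" where
  "sum_runit C S A = copair C S (ident C A) (from_zero C S A)"

definition sum_symm :: "('o, 'a, 'z) cat_scheme \<Rightarrow> ('o, 'a) sum_choice \<Rightarrow> 'o \<Rightarrow> 'o \<Rightarrow> 'a" where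
  "sum_symm C S A B = copair C S (inj2 S B A) (inj1 S B A)"


section \<open>Cospans\<close>

definition cospans :: "('o, 'a, 'z) cat_scheme \<Rightarrow> ('a \<times> 'a) set" where
  "cospans C = {(f, g). f \<in> Ar C \<and> g \<in> Ar C \<and> Cod C f = Cod C g}"

definition cospan_iso :: "('o, 'a, 'z) cat_scheme \<Rightarrow> 'a \<times> 'a \<Rightarrow> 'a \<times> 'a \<Rightarrow> bool" where
  "cospan_iso C c d \<longleftrightarrow> (\<exists>h. iso C h \<and> h \<in> Hom C (Cod C (fst c)) (Cod C (fst d)) \<and>
     h \<cdot>\<^bsub>C\<^esub> fst c = fst d \<and> h \<cdot>\<^bsub>C\<^esub> snd c = snd d)"

definition cospan_class :: "('o, 'a, 'z) cat_scheme \<Rightarrow> 'a \<times> 'a \<Rightarrow> ('a \<times> 'a) set" where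
  "cospan_class C c = {d \<in> cospans C. cospan_iso C c d}"

definition vec :: "('o, 'a, 'z) cat_scheme \<Rightarrow> 'a \<Rightarrow> ('a \<times> 'a) set" where
  "vec C f = cospan_class C (f, ident C (Cod C f))"

definition opp :: "('o, 'a, 'z) cat_scheme \<Rightarrow> 'a \<Rightarrow> ('a \<times> 'a) set" where
  "opp C f = cospan_class C (ident C (Cod C f), f)"

text \<open>Isomorphic cospans have the same feet, so domain and codomain of a class are the unique
  values of the feet on it. Composition and tensor are defined without choosing representatives or
  pushouts: the composite collects what is obtained from all representatives and all pushouts,
  which is one isomorphism class.\<close>

definition cospan_cat ::
    "('o, 'a, 'z) cat_scheme \<Rightarrow> ('o, 'a) sum_choice \<Rightarrow> ('o, ('a \<times> 'a) set) wscc" where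
  "cospan_cat C S = \<lparr>
     Ob = Ob C,
     Ar = cospan_class C ` cospans C,
     Dom = (\<lambda>c. the_elem ((\<lambda>x. Dom C (fst x)) ` c)),
     Cod = (\<lambda>c. the_elem ((\<lambda>x. Dom C (snd x)) ` c)),
     ident = (\<lambda>A. vec C (ident C A)),
     comp = (\<lambda>d c. {(i \<cdot>\<^bsub>C\<^esub> f, j \<cdot>\<^bsub>C\<^esub> g) | f f' g' g i j.
        (f, f') \<in> c \<and> (g', g) \<in> d \<and> is_pushout C f' g' i j}),
     tens = sum_ob S,
     tens_ar = (\<lambda>c d. \<Union>(f, f') \<in> c. \<Union>(g, g') \<in> d.
        cospan_class C (sum_ar C S f g, sum_ar C S f' g')),
     tunit = zero_ob S,
     assoc = (\<lambda>A B D. vec C (sum_assoc C S A B D)),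
     lunit = (\<lambda>A. vec C (sum_lunit C S A)),
     runit = (\<lambda>A. vec C (sum_runit C S A)),
     symm = (\<lambda>A B. vec C (sum_symm C S A B)),
     bang = (\<lambda>A. vec C (from_zero C S A)),
     nabla = (\<lambda>A. vec C (codiag C S A)),
     cobang = (\<lambda>A. opp C (from_zero C S A)),
     delta = (\<lambda>A. opp C (codiag C S A))\<rparr>"


section \<open>Graphs and diagrams\<close>

record ('v, 'e) digraph =
  verts :: "'v set"
  edges :: "'e set"
  src :: "'e \<Rightarrow> 'v"
  tgt :: "'e \<Rightarrow> 'v"

record ('v, 'e, 'w, 'f) gmap =
  on_v :: "'v \<Rightarrow> 'w"
  on_e :: "'e \<Rightarrow> 'f"

text \<open>Functions are extensional outside the relevant set, so that equality of graphs, of graph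
  morphisms and of diagrams is the intended one.\<close>

definition finite_graph :: "('v, 'e) digraph \<Rightarrow> bool" where
  "finite_graph G \<longleftrightarrow> finite (verts G) \<and> finite (edges G) \<and>
     src G \<in> edges G \<rightarrow>\<^sub>E verts G \<and> tgt G \<in> edges G \<rightarrow>\<^sub>E verts G"

definition graph_morphism ::
    "('v, 'e) digraph \<Rightarrow> ('w, 'f) digraph \<Rightarrow> ('v, 'e, 'w, 'f) gmap \<Rightarrow> bool" where
  "graph_morphism G H \<phi> \<longleftrightarrow>
     on_v \<phi> \<in> verts G \<rightarrow>\<^sub>E verts H \<and> on_e \<phi> \<in> edges G \<rightarrow>\<^sub>E edges H \<and>
     (\<forall>\<alpha> \<in> edges G. src H (on_e \<phi> \<alpha>) = on_v \<phi> (src G \<alpha>) \<and> tgt H (on_e \<phi> \<alpha>) = on_v \<phi> (tgt G \<alpha>))"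

definition gcomp ::
    "('v, 'e) digraph \<Rightarrow> ('w, 'f, 'x, 'h) gmap \<Rightarrow> ('v, 'e, 'w, 'f) gmap \<Rightarrow> ('v, 'e, 'x, 'h) gmap" where
  "gcomp G \<psi> \<phi> = \<lparr>on_v = compose (verts G) (on_v \<psi>) (on_v \<phi>),
                  on_e = compose (edges G) (on_e \<psi>) (on_e \<phi>)\<rparr>"

definition gident :: "('v, 'e) digraph \<Rightarrow> ('v, 'e, 'v, 'e) gmap" where
  "gident G = \<lparr>on_v = (\<lambda>x \<in> verts G. x), on_e = (\<lambda>x \<in> edges G. x)\<rparr>"

definition underlying_graph :: "('o, 'a, 'z) cat_scheme \<Rightarrow> ('o, 'a) digraph" where
  "underlying_graph E = \<lparr>verts = Ob E, edges = Ar E, src = Dom E, tgt = Cod E\<rparr>"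

record ('v, 'e, 'o, 'a) diagram =
  shape :: "('v, 'e) digraph"
  lab :: "('v, 'e, 'o, 'a) gmap"

definition is_diagram :: "('o, 'a, 'z) cat_scheme \<Rightarrow> ('v, 'e, 'o, 'a) diagram \<Rightarrow> bool" where
  "is_diagram E D \<longleftrightarrow> finite_graph (shape D) \<and> graph_morphism (shape D) (underlying_graph E) (lab D)"

definition discrete_diagrams :: "('v, 'e, 'o, 'a) diagram set" where
  "discrete_diagrams = {D. edges (shape D) = {}}"

type_synonym ('v, 'e, 'o, 'a) diagram_ar =
  "('v, 'e, 'o, 'a) diagram \<times> ('v, 'e, 'v, 'e) gmap \<times> ('v, 'e, 'o, 'a) diagram"

text \<open>The category of finite diagrams in \<open>E\<close> and compatible graph morphisms. The parametrizing
  graphs have vertices in \<open>'v\<close> and arrows in \<open>'e\<close>; when both types are infinite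
  every finite graph occurs up to isomorphism.\<close>

definition diagram_cat ::
    "('o, 'a, 'z) cat_scheme \<Rightarrow> (('v, 'e, 'o, 'a) diagram, ('v, 'e, 'o, 'a) diagram_ar) cat" where
  "diagram_cat E = \<lparr>
     Ob = {D. is_diagram E D},
     Ar = {(D, \<phi>, D'). is_diagram E D \<and> is_diagram E D' \<and>
             graph_morphism (shape D) (shape D') \<phi> \<and> gcomp (shape D) (lab D') \<phi> = lab D},
     Dom = (\<lambda>(D, \<phi>, D'). D),
     Cod = (\<lambda>(D, \<phi>, D'). D'),
     ident = (\<lambda>D. (D, gident (shape D), D)),
     comp = (\<lambda>(D', \<psi>, D'') (D, \<phi>, _). (D, gcomp (shape D) \<psi> \<phi>, D''))\<rparr>"

definition Cspn ::
    "('o, 'a, 'z) cat_scheme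
      \<Rightarrow> (('v, 'e, 'o, 'a) diagram, ('v, 'e, 'o, 'a) diagram_ar) sum_choice
      \<Rightarrow> (('v, 'e, 'o, 'a) diagram,
          (('v, 'e, 'o, 'a) diagram_ar \<times> ('v, 'e, 'o, 'a) diagram_ar) set) wscc" where
  "Cspn E T = full_sub (cospan_cat (diagram_cat E) T) discrete_diagrams"


section \<open>Colimits of diagrams\<close>

definition is_cocone ::
    "('o, 'a, 'z) cat_scheme \<Rightarrow> ('v, 'e, 'o, 'a) diagram \<Rightarrow> 'o \<Rightarrow> ('v \<Rightarrow> 'a) \<Rightarrow> bool" where
  "is_cocone E D X q \<longleftrightarrow> X \<in> Ob E \<and>
     (\<forall>x \<in> verts (shape D). q x \<in> Hom E (on_v (lab D) x) X) \<and>
     (\<forall>\<alpha> \<in> edges (shape D). q (tgt (shape D) \<alpha>) \<cdot>\<^bsub>E\<^esub> on_e (lab D) \<alpha> = q (src (shape D) \<alpha>))"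

definition is_colimit ::
    "('o, 'a, 'z) cat_scheme \<Rightarrow> ('v, 'e, 'o, 'a) diagram \<Rightarrow> 'o \<Rightarrow> ('v \<Rightarrow> 'a) \<Rightarrow> bool" where
  "is_colimit E D X q \<longleftrightarrow> is_cocone E D X q \<and>
     (\<forall>Y r. is_cocone E D Y r \<longrightarrow>
        (\<exists>!h. h \<in> Hom E X Y \<and> (\<forall>x \<in> verts (shape D). h \<cdot>\<^bsub>E\<^esub> q x = r x)))"

record ('v, 'e, 'o, 'a) colim_choice =
  colim_ob :: "('v, 'e, 'o, 'a) diagram \<Rightarrow> 'o"
  colim_in :: "('v, 'e, 'o, 'a) diagram \<Rightarrow> 'v \<Rightarrow> 'a"

definition chosen_colimits ::
    "('o, 'a, 'z) cat_scheme \<Rightarrow> ('v, 'e, 'o, 'a) colim_choice \<Rightarrow> bool" where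
  "chosen_colimits E K \<longleftrightarrow> (\<forall>D. is_diagram E D \<longrightarrow> is_colimit E D (colim_ob K D) (colim_in K D))"

definition colim_ar ::
    "('o, 'a, 'z) cat_scheme \<Rightarrow> ('v, 'e, 'o, 'a) colim_choice \<Rightarrow> ('v, 'e, 'o, 'a) diagram_ar \<Rightarrow> 'a" where
  "colim_ar E K = (\<lambda>(D, \<phi>, D'). THE h. h \<in> Hom E (colim_ob K D) (colim_ob K D') \<and>
     (\<forall>x \<in> verts (shape D). h \<cdot>\<^bsub>E\<^esub> colim_in K D x = colim_in K D' (on_v \<phi> x)))"

definition colim ::
    "('o, 'a, 'z) cat_scheme \<Rightarrow> ('v, 'e, 'o, 'a) colim_choice
      \<Rightarrow> (('v, 'e, 'o, 'a) diagram, ('v, 'e, 'o, 'a) diagram_ar, 'o, 'a) cat_map" where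
  "colim E K = \<lparr>obj_map = colim_ob K, ar_map = colim_ar E K\<rparr>"

text \<open>The canonical arrow \<open>colim X + colim Y \<rightarrow> colim (X + Y)\<close>.\<close>

definition colim_sum ::
    "('o, 'a, 'z) cat_scheme \<Rightarrow> ('o, 'a) sum_choice \<Rightarrow> ('v, 'e, 'o, 'a) colim_choice
      \<Rightarrow> (('v, 'e, 'o, 'a) diagram, ('v, 'e, 'o, 'a) diagram_ar) sum_choice
      \<Rightarrow> ('v, 'e, 'o, 'a) diagram \<Rightarrow> ('v, 'e, 'o, 'a) diagram \<Rightarrow> 'a" where
  "colim_sum E S K T X Y = copair E S (colim_ar E K (inj1 T X Y)) (colim_ar E K (inj2 T X Y))"

end

theory Submission
  imports Defs
begin

text \<open>A cocone from a finite diagram \<open>D\<close> to \<open>X\<close> is a morphism from \<open>D\<close> to the forgetful diagram of the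
  slice \<open>E/X\<close>. That diagram is infinite in general, but finitely many cocones only reach a finite part
  of it, which is an object of \<open>Graph/|E|\<close>. So finite colimits in \<open>Graph/|E|\<close> can be tested against
  cocones, and \<open>colim\<close> preserves them, in particular the initial object, sums and pushouts. A functor
  with this property extends to cospans and respects all the structure built there from sums and
  codiagonals. The tensor and wscc equations for cospans reduce, through \<open>f \<mapsto> vec f\<close> and
  \<open>f \<mapsto> opp f\<close>, to equations in the category itself; only the Frobenius and separability laws need
  pushout squares. A sum of discrete diagrams is discrete because it maps to its own edgeless part.\<close>

section \<open>Arrows, isomorphisms and pushouts\<close>

text \<open>What saves the argument is that a universal property, tested at one target
  \<open>X\<close>, involves only two arrows into \<open>X\<close> at a time: two given legs for
  existence, two competing mediating arrows for uniqueness. A classifier depending on those two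
  arrows suffices. Its vertices are naturally pairs and its edges triples; since the vertex and edge
  types are infinite, finitely many of these can be encoded in them. The choice \<open>T\<close> of
  sums of diagrams is arbitrary, so the graphs underlying its values are unknown, and every fact
  about them is drawn from the universal property. Composition of cospans of diagrams needs
  pushouts, which come from \<open>T\<close> and an explicit coequalizer; pushouts in
  \<open>E\<close> are colimits of span-shaped diagrams. Preservation of pushouts yields
  functoriality on cospans, preservation of sums and of the initial object makes the comparison
  arrows invertible.\<close>

context category
begin

text \<open>The locale axioms speak of hom-sets, whose endpoints would have to be guessed in each
  application. Restated with equations between \<open>Dom\<close> and \<open>Cod\<close>, they
  become conditional rewrite rules whose side conditions simplify away.\<close>

lemma arr_comp [simp]:
  assumes "f \<in> Ar C" "g \<in> Ar C" "Dom C g = Cod C f"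
  shows "g \<cdot> f \<in> Ar C" "Dom C (g \<cdot> f) = Dom C f" "Cod C (g \<cdot> f) = Cod C g"
  using comp_in[of f "Dom C f" "Cod C f" g "Cod C g"] assms by (auto simp: Hom_def)

lemma arr_ident [simp]:
  assumes "A \<in> Ob C"
  shows "ident C A \<in> Ar C" "Dom C (ident C A) = A" "Cod C (ident C A) = A"
  using ident_in[OF assms] by (auto simp: Hom_def)

lemma arr_Dom [simp]: "f \<in> Ar C \<Longrightarrow> Dom C f \<in> Ob C"
  and arr_Cod [simp]: "f \<in> Ar C \<Longrightarrow> Cod C f \<in> Ob C"
  by (auto intro: Dom_in Cod_in)

lemma arr_comp_ident [simp]: "f \<in> Ar C \<Longrightarrow> Dom C f = A \<Longrightarrow> f \<cdot> ident C A = f"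
  by (rule comp_ident) (auto simp: Hom_def)

lemma arr_ident_comp [simp]: "f \<in> Ar C \<Longrightarrow> Cod C f = A \<Longrightarrow> ident C A \<cdot> f = f"
  by (rule ident_comp) (auto simp: Hom_def)

lemma arr_assoc [simp]:
  assumes "f \<in> Ar C" "g \<in> Ar C" "h \<in> Ar C" "Dom C g = Cod C f" "Dom C h = Cod C g"
  shows "(h \<cdot> g) \<cdot> f = h \<cdot> g \<cdot> f"
  using assms comp_assoc[of f "Dom C f" "Cod C f" g "Cod C g" h "Cod C h"]
  by (auto simp: Hom_def)

text \<open>Since \<open>arr_assoc\<close> nests composites to the right, the factor
  \<open>h \<cdot> g\<close> is no longer visible inside \<open>h \<cdot> g \<cdot> f\<close>, and
  an equation about it does not rewrite. This rule appends a common first arrow to an equation in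
  the nested form.\<close>

lemma comp_swap:
  assumes "h \<cdot> g = h' \<cdot> g'" "f \<in> Ar C" "g \<in> Ar C" "h \<in> Ar C" "Dom C g = Cod C f" "Dom C h = Cod C g"
    "g' \<in> Ar C" "h' \<in> Ar C" "Dom C g' = Cod C f" "Dom C h' = Cod C g'"
  shows "h \<cdot> g \<cdot> f = h' \<cdot> g' \<cdot> f"
  using assms arr_assoc[of f g h] arr_assoc[of f g' h'] by simp

lemma inverse_arD:
  assumes "inverse_ar C f g"
  shows "f \<in> Ar C" "g \<in> Ar C" "Dom C g = Cod C f" "Cod C g = Dom C f"
    "g \<cdot> f = ident C (Dom C f)" "f \<cdot> g = ident C (Cod C f)"
  using assms by (auto simp: inverse_ar_def Hom_def)

lemma inverse_arI:
  assumes "f \<in> Ar C" "g \<in> Ar C" "Dom C g = Cod C f" "Cod C g = Dom C f"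
    "g \<cdot> f = ident C (Dom C f)" "f \<cdot> g = ident C (Cod C f)"
  shows "inverse_ar C f g"
  using assms by (auto simp: inverse_ar_def Hom_def)

lemma inverse_ar_sym: "inverse_ar C f g \<Longrightarrow> inverse_ar C g f"
  using inverse_arD[of f g] by (intro inverse_arI) simp_all

text \<open>Cancellation in right-nested form, for the same reason as
  \<open>comp_swap\<close>.\<close>

lemma inverse_ar_cancel:
  assumes "inverse_ar C f g" "h \<in> Ar C" "Cod C h = Dom C f"
  shows "g \<cdot> f \<cdot> h = h"
  using assms inverse_arD[OF assms(1)] arr_assoc[of h f g] by simp

lemma inverse_ar_unique:
  assumes "inverse_ar C f g" "inverse_ar C f h"
  shows "g = h"
  using inverse_ar_cancel[OF assms(1), of h] inverse_arD[OF assms(1)] inverse_arD[OF assms(2)] by simp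

lemma inv_ar_eq: "inverse_ar C f g \<Longrightarrow> inv_ar C f = g"
  unfolding inv_ar_def by (blast intro: inverse_ar_unique)

lemma inverse_ar_comp:
  assumes "inverse_ar C f f'" "inverse_ar C g g'" "Dom C g = Cod C f"
  shows "inverse_ar C (g \<cdot> f) (f' \<cdot> g')"
  using inverse_arD[OF assms(1)] inverse_arD[OF assms(2)] assms(3)
    inverse_ar_cancel[OF assms(2)] inverse_ar_cancel[OF inverse_ar_sym[OF assms(1)]]
  by (intro inverse_arI) auto

lemma inverse_ar_ident: "A \<in> Ob C \<Longrightarrow> inverse_ar C (ident C A) (ident C A)"
  by (intro inverse_arI) auto

section \<open>Pushout squares: introduction, pasting, transport along isomorphisms\<close>

lemma is_pushoutI:
  assumes base: "f \<in> Ar C" "g \<in> Ar C" "Dom C f = Dom C g" "i \<in> Ar C" "j \<in> Ar C"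
    "Dom C i = Cod C f" "Dom C j = Cod C g" "Cod C i = Cod C j" "i \<cdot> f = j \<cdot> g"
    and ex: "\<And>u v. u \<in> Ar C \<Longrightarrow> v \<in> Ar C \<Longrightarrow> Dom C u = Cod C f \<Longrightarrow> Dom C v = Cod C g \<Longrightarrow>
       Cod C u = Cod C v \<Longrightarrow> u \<cdot> f = v \<cdot> g \<Longrightarrow>
       \<exists>h. h \<in> Ar C \<and> Dom C h = Cod C i \<and> Cod C h = Cod C u \<and> h \<cdot> i = u \<and> h \<cdot> j = v"
    and un: "\<And>h k. h \<in> Ar C \<Longrightarrow> k \<in> Ar C \<Longrightarrow> Dom C h = Cod C i \<Longrightarrow> Dom C k = Cod C i \<Longrightarrow>
       Cod C h = Cod C k \<Longrightarrow> h \<cdot> i = k \<cdot> i \<Longrightarrow> h \<cdot> j = k \<cdot> j \<Longrightarrow> h = k"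
  shows "is_pushout C f g i j"
proof -
  have "\<exists>!h. h \<in> Hom C (Cod C i) X \<and> h \<cdot> i = u \<and> h \<cdot> j = v"
    if "u \<in> Hom C (Cod C f) X \<and> v \<in> Hom C (Cod C g) X \<and> u \<cdot> f = v \<cdot> g" for X u v
  proof -
    have "\<exists>h. h \<in> Ar C \<and> Dom C h = Cod C i \<and> Cod C h = Cod C u \<and> h \<cdot> i = u \<and> h \<cdot> j = v"
      by (rule ex) (use that in \<open>simp_all add: Hom_def\<close>)
    then obtain h where h: "h \<in> Ar C" "Dom C h = Cod C i" "Cod C h = Cod C u" "h \<cdot> i = u" "h \<cdot> j = v"
      by blast
    show ?thesis
    proof (rule ex1I)
      show "h \<in> Hom C (Cod C i) X \<and> h \<cdot> i = u \<and> h \<cdot> j = v"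
        using h that by (simp add: Hom_def)
      fix k assume "k \<in> Hom C (Cod C i) X \<and> k \<cdot> i = u \<and> k \<cdot> j = v"
      then show "k = h"
        using h that by (rule_tac un) (simp_all add: Hom_def)
    qed
  qed
  moreover have "i \<in> Hom C (Cod C f) (Cod C i)" "j \<in> Hom C (Cod C g) (Cod C i)"
    using base by (simp_all add: Hom_def)
  ultimately show ?thesis
    unfolding is_pushout_def using base(1-3,9) by blast
qed

lemma is_pushoutD:
  assumes "is_pushout C f g i j"
  shows "f \<in> Ar C" "g \<in> Ar C" "Dom C f = Dom C g" "i \<in> Ar C" "j \<in> Ar C"
    "Dom C i = Cod C f" "Dom C j = Cod C g" "Cod C i = Cod C j" "i \<cdot> f = j \<cdot> g"
  using assms by (auto simp: is_pushout_def Hom_def)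

lemma is_pushout_ex:
  assumes "is_pushout C f g i j" "u \<in> Ar C" "v \<in> Ar C" "Dom C u = Cod C f" "Dom C v = Cod C g"
    "Cod C u = Cod C v" "u \<cdot> f = v \<cdot> g"
  obtains h where "h \<in> Ar C" "Dom C h = Cod C i" "Cod C h = Cod C u" "h \<cdot> i = u" "h \<cdot> j = v"
proof -
  obtain P where P: "i \<in> Hom C (Cod C f) P"
    "\<And>X u v. u \<in> Hom C (Cod C f) X \<Longrightarrow> v \<in> Hom C (Cod C g) X \<Longrightarrow> u \<cdot> f = v \<cdot> g \<Longrightarrow>
          \<exists>!h. h \<in> Hom C P X \<and> h \<cdot> i = u \<and> h \<cdot> j = v"
    using assms(1) by (auto simp: is_pushout_def)
  obtain h where "h \<in> Hom C P (Cod C u) \<and> h \<cdot> i = u \<and> h \<cdot> j = v"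
    using P(2)[of u "Cod C u" v] assms by (auto simp: Hom_def)
  then show ?thesis using P(1) that[of h] by (auto simp: Hom_def)
qed

text \<open>The two coprojections of a pushout are jointly epic; the apex of the definition is
  necessarily \<open>Cod C i\<close>.\<close>

lemma is_pushout_eqI:
  assumes po: "is_pushout C f g i j" and "h \<in> Ar C" "k \<in> Ar C" "Dom C h = Cod C i" "Dom C k = Cod C i"
    "Cod C h = Cod C k" "h \<cdot> i = k \<cdot> i" "h \<cdot> j = k \<cdot> j"
  shows "h = k"
proof -
  note D = is_pushoutD[OF po]
  obtain P where P: "i \<in> Hom C (Cod C f) P"
    "\<And>X u v. u \<in> Hom C (Cod C f) X \<Longrightarrow> v \<in> Hom C (Cod C g) X \<Longrightarrow> u \<cdot> f = v \<cdot> g \<Longrightarrow>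
          \<exists>!h. h \<in> Hom C P X \<and> h \<cdot> i = u \<and> h \<cdot> j = v"
    using po by (auto simp: is_pushout_def)
  have "\<exists>!l. l \<in> Hom C P (Cod C h) \<and> l \<cdot> i = h \<cdot> i \<and> l \<cdot> j = h \<cdot> j"
    by (rule P(2)) (use assms D in \<open>auto simp: Hom_def\<close>)
  moreover have "P = Cod C i" using P(1) by (simp add: Hom_def)
  ultimately show ?thesis using assms by (auto simp: Hom_def)
qed

lemma is_pushout_sym:
  assumes po: "is_pushout C f g i j"
  shows "is_pushout C g f j i"
proof (rule is_pushoutI)
  note D = is_pushoutD[OF po]
  fix u v assume "u \<in> Ar C" "v \<in> Ar C" "Dom C u = Cod C g" "Dom C v = Cod C f"
       "Cod C u = Cod C v" "u \<cdot> g = v \<cdot> f"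
  then obtain h where "h \<in> Ar C" "Dom C h = Cod C i" "Cod C h = Cod C v" "h \<cdot> i = v" "h \<cdot> j = u"
    using is_pushout_ex[OF po, of v u] by metis
  then show "\<exists>h. h \<in> Ar C \<and> Dom C h = Cod C j \<and> Cod C h = Cod C u \<and> h \<cdot> j = u \<and> h \<cdot> i = v"
    using D \<open>Cod C u = Cod C v\<close> by metis
next
  note D = is_pushoutD[OF po]
  fix h k assume "h \<in> Ar C" "k \<in> Ar C" "Dom C h = Cod C j" "Dom C k = Cod C j"
       "Cod C h = Cod C k" "h \<cdot> j = k \<cdot> j" "h \<cdot> i = k \<cdot> i"
  then show "h = k" using D by (rule_tac is_pushout_eqI[OF po]) auto
qed (use is_pushoutD[OF po] in auto)

text \<open>The pasting law for two adjacent squares. It is what makes composition of cospans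
  associative.\<close>

lemma is_pushout_paste:
  assumes po: "is_pushout C f g i j" and po': "is_pushout C j h k l"
  shows "is_pushout C f (h \<cdot> g) (k \<cdot> i) l"
proof (rule is_pushoutI)
  note [simp] = is_pushoutD[OF po] is_pushoutD[OF po']
  have [simp]: "Dom C h = Cod C g" using is_pushoutD(7)[OF po] is_pushoutD(3)[OF po'] by simp
  have kj: "k \<cdot> j \<cdot> x = l \<cdot> h \<cdot> x" if "x \<in> Ar C" "Cod C x = Dom C j" for x
    by (rule comp_swap) (use that in simp_all)
  show "(k \<cdot> i) \<cdot> f = l \<cdot> h \<cdot> g"
    using kj[of g] by simp
  fix u v assume u: "u \<in> Ar C" "v \<in> Ar C" "Dom C u = Cod C f" "Dom C v = Cod C (h \<cdot> g)"
       "Cod C u = Cod C v" "u \<cdot> f = v \<cdot> h \<cdot> g"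
  obtain m where m: "m \<in> Ar C" "Dom C m = Cod C i" "Cod C m = Cod C u" "m \<cdot> i = u" "m \<cdot> j = v \<cdot> h"
    by (rule is_pushout_ex[OF po, of u "v \<cdot> h"]) (use u in simp_all)
  obtain n where n: "n \<in> Ar C" "Dom C n = Cod C k" "Cod C n = Cod C m" "n \<cdot> k = m" "n \<cdot> l = v"
    by (rule is_pushout_ex[OF po', of m v]) (use u m in simp_all)
  have "n \<cdot> k \<cdot> i = u"
    using n m arr_assoc[of i k n] by simp
  then show "\<exists>n. n \<in> Ar C \<and> Dom C n = Cod C (k \<cdot> i) \<and> Cod C n = Cod C u \<and> n \<cdot> k \<cdot> i = u \<and> n \<cdot> l = v"
    using n m by (intro exI[of _ n]) simp
next
  note [simp] = is_pushoutD[OF po] is_pushoutD[OF po']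
  fix m n assume m: "m \<in> Ar C" "n \<in> Ar C" "Dom C m = Cod C (k \<cdot> i)" "Dom C n = Cod C (k \<cdot> i)"
       "Cod C m = Cod C n" "m \<cdot> k \<cdot> i = n \<cdot> k \<cdot> i" "m \<cdot> l = n \<cdot> l"
  have "m \<cdot> l \<cdot> h = n \<cdot> l \<cdot> h"
    by (rule comp_swap) (use m in simp_all)
  then have "m \<cdot> k = n \<cdot> k"
    by (rule_tac is_pushout_eqI[OF po]) (use m in simp_all)
  then show "m = n"
    by (rule_tac is_pushout_eqI[OF po']) (use m in simp_all)
qed (use is_pushoutD[OF po] is_pushoutD[OF po'] in simp_all)

lemma is_pushout_unique:
  assumes po: "is_pushout C f g i j" and po': "is_pushout C f g i' j'"
  obtains h h' where "inverse_ar C h h'" "Dom C h = Cod C i" "h \<cdot> i = i'" "h \<cdot> j = j'"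
proof -
  note [simp] = is_pushoutD[OF po] is_pushoutD[OF po']
  obtain h where h: "h \<in> Ar C" "Dom C h = Cod C i" "Cod C h = Cod C i'" "h \<cdot> i = i'" "h \<cdot> j = j'"
    by (rule is_pushout_ex[OF po, of i' j']) simp_all
  obtain h' where h': "h' \<in> Ar C" "Dom C h' = Cod C i'" "Cod C h' = Cod C i" "h' \<cdot> i' = i" "h' \<cdot> j' = j"
    by (rule is_pushout_ex[OF po', of i j]) simp_all
  have "h' \<cdot> h = ident C (Cod C i)"
    by (rule is_pushout_eqI[OF po]) (use h h' in simp_all)
  moreover have "h \<cdot> h' = ident C (Cod C i')"
    by (rule is_pushout_eqI[OF po']) (use h h' in simp_all)
  ultimately have "inverse_ar C h h'"
    using h h' by (intro inverse_arI) simp_all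
  then show ?thesis using that h by blast
qed

text \<open>Together with \<open>is_pushout_unique\<close> this says that the pushouts of a span are
  exactly the isomorphic copies of any one of them, as needed for a composition that collects all
  pushouts.\<close>

lemma is_pushout_inverse_ar:
  assumes po: "is_pushout C f g i j" and "inverse_ar C h h'" "Dom C h = Cod C i"
  shows "is_pushout C f g (h \<cdot> i) (h \<cdot> j)"
proof (rule is_pushoutI)
  note [simp] = is_pushoutD[OF po] inverse_arD[OF assms(2)] assms(3) inverse_ar_cancel[OF assms(2)]
  fix u v assume u: "u \<in> Ar C" "v \<in> Ar C" "Dom C u = Cod C f" "Dom C v = Cod C g"
       "Cod C u = Cod C v" "u \<cdot> f = v \<cdot> g"
  obtain m where m: "m \<in> Ar C" "Dom C m = Cod C i" "Cod C m = Cod C u" "m \<cdot> i = u" "m \<cdot> j = v"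
    by (rule is_pushout_ex[OF po, of u v]) (use u in simp_all)
  then show "\<exists>m. m \<in> Ar C \<and> Dom C m = Cod C (h \<cdot> i) \<and> Cod C m = Cod C u \<and> m \<cdot> h \<cdot> i = u \<and> m \<cdot> h \<cdot> j = v"
    by (intro exI[of _ "m \<cdot> h'"]) simp
next
  note [simp] = is_pushoutD[OF po] inverse_arD[OF assms(2)] assms(3) inverse_ar_cancel[OF assms(2)]
  fix m n assume m: "m \<in> Ar C" "n \<in> Ar C" "Dom C m = Cod C (h \<cdot> i)" "Dom C n = Cod C (h \<cdot> i)"
       "Cod C m = Cod C n" "m \<cdot> h \<cdot> i = n \<cdot> h \<cdot> i" "m \<cdot> h \<cdot> j = n \<cdot> h \<cdot> j"
  have "m \<cdot> h = n \<cdot> h"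
    by (rule is_pushout_eqI[OF po]) (use m in simp_all)
  then have "m \<cdot> h \<cdot> h' = n \<cdot> h \<cdot> h'"
    by (rule_tac comp_swap) (use m in simp_all)
  then show "m = n"
    using m by simp
qed (use is_pushoutD[OF po] inverse_arD[OF assms(2)] assms(3) in simp_all)

text \<open>Changing representatives of two composable cospans applies isomorphisms \<open>h\<close>
  and \<open>k\<close> to their apexes, hence to the targets of the span in the middle; the
  coprojections absorb the inverses.\<close>

lemma is_pushout_change_apex:
  assumes po: "is_pushout C f g i j" and h: "inverse_ar C h h'" "Dom C h = Cod C f"
    and k: "inverse_ar C k k'" "Dom C k = Cod C g"
  shows "is_pushout C (h \<cdot> f) (k \<cdot> g) (i \<cdot> h') (j \<cdot> k')"
proof (rule is_pushoutI)
  note [simp] = is_pushoutD[OF po] inverse_arD[OF h(1)] inverse_arD[OF k(1)] h(2) k(2)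
    inverse_ar_cancel[OF h(1)] inverse_ar_cancel[OF k(1)]
  show "(i \<cdot> h') \<cdot> h \<cdot> f = (j \<cdot> k') \<cdot> k \<cdot> g" by simp
  fix u v assume u: "u \<in> Ar C" "v \<in> Ar C" "Dom C u = Cod C (h \<cdot> f)" "Dom C v = Cod C (k \<cdot> g)"
       "Cod C u = Cod C v" "u \<cdot> h \<cdot> f = v \<cdot> k \<cdot> g"
  obtain m where m: "m \<in> Ar C" "Dom C m = Cod C i" "Cod C m = Cod C u" "m \<cdot> i = u \<cdot> h" "m \<cdot> j = v \<cdot> k"
    by (rule is_pushout_ex[OF po, of "u \<cdot> h" "v \<cdot> k"]) (use u in simp_all)
  have "m \<cdot> i \<cdot> h' = u \<cdot> h \<cdot> h'" "m \<cdot> j \<cdot> k' = v \<cdot> k \<cdot> k'"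
    by (rule comp_swap; use u m in simp)+
  then show "\<exists>m. m \<in> Ar C \<and> Dom C m = Cod C (i \<cdot> h') \<and> Cod C m = Cod C u
      \<and> m \<cdot> i \<cdot> h' = u \<and> m \<cdot> j \<cdot> k' = v"
    using m u by (intro exI[of _ m]) simp
next
  note [simp] = is_pushoutD[OF po] inverse_arD[OF h(1)] inverse_arD[OF k(1)] h(2) k(2)
    inverse_ar_cancel[OF h(1)] inverse_ar_cancel[OF k(1)]
  fix m n assume m: "m \<in> Ar C" "n \<in> Ar C" "Dom C m = Cod C (i \<cdot> h')" "Dom C n = Cod C (i \<cdot> h')"
       "Cod C m = Cod C n" "m \<cdot> i \<cdot> h' = n \<cdot> i \<cdot> h'" "m \<cdot> j \<cdot> k' = n \<cdot> j \<cdot> k'"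
  have "(m \<cdot> i \<cdot> h') \<cdot> h = (n \<cdot> i \<cdot> h') \<cdot> h" "(m \<cdot> j \<cdot> k') \<cdot> k = (n \<cdot> j \<cdot> k') \<cdot> k"
    by (simp_all only: m(6,7))
  then have "m \<cdot> i = n \<cdot> i" "m \<cdot> j = n \<cdot> j"
    using m(1-5) by simp_all
  then show "m = n"
    by (rule_tac is_pushout_eqI[OF po]) (use m(1-5) in simp_all)
qed (use is_pushoutD[OF po] inverse_arD[OF h(1)] inverse_arD[OF k(1)] h(2) k(2) in simp_all)

text \<open>Pushing out along an identity changes nothing, so composing with \<open>vec\<close> on
  one side or \<open>opp\<close> on the other will reduce to composing a single leg.\<close>

lemma is_pushout_ident_left:
  assumes "g \<in> Ar C"
  shows "is_pushout C (ident C (Dom C g)) g g (ident C (Cod C g))"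
  using assms by (intro is_pushoutI) auto

lemma is_pushout_ident_right:
  assumes "g \<in> Ar C"
  shows "is_pushout C g (ident C (Dom C g)) (ident C (Cod C g)) g"
  using is_pushout_sym[OF is_pushout_ident_left[OF assms]] .

end

section \<open>Chosen sums\<close>

locale category_with_sums = category C
  for C :: "('o, 'a, 'z) cat_scheme" (structure) +
  fixes S :: "('o, 'a) sum_choice"
  assumes sums: "chosen_sums C S"
begin

lemma zero_in [simp]: "zero_ob S \<in> Ob C"
  using sums by (simp add: chosen_sums_def is_initial_def)

lemma from_zero_in [simp]:
  assumes "A \<in> Ob C"
  shows "from_zero C S A \<in> Ar C" "Dom C (from_zero C S A) = zero_ob S" "Cod C (from_zero C S A) = A"
proof -
  have "\<exists>!h. h \<in> Hom C (zero_ob S) A"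
    using sums assms by (simp add: chosen_sums_def is_initial_def)
  then have "from_zero C S A \<in> Hom C (zero_ob S) A"
    unfolding from_zero_def by (rule theI')
  then show "from_zero C S A \<in> Ar C" "Dom C (from_zero C S A) = zero_ob S" "Cod C (from_zero C S A) = A"
    by (simp_all add: Hom_def)
qed

lemma zero_eqI:
  assumes "f \<in> Ar C" "g \<in> Ar C" "Dom C f = zero_ob S" "Dom C g = zero_ob S" "Cod C f = Cod C g"
  shows "f = g"
proof -
  have "\<exists>!h. h \<in> Hom C (zero_ob S) (Cod C f)"
    using sums assms by (simp add: chosen_sums_def is_initial_def)
  then show ?thesis
    using assms by (auto simp: Hom_def)
qed

lemma comp_from_zero [simp]:
  assumes "A \<in> Ob C" "f \<in> Ar C" "Dom C f = A"
  shows "f \<cdot> from_zero C S A = from_zero C S (Cod C f)"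
  using assms by (intro zero_eqI) auto

lemma binary_sum: "A \<in> Ob C \<Longrightarrow> B \<in> Ob C \<Longrightarrow>
    is_binary_sum C A B (sum_ob S A B) (inj1 S A B) (inj2 S A B)"
  using sums by (simp add: chosen_sums_def)

lemma sum_in [simp]: "A \<in> Ob C \<Longrightarrow> B \<in> Ob C \<Longrightarrow> sum_ob S A B \<in> Ob C"
  using binary_sum by (auto simp: is_binary_sum_def)

lemma inj_in [simp]:
  assumes "A \<in> Ob C" "B \<in> Ob C"
  shows "inj1 S A B \<in> Ar C" "Dom C (inj1 S A B) = A" "Cod C (inj1 S A B) = sum_ob S A B"
    "inj2 S A B \<in> Ar C" "Dom C (inj2 S A B) = B" "Cod C (inj2 S A B) = sum_ob S A B"
  using binary_sum[OF assms] by (auto simp: is_binary_sum_def Hom_def)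

lemma sum_eqI:
  assumes "f \<cdot> inj1 S A B = g \<cdot> inj1 S A B" "f \<cdot> inj2 S A B = g \<cdot> inj2 S A B"
    and "A \<in> Ob C" "B \<in> Ob C" "f \<in> Ar C" "g \<in> Ar C" "Dom C f = sum_ob S A B" "Dom C g = sum_ob S A B"
    "Cod C f = Cod C g"
  shows "f = g"
proof -
  have "f \<cdot> inj1 S A B \<in> Hom C A (Cod C f) \<and> f \<cdot> inj2 S A B \<in> Hom C B (Cod C f)"
    using assms(3-9) by (simp add: Hom_def)
  then have "\<exists>!h. h \<in> Hom C (sum_ob S A B) (Cod C f) \<and> h \<cdot> inj1 S A B = f \<cdot> inj1 S A B
     \<and> h \<cdot> inj2 S A B = f \<cdot> inj2 S A B"
    using binary_sum[OF assms(3,4)] unfolding is_binary_sum_def by blast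
  moreover have "f \<in> Hom C (sum_ob S A B) (Cod C f)" "g \<in> Hom C (sum_ob S A B) (Cod C f)"
    using assms(5-9) by (simp_all add: Hom_def)
  ultimately show ?thesis using assms(1,2) by metis
qed

lemma copair_props:
  assumes "f \<in> Ar C" "g \<in> Ar C" "Cod C f = Cod C g"
  shows "copair C S f g \<in> Hom C (sum_ob S (Dom C f) (Dom C g)) (Cod C f) \<and>
     copair C S f g \<cdot> inj1 S (Dom C f) (Dom C g) = f \<and> copair C S f g \<cdot> inj2 S (Dom C f) (Dom C g) = g"
proof -
  have "f \<in> Hom C (Dom C f) (Cod C f) \<and> g \<in> Hom C (Dom C g) (Cod C f)"
    using assms by (simp add: Hom_def)
  then have "\<exists>!h. h \<in> Hom C (sum_ob S (Dom C f) (Dom C g)) (Cod C f) \<and>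
     h \<cdot> inj1 S (Dom C f) (Dom C g) = f \<and> h \<cdot> inj2 S (Dom C f) (Dom C g) = g"
    using binary_sum[OF arr_Dom[OF assms(1)] arr_Dom[OF assms(2)]] unfolding is_binary_sum_def by blast
  then show ?thesis
    unfolding copair_def by (rule theI')
qed

lemma copair_in [simp]:
  assumes "f \<in> Ar C" "g \<in> Ar C" "Cod C f = Cod C g"
  shows "copair C S f g \<in> Ar C" "Dom C (copair C S f g) = sum_ob S (Dom C f) (Dom C g)"
    "Cod C (copair C S f g) = Cod C f"
  using copair_props[OF assms] by (auto simp: Hom_def)

lemma copair_inj [simp]:
  assumes "f \<in> Ar C" "g \<in> Ar C" "Cod C f = Cod C g" "Dom C f = A" "Dom C g = B"
  shows "copair C S f g \<cdot> inj1 S A B = f" "copair C S f g \<cdot> inj2 S A B = g"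
  using copair_props[OF assms(1-3)] assms by auto

text \<open>Variant for right-nested composites, where \<open>arr_assoc\<close> has hidden the redex
  in front of a further factor \<open>x\<close>. With these rules an equation between arrows out of
  nested sums is settled by repeated \<open>sum_eqI\<close> and simplification.\<close>

lemma copair_inj_comp [simp]:
  assumes "f \<in> Ar C" "g \<in> Ar C" "Cod C f = Cod C g" "Dom C f = A" "Dom C g = B" "x \<in> Ar C"
  shows "Cod C x = A \<Longrightarrow> copair C S f g \<cdot> inj1 S A B \<cdot> x = f \<cdot> x"
    "Cod C x = B \<Longrightarrow> copair C S f g \<cdot> inj2 S A B \<cdot> x = g \<cdot> x"
  using copair_inj[OF assms(1-5)] assms arr_assoc[of x "inj1 S A B" "copair C S f g"]
    arr_assoc[of x "inj2 S A B" "copair C S f g"] by (auto simp: arr_Dom)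

lemma sum_ar_in [simp]:
  assumes "f \<in> Ar C" "g \<in> Ar C"
  shows "sum_ar C S f g \<in> Ar C" "Dom C (sum_ar C S f g) = sum_ob S (Dom C f) (Dom C g)"
    "Cod C (sum_ar C S f g) = sum_ob S (Cod C f) (Cod C g)"
  using assms by (auto simp: sum_ar_def)

lemma sum_ar_inj [simp]:
  assumes "f \<in> Ar C" "g \<in> Ar C" "Dom C f = A" "Dom C g = B"
  shows "sum_ar C S f g \<cdot> inj1 S A B = inj1 S (Cod C f) (Cod C g) \<cdot> f"
    "sum_ar C S f g \<cdot> inj2 S A B = inj2 S (Cod C f) (Cod C g) \<cdot> g"
  using assms by (auto simp: sum_ar_def)

lemma sum_ar_inj_comp [simp]:
  assumes "f \<in> Ar C" "g \<in> Ar C" "Dom C f = A" "Dom C g = B" "x \<in> Ar C"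
  shows "Cod C x = A \<Longrightarrow> sum_ar C S f g \<cdot> inj1 S A B \<cdot> x = inj1 S (Cod C f) (Cod C g) \<cdot> f \<cdot> x"
    "Cod C x = B \<Longrightarrow> sum_ar C S f g \<cdot> inj2 S A B \<cdot> x = inj2 S (Cod C f) (Cod C g) \<cdot> g \<cdot> x"
  using assms by (auto simp: sum_ar_def)

lemma codiag_in [simp]:
  assumes "A \<in> Ob C"
  shows "codiag C S A \<in> Ar C" "Dom C (codiag C S A) = sum_ob S A A" "Cod C (codiag C S A) = A"
  using assms by (auto simp: codiag_def)

lemma codiag_inj [simp]:
  assumes "A \<in> Ob C"
  shows "codiag C S A \<cdot> inj1 S A A = ident C A" "codiag C S A \<cdot> inj2 S A A = ident C A"
  using assms by (auto simp: codiag_def)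

lemma codiag_inj_comp [simp]:
  assumes "A \<in> Ob C" "x \<in> Ar C" "Cod C x = A"
  shows "codiag C S A \<cdot> inj1 S A A \<cdot> x = x" "codiag C S A \<cdot> inj2 S A A \<cdot> x = x"
  using assms by (auto simp: codiag_def)

lemma sum_ar_comp:
  assumes "f \<in> Ar C" "g \<in> Ar C" "f' \<in> Ar C" "g' \<in> Ar C" "Dom C g = Cod C f" "Dom C g' = Cod C f'"
  shows "sum_ar C S (g \<cdot> f) (g' \<cdot> f') = sum_ar C S g g' \<cdot> sum_ar C S f f'"
  by (rule sum_eqI[of _ "Dom C f" "Dom C f'"]) (use assms in auto)

lemma sum_ar_ident:
  assumes "A \<in> Ob C" "B \<in> Ob C"
  shows "sum_ar C S (ident C A) (ident C B) = ident C (sum_ob S A B)"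
  by (rule sum_eqI[of _ A B]) (use assms in auto)

lemma inverse_ar_sum:
  assumes "inverse_ar C f f'" "inverse_ar C g g'"
  shows "inverse_ar C (sum_ar C S f g) (sum_ar C S f' g')"
proof -
  note [simp] = inverse_arD[OF assms(1)] inverse_arD[OF assms(2)]
  show ?thesis
    by (rule inverse_arI) (auto simp: sum_ar_comp[symmetric] sum_ar_ident)
qed

text \<open>Colimits commute with colimits: the mediating arrow out of the sum of two pushouts is
  the copair of the two mediating arrows. This is the interchange law of tensor and composition of
  cospans.\<close>

lemma is_pushout_sum:
  assumes po: "is_pushout C f g i j" and po': "is_pushout C f' g' i' j'"
  shows "is_pushout C (sum_ar C S f f') (sum_ar C S g g') (sum_ar C S i i') (sum_ar C S j j')"
proof (rule is_pushoutI)
  note [simp] = is_pushoutD[OF po] is_pushoutD[OF po']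
  show "sum_ar C S i i' \<cdot> sum_ar C S f f' = sum_ar C S j j' \<cdot> sum_ar C S g g'"
    by (simp add: sum_ar_comp[symmetric])
  fix u v assume u: "u \<in> Ar C" "v \<in> Ar C" "Dom C u = Cod C (sum_ar C S f f')"
    "Dom C v = Cod C (sum_ar C S g g')" "Cod C u = Cod C v" "u \<cdot> sum_ar C S f f' = v \<cdot> sum_ar C S g g'"
  have "u \<cdot> sum_ar C S f f' \<cdot> inj1 S (Dom C f) (Dom C f') = v \<cdot> sum_ar C S g g' \<cdot> inj1 S (Dom C f) (Dom C f')"
    "u \<cdot> sum_ar C S f f' \<cdot> inj2 S (Dom C f) (Dom C f') = v \<cdot> sum_ar C S g g' \<cdot> inj2 S (Dom C f) (Dom C f')"
    by (rule comp_swap[OF u(6)]; use u(1-5) in simp)+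
  then have 1: "u \<cdot> inj1 S (Cod C f) (Cod C f') \<cdot> f = v \<cdot> inj1 S (Cod C g) (Cod C g') \<cdot> g"
    and 2: "u \<cdot> inj2 S (Cod C f) (Cod C f') \<cdot> f' = v \<cdot> inj2 S (Cod C g) (Cod C g') \<cdot> g'"
    by simp_all
  obtain m where m: "m \<in> Ar C" "Dom C m = Cod C i" "Cod C m = Cod C u"
    "m \<cdot> i = u \<cdot> inj1 S (Cod C f) (Cod C f')" "m \<cdot> j = v \<cdot> inj1 S (Cod C g) (Cod C g')"
    by (rule is_pushout_ex[OF po, of "u \<cdot> inj1 S (Cod C f) (Cod C f')" "v \<cdot> inj1 S (Cod C g) (Cod C g')"])
      (use u(1-5) 1 in simp_all)
  obtain n where n: "n \<in> Ar C" "Dom C n = Cod C i'" "Cod C n = Cod C u"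
    "n \<cdot> i' = u \<cdot> inj2 S (Cod C f) (Cod C f')" "n \<cdot> j' = v \<cdot> inj2 S (Cod C g) (Cod C g')"
    by (rule is_pushout_ex[OF po', of "u \<cdot> inj2 S (Cod C f) (Cod C f')" "v \<cdot> inj2 S (Cod C g) (Cod C g')"])
      (use u(1-5) 2 in simp_all)
  have "copair C S m n \<cdot> sum_ar C S i i' = u"
    by (rule sum_eqI[of _ "Cod C f" "Cod C f'"]) (use u(1-5) m n in simp_all)
  moreover have "copair C S m n \<cdot> sum_ar C S j j' = v"
    by (rule sum_eqI[of _ "Cod C g" "Cod C g'"]) (use u(1-5) m n in simp_all)
  ultimately show "\<exists>h. h \<in> Ar C \<and> Dom C h = Cod C (sum_ar C S i i') \<and> Cod C h = Cod C u \<and>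
      h \<cdot> sum_ar C S i i' = u \<and> h \<cdot> sum_ar C S j j' = v"
    using m n by (intro exI[of _ "copair C S m n"]) simp
next
  note [simp] = is_pushoutD[OF po] is_pushoutD[OF po']
  fix m n assume m: "m \<in> Ar C" "n \<in> Ar C" "Dom C m = Cod C (sum_ar C S i i')"
    "Dom C n = Cod C (sum_ar C S i i')" "Cod C m = Cod C n"
    "m \<cdot> sum_ar C S i i' = n \<cdot> sum_ar C S i i'" "m \<cdot> sum_ar C S j j' = n \<cdot> sum_ar C S j j'"
  have "m \<cdot> sum_ar C S i i' \<cdot> inj1 S (Cod C f) (Cod C f') = n \<cdot> sum_ar C S i i' \<cdot> inj1 S (Cod C f) (Cod C f')"
    "m \<cdot> sum_ar C S i i' \<cdot> inj2 S (Cod C f) (Cod C f') = n \<cdot> sum_ar C S i i' \<cdot> inj2 S (Cod C f) (Cod C f')"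
    "m \<cdot> sum_ar C S j j' \<cdot> inj1 S (Cod C g) (Cod C g') = n \<cdot> sum_ar C S j j' \<cdot> inj1 S (Cod C g) (Cod C g')"
    "m \<cdot> sum_ar C S j j' \<cdot> inj2 S (Cod C g) (Cod C g') = n \<cdot> sum_ar C S j j' \<cdot> inj2 S (Cod C g) (Cod C g')"
    by (rule comp_swap[OF m(6)] comp_swap[OF m(7)]; use m(1-5) in simp)+
  then have e: "m \<cdot> inj1 S (Cod C i) (Cod C i') \<cdot> i = n \<cdot> inj1 S (Cod C i) (Cod C i') \<cdot> i"
    "m \<cdot> inj2 S (Cod C i) (Cod C i') \<cdot> i' = n \<cdot> inj2 S (Cod C i) (Cod C i') \<cdot> i'"
    "m \<cdot> inj1 S (Cod C i) (Cod C i') \<cdot> j = n \<cdot> inj1 S (Cod C i) (Cod C i') \<cdot> j"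
    "m \<cdot> inj2 S (Cod C i) (Cod C i') \<cdot> j' = n \<cdot> inj2 S (Cod C i) (Cod C i') \<cdot> j'"
    by simp_all
  have "m \<cdot> inj1 S (Cod C i) (Cod C i') = n \<cdot> inj1 S (Cod C i) (Cod C i')"
    by (rule is_pushout_eqI[OF po]) (use m(1-5) e in simp_all)
  moreover have "m \<cdot> inj2 S (Cod C i) (Cod C i') = n \<cdot> inj2 S (Cod C i) (Cod C i')"
    by (rule is_pushout_eqI[OF po']) (use m(1-5) e in simp_all)
  ultimately show "m = n"
    by (rule_tac sum_eqI) (use m(1-5) in simp_all)
qed (use is_pushoutD[OF po] is_pushoutD[OF po'] in simp_all)

section \<open>Associativity, unit and symmetry isomorphisms of sums\<close>

lemma sum_assoc_in [simp]:
  assumes "A \<in> Ob C" "B \<in> Ob C" "D \<in> Ob C"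
  shows "sum_assoc C S A B D \<in> Ar C" "Dom C (sum_assoc C S A B D) = sum_ob S (sum_ob S A B) D"
    "Cod C (sum_assoc C S A B D) = sum_ob S A (sum_ob S B D)"
  using assms by (auto simp: sum_assoc_def)

lemma sum_unit_in [simp]:
  assumes "A \<in> Ob C"
  shows "sum_lunit C S A \<in> Ar C" "Dom C (sum_lunit C S A) = sum_ob S (zero_ob S) A" "Cod C (sum_lunit C S A) = A"
    "sum_runit C S A \<in> Ar C" "Dom C (sum_runit C S A) = sum_ob S A (zero_ob S)" "Cod C (sum_runit C S A) = A"
  using assms by (auto simp: sum_lunit_def sum_runit_def)

lemma sum_symm_in [simp]:
  assumes "A \<in> Ob C" "B \<in> Ob C"
  shows "sum_symm C S A B \<in> Ar C" "Dom C (sum_symm C S A B) = sum_ob S A B"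
    "Cod C (sum_symm C S A B) = sum_ob S B A"
  using assms by (auto simp: sum_symm_def)

text \<open>The inverse of \<open>sum_assoc\<close> as a formula: \<open>inv_ar\<close> is only a
  description, while turning a \<open>vec\<close> into an \<open>opp\<close> and computing the
  second Frobenius square require an explicit inverse.\<close>

definition sum_unassoc :: "'o \<Rightarrow> 'o \<Rightarrow> 'o \<Rightarrow> 'a" where
  "sum_unassoc A B D = copair C S (inj1 S (sum_ob S A B) D \<cdot> inj1 S A B)
     (copair C S (inj1 S (sum_ob S A B) D \<cdot> inj2 S A B) (inj2 S (sum_ob S A B) D))"

lemma sum_unassoc_in [simp]:
  assumes "A \<in> Ob C" "B \<in> Ob C" "D \<in> Ob C"
  shows "sum_unassoc A B D \<in> Ar C" "Dom C (sum_unassoc A B D) = sum_ob S A (sum_ob S B D)"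
    "Cod C (sum_unassoc A B D) = sum_ob S (sum_ob S A B) D"
  using assms by (auto simp: sum_unassoc_def)

lemma sum_assoc_inverse:
  assumes "A \<in> Ob C" "B \<in> Ob C" "D \<in> Ob C"
  shows "inverse_ar C (sum_assoc C S A B D) (sum_unassoc A B D)"
proof (rule inverse_arI)
  show "sum_unassoc A B D \<cdot> sum_assoc C S A B D = ident C (Dom C (sum_assoc C S A B D))"
    by (rule sum_eqI[of _ "sum_ob S A B" D], rule sum_eqI[of _ A B])
      (use assms in \<open>simp_all add: sum_assoc_def sum_unassoc_def\<close>)
  show "sum_assoc C S A B D \<cdot> sum_unassoc A B D = ident C (Cod C (sum_assoc C S A B D))"
    by (rule sum_eqI[of _ A "sum_ob S B D"], rule_tac [2] sum_eqI[of _ B D])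
      (use assms in \<open>simp_all add: sum_assoc_def sum_unassoc_def\<close>)
qed (use assms in simp_all)

lemma sum_lunit_inverse:
  assumes "A \<in> Ob C"
  shows "inverse_ar C (sum_lunit C S A) (inj2 S (zero_ob S) A)"
proof (rule inverse_arI)
  \<comment> \<open>Both arrows leave the initial object. This makes the two sides agree on the
    first summand; the second is immediate.\<close>
  have "inj1 S (zero_ob S) A = from_zero C S (sum_ob S (zero_ob S) A)"
    using assms by (intro zero_eqI) simp_all
  then show "inj2 S (zero_ob S) A \<cdot> sum_lunit C S A = ident C (Dom C (sum_lunit C S A))"
    by (rule_tac sum_eqI[of _ "zero_ob S" A]) (use assms in \<open>simp_all add: sum_lunit_def\<close>)
qed (use assms in \<open>simp_all add: sum_lunit_def\<close>)

lemma sum_runit_inverse: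
  assumes "A \<in> Ob C"
  shows "inverse_ar C (sum_runit C S A) (inj1 S A (zero_ob S))"
proof (rule inverse_arI)
  have "inj2 S A (zero_ob S) = from_zero C S (sum_ob S A (zero_ob S))"
    using assms by (intro zero_eqI) simp_all
  then show "inj1 S A (zero_ob S) \<cdot> sum_runit C S A = ident C (Dom C (sum_runit C S A))"
    by (rule_tac sum_eqI[of _ A "zero_ob S"]) (use assms in \<open>simp_all add: sum_runit_def\<close>)
qed (use assms in \<open>simp_all add: sum_runit_def\<close>)

lemma sum_symm_symm:
  assumes "A \<in> Ob C" "B \<in> Ob C"
  shows "sum_symm C S B A \<cdot> sum_symm C S A B = ident C (sum_ob S A B)"
  by (rule sum_eqI[of _ A B]) (use assms in \<open>simp_all add: sum_symm_def\<close>)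

lemma sum_symm_inverse: "A \<in> Ob C \<Longrightarrow> B \<in> Ob C \<Longrightarrow> inverse_ar C (sum_symm C S A B) (sum_symm C S B A)"
  by (rule inverse_arI) (simp_all add: sum_symm_symm)

lemma sum_assoc_natural:
  assumes "f \<in> Ar C" "g \<in> Ar C" "h \<in> Ar C"
  shows "sum_assoc C S (Cod C f) (Cod C g) (Cod C h) \<cdot> sum_ar C S (sum_ar C S f g) h
    = sum_ar C S f (sum_ar C S g h) \<cdot> sum_assoc C S (Dom C f) (Dom C g) (Dom C h)"
  by (rule sum_eqI[of _ "sum_ob S (Dom C f) (Dom C g)" "Dom C h"], rule sum_eqI[of _ "Dom C f" "Dom C g"])
    (use assms in \<open>simp_all add: sum_assoc_def\<close>)

lemma sum_lunit_natural:
  assumes "f \<in> Ar C"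
  shows "sum_lunit C S (Cod C f) \<cdot> sum_ar C S (ident C (zero_ob S)) f = f \<cdot> sum_lunit C S (Dom C f)"
  by (rule sum_eqI[of _ "zero_ob S" "Dom C f"]) (use assms in \<open>simp_all add: sum_lunit_def\<close>)

lemma sum_runit_natural:
  assumes "f \<in> Ar C"
  shows "sum_runit C S (Cod C f) \<cdot> sum_ar C S f (ident C (zero_ob S)) = f \<cdot> sum_runit C S (Dom C f)"
  by (rule sum_eqI[of _ "Dom C f" "zero_ob S"]) (use assms in \<open>simp_all add: sum_runit_def\<close>)

lemma sum_symm_natural:
  assumes "f \<in> Ar C" "g \<in> Ar C"
  shows "sum_symm C S (Cod C f) (Cod C g) \<cdot> sum_ar C S f g = sum_ar C S g f \<cdot> sum_symm C S (Dom C f) (Dom C g)"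
  by (rule sum_eqI[of _ "Dom C f" "Dom C g"]) (use assms in \<open>simp_all add: sum_symm_def\<close>)

lemma sum_pentagon:
  assumes "A \<in> Ob C" "B \<in> Ob C" "D \<in> Ob C" "F \<in> Ob C"
  shows "sum_assoc C S A B (sum_ob S D F) \<cdot> sum_assoc C S (sum_ob S A B) D F
    = sum_ar C S (ident C A) (sum_assoc C S B D F) \<cdot> sum_assoc C S A (sum_ob S B D) F
      \<cdot> sum_ar C S (sum_assoc C S A B D) (ident C F)"
  by (rule sum_eqI[of _ "sum_ob S (sum_ob S A B) D" F], rule sum_eqI[of _ "sum_ob S A B" D],
      rule sum_eqI[of _ A B]) (use assms in \<open>simp_all add: sum_assoc_def\<close>)

lemma sum_triangle:
  assumes "A \<in> Ob C" "B \<in> Ob C"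
  shows "sum_ar C S (ident C A) (sum_lunit C S B) \<cdot> sum_assoc C S A (zero_ob S) B
    = sum_ar C S (sum_runit C S A) (ident C B)"
  by (rule sum_eqI[of _ "sum_ob S A (zero_ob S)" B], rule sum_eqI[of _ A "zero_ob S"])
    (use assms in \<open>simp_all add: sum_assoc_def sum_lunit_def sum_runit_def\<close>)

lemma sum_hexagon:
  assumes "A \<in> Ob C" "B \<in> Ob C" "D \<in> Ob C"
  shows "sum_assoc C S B D A \<cdot> sum_symm C S A (sum_ob S B D) \<cdot> sum_assoc C S A B D
    = sum_ar C S (ident C B) (sum_symm C S A D) \<cdot> sum_assoc C S B A D \<cdot> sum_ar C S (sum_symm C S A B) (ident C D)"
  by (rule sum_eqI[of _ "sum_ob S A B" D], rule sum_eqI[of _ A B])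
    (use assms in \<open>simp_all add: sum_assoc_def sum_symm_def\<close>)

section \<open>Codiagonals and the pushout squares behind the separable algebra laws\<close>

lemma codiag_assoc:
  assumes "A \<in> Ob C"
  shows "codiag C S A \<cdot> sum_ar C S (codiag C S A) (ident C A)
    = codiag C S A \<cdot> sum_ar C S (ident C A) (codiag C S A) \<cdot> sum_assoc C S A A A"
  by (rule sum_eqI[of _ "sum_ob S A A" A], rule sum_eqI[of _ A A])
    (use assms in \<open>simp_all add: sum_assoc_def\<close>)

lemma codiag_lunit:
  assumes "A \<in> Ob C"
  shows "codiag C S A \<cdot> sum_ar C S (from_zero C S A) (ident C A) = sum_lunit C S A"
  by (rule sum_eqI[of _ "zero_ob S" A]) (use assms in \<open>simp_all add: sum_lunit_def\<close>)

lemma codiag_runit: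
  assumes "A \<in> Ob C"
  shows "codiag C S A \<cdot> sum_ar C S (ident C A) (from_zero C S A) = sum_runit C S A"
  by (rule sum_eqI[of _ A "zero_ob S"]) (use assms in \<open>simp_all add: sum_runit_def\<close>)

lemma codiag_comm:
  assumes "A \<in> Ob C"
  shows "codiag C S A \<cdot> sum_symm C S A A = codiag C S A"
  by (rule sum_eqI[of _ A A]) (use assms in \<open>simp_all add: sum_symm_def\<close>)

text \<open>The codiagonal is split epic, with section \<open>inj1 S A A\<close>, and the pushout of
  an epimorphism with itself is trivial. This square is the separability law.\<close>

lemma is_pushout_codiag:
  assumes "A \<in> Ob C"
  shows "is_pushout C (codiag C S A) (codiag C S A) (ident C A) (ident C A)"
proof (rule is_pushoutI)
  fix u v assume u: "u \<in> Ar C" "v \<in> Ar C" "Dom C u = Cod C (codiag C S A)"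
    "Dom C v = Cod C (codiag C S A)" "Cod C u = Cod C v" "u \<cdot> codiag C S A = v \<cdot> codiag C S A"
  have "u \<cdot> codiag C S A \<cdot> inj1 S A A = v \<cdot> codiag C S A \<cdot> inj1 S A A"
    by (rule comp_swap[OF u(6)]) (use u(1-5) assms in simp_all)
  then have "u = v" using u(1-5) assms by simp
  then show "\<exists>h. h \<in> Ar C \<and> Dom C h = Cod C (ident C A) \<and> Cod C h = Cod C u \<and>
      h \<cdot> ident C A = u \<and> h \<cdot> ident C A = v"
    using u(1-5) assms by auto
qed (use assms in auto)

text \<open>Restricted to the three copies of \<open>A\<close>, commutativity of a competing square
  says that both components of \<open>u\<close> and both components of \<open>v\<close> are one and
  the same arrow \<open>A \<rightarrow> X\<close>. So \<open>u\<close> and \<open>v\<close> both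
  factor through the codiagonal, uniquely because it is split epic. The associativity isomorphism is
  part of the second leg so that both legs start at the same bracketing.\<close>

lemma is_pushout_frobenius:
  assumes A: "A \<in> Ob C"
  shows "is_pushout C (sum_ar C S (codiag C S A) (ident C A))
    (sum_ar C S (ident C A) (codiag C S A) \<cdot> sum_assoc C S A A A) (codiag C S A) (codiag C S A)"
    (is "is_pushout C ?f ?g ?d ?d")
proof (rule is_pushoutI)
  show "?d \<cdot> ?f = ?d \<cdot> ?g" by (rule codiag_assoc[OF A])
  fix u v assume u: "u \<in> Ar C" "v \<in> Ar C" "Dom C u = Cod C ?f" "Dom C v = Cod C ?g"
    "Cod C u = Cod C v" "u \<cdot> ?f = v \<cdot> ?g"
  let ?i = "inj1 S (sum_ob S A A) A" and ?j = "inj2 S (sum_ob S A A) A" and ?k = "inj1 S A A" and ?l = "inj2 S A A"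
  have "u \<cdot> ?f \<cdot> (?i \<cdot> ?k) = v \<cdot> ?g \<cdot> (?i \<cdot> ?k)" "u \<cdot> ?f \<cdot> (?i \<cdot> ?l) = v \<cdot> ?g \<cdot> (?i \<cdot> ?l)"
    "u \<cdot> ?f \<cdot> ?j = v \<cdot> ?g \<cdot> ?j"
    by (rule comp_swap[OF u(6)]; use u(1-5) A in simp)+
  then have e: "u \<cdot> ?k = v \<cdot> ?k" "u \<cdot> ?k = v \<cdot> ?l" "u \<cdot> ?l = v \<cdot> ?l"
    using u(1-5) A by (simp_all add: sum_assoc_def)
  have "(u \<cdot> ?k) \<cdot> ?d = u"
    by (rule sum_eqI[of _ A A]) (use u(1-5) e A in simp_all)
  moreover have "(u \<cdot> ?k) \<cdot> ?d = v"
    by (rule sum_eqI[of _ A A]) (use u(1-5) e A in simp_all)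
  ultimately show "\<exists>h. h \<in> Ar C \<and> Dom C h = Cod C ?d \<and> Cod C h = Cod C u \<and> h \<cdot> ?d = u \<and> h \<cdot> ?d = v"
    using u(1-5) A by (intro exI[of _ "u \<cdot> ?k"]) simp
next
  let ?k = "inj1 S A A"
  fix m n assume m: "m \<in> Ar C" "n \<in> Ar C" "Dom C m = Cod C ?d" "Dom C n = Cod C ?d"
    "Cod C m = Cod C n" "m \<cdot> ?d = n \<cdot> ?d"
  have "m \<cdot> ?d \<cdot> ?k = n \<cdot> ?d \<cdot> ?k"
    by (rule comp_swap[OF m(6)]) (use m(1-5) A in simp_all)
  then show "m = n" using m(1-5) A by simp
qed (use A in simp_all)

text \<open>Mirror image of \<open>is_pushout_frobenius\<close>, starting at the other bracketing
  and hence using the inverse associativity.\<close>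

lemma is_pushout_frobenius':
  assumes A: "A \<in> Ob C"
  shows "is_pushout C (sum_ar C S (ident C A) (codiag C S A))
    (sum_ar C S (codiag C S A) (ident C A) \<cdot> sum_unassoc A A A) (codiag C S A) (codiag C S A)"
    (is "is_pushout C ?f ?g ?d ?d")
proof (rule is_pushoutI)
  show "?d \<cdot> ?f = ?d \<cdot> ?g"
    by (rule sum_eqI[of _ A "sum_ob S A A"], rule_tac [2] sum_eqI[of _ A A])
      (use A in \<open>simp_all add: sum_unassoc_def\<close>)
  fix u v assume u: "u \<in> Ar C" "v \<in> Ar C" "Dom C u = Cod C ?f" "Dom C v = Cod C ?g"
    "Cod C u = Cod C v" "u \<cdot> ?f = v \<cdot> ?g"
  let ?i = "inj2 S A (sum_ob S A A)" and ?j = "inj1 S A (sum_ob S A A)" and ?k = "inj1 S A A" and ?l = "inj2 S A A"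
  have "u \<cdot> ?f \<cdot> (?i \<cdot> ?k) = v \<cdot> ?g \<cdot> (?i \<cdot> ?k)" "u \<cdot> ?f \<cdot> (?i \<cdot> ?l) = v \<cdot> ?g \<cdot> (?i \<cdot> ?l)"
    "u \<cdot> ?f \<cdot> ?j = v \<cdot> ?g \<cdot> ?j"
    by (rule comp_swap[OF u(6)]; use u(1-5) A in simp)+
  then have e: "u \<cdot> ?l = v \<cdot> ?k" "u \<cdot> ?l = v \<cdot> ?l" "u \<cdot> ?k = v \<cdot> ?k"
    using u(1-5) A by (simp_all add: sum_unassoc_def)
  have "(u \<cdot> ?k) \<cdot> ?d = u"
    by (rule sum_eqI[of _ A A]) (use u(1-5) e A in simp_all)
  moreover have "(u \<cdot> ?k) \<cdot> ?d = v"
    by (rule sum_eqI[of _ A A]) (use u(1-5) e A in simp_all)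
  ultimately show "\<exists>h. h \<in> Ar C \<and> Dom C h = Cod C ?d \<and> Cod C h = Cod C u \<and> h \<cdot> ?d = u \<and> h \<cdot> ?d = v"
    using u(1-5) A by (intro exI[of _ "u \<cdot> ?k"]) simp
next
  let ?k = "inj1 S A A"
  fix m n assume m: "m \<in> Ar C" "n \<in> Ar C" "Dom C m = Cod C ?d" "Dom C n = Cod C ?d"
    "Cod C m = Cod C n" "m \<cdot> ?d = n \<cdot> ?d"
  have "m \<cdot> ?d \<cdot> ?k = n \<cdot> ?d \<cdot> ?k"
    by (rule comp_swap[OF m(6)]) (use m(1-5) A in simp_all)
  then show "m = n" using m(1-5) A by simp
qed (use A in simp_all)

end

section \<open>Cospans\<close>

context category
begin

text \<open>The members of a class are the representative with an invertible arrow applied to both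
  legs. All arguments about independence of representatives use this form, with the inverse kept
  explicit.\<close>

lemma cospan_class_mem:
  assumes "f \<in> Ar C" "g \<in> Ar C" "Cod C f = Cod C g"
  shows "(f', g') \<in> cospan_class C (f, g) \<longleftrightarrow>
    (\<exists>h h'. inverse_ar C h h' \<and> Dom C h = Cod C f \<and> f' = h \<cdot> f \<and> g' = h \<cdot> g)"
    (is "?l \<longleftrightarrow> ?r")
proof
  assume ?l
  then show ?r
    unfolding cospan_class_def cospan_iso_def iso_def Hom_def by auto
next
  assume ?r
  then obtain h h' where h: "inverse_ar C h h'" "Dom C h = Cod C f" "f' = h \<cdot> f" "g' = h \<cdot> g"
    by blast
  note inverse_arD[OF h(1)]
  then have "(f', g') \<in> cospans C" "h \<in> Hom C (Cod C f) (Cod C f')"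
    using assms h(2-4) by (simp_all add: cospans_def Hom_def)
  then show ?l
    using h unfolding cospan_class_def cospan_iso_def iso_def by auto
qed

lemma cospan_class_self:
  assumes "f \<in> Ar C" "g \<in> Ar C" "Cod C f = Cod C g"
  shows "(f, g) \<in> cospan_class C (f, g)"
proof -
  have "inverse_ar C (ident C (Cod C f)) (ident C (Cod C f)) \<and> Dom C (ident C (Cod C f)) = Cod C f \<and>
    f = ident C (Cod C f) \<cdot> f \<and> g = ident C (Cod C f) \<cdot> g"
    using assms by (simp add: inverse_ar_ident)
  then show ?thesis
    unfolding cospan_class_mem[OF assms] by blast
qed

lemma cospan_class_iso:
  assumes fg: "f \<in> Ar C" "g \<in> Ar C" "Cod C f = Cod C g" and h: "inverse_ar C h h'" "Dom C h = Cod C f"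
  shows "cospan_class C (h \<cdot> f, h \<cdot> g) = cospan_class C (f, g)"
proof -
  note hD = inverse_arD[OF h(1)]
  have "cospan_class C (k \<cdot> p, k \<cdot> q) \<subseteq> cospan_class C (p, q)"
    if k: "inverse_ar C k k'" "Dom C k = Cod C p" and pq: "p \<in> Ar C" "q \<in> Ar C" "Cod C p = Cod C q"
    for k k' p q
  proof -
    note kD = inverse_arD[OF k(1)]
    have a: "k \<cdot> p \<in> Ar C" "k \<cdot> q \<in> Ar C" "Cod C (k \<cdot> p) = Cod C (k \<cdot> q)"
      using kD k pq by simp_all
    show ?thesis
    proof (rule subrelI)
      fix u v assume "(u, v) \<in> cospan_class C (k \<cdot> p, k \<cdot> q)"
      then obtain m m' where m: "inverse_ar C m m'" "Dom C m = Cod C (k \<cdot> p)" "u = m \<cdot> k \<cdot> p" "v = m \<cdot> k \<cdot> q"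
        unfolding cospan_class_mem[OF a] by blast
      note mD = inverse_arD[OF m(1)]
      have "inverse_ar C (m \<cdot> k) (k' \<cdot> m')"
        using m(2) k kD pq by (intro inverse_ar_comp[OF k(1) m(1)]) simp
      moreover have "Dom C (m \<cdot> k) = Cod C p" "u = (m \<cdot> k) \<cdot> p" "v = (m \<cdot> k) \<cdot> q"
        using m k kD mD pq by simp_all
      ultimately show "(u, v) \<in> cospan_class C (p, q)"
        unfolding cospan_class_mem[OF pq] by blast
    qed
  qed
  note sub = this
  \<comment> \<open>The inclusion just shown, used for \<open>h'\<close> in place of
    \<open>h\<close>, gives the converse inclusion.\<close>
  have "cospan_class C (h' \<cdot> h \<cdot> f, h' \<cdot> h \<cdot> g) \<subseteq> cospan_class C (h \<cdot> f, h \<cdot> g)"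
    by (rule sub[OF inverse_ar_sym[OF h(1)]]) (use fg h hD in simp_all)
  then have "cospan_class C (f, g) \<subseteq> cospan_class C (h \<cdot> f, h \<cdot> g)"
    using fg h by (simp add: inverse_ar_cancel[OF h(1)])
  then show ?thesis
    using sub[OF h fg] by blast
qed

lemma cospan_class_eqI:
  assumes "f \<in> Ar C" "g \<in> Ar C" "Cod C f = Cod C g" "inverse_ar C h h'" "Dom C h = Cod C f"
    "h \<cdot> f = f'" "h \<cdot> g = g'"
  shows "cospan_class C (f, g) = cospan_class C (f', g')"
  using cospan_class_iso[OF assms(1-5)] assms(6,7) by simp

end

context category_with_sums
begin

abbreviation "W \<equiv> cospan_cat C S"

lemma cospan_cat_simps [simp]:
  "Ob W = Ob C" "ident W A = vec C (ident C A)" "tens W = sum_ob S" "tunit W = zero_ob S"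
  "assoc W A B D = vec C (sum_assoc C S A B D)" "lunit W A = vec C (sum_lunit C S A)"
  "runit W A = vec C (sum_runit C S A)" "symm W A B = vec C (sum_symm C S A B)"
  "bang W A = vec C (from_zero C S A)" "nabla W A = vec C (codiag C S A)"
  "cobang W A = opp C (from_zero C S A)" "delta W A = opp C (codiag C S A)"
  by (simp_all add: cospan_cat_def)

text \<open>Isomorphisms act on apexes only, so the feet are constant on a class, and the class is
  nonempty; hence \<open>the_elem\<close> in \<open>cospan_cat\<close> meets a singleton.\<close>

lemma cospan_cat_Ar:
  assumes "f \<in> Ar C" "g \<in> Ar C" "Cod C f = Cod C g"
  shows "cospan_class C (f, g) \<in> Ar W" "Dom W (cospan_class C (f, g)) = Dom C f"
    "Cod W (cospan_class C (f, g)) = Dom C g"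
proof -
  have "Dom C (fst x) = Dom C f \<and> Dom C (snd x) = Dom C g" if "x \<in> cospan_class C (f, g)" for x
  proof -
    have "(fst x, snd x) \<in> cospan_class C (f, g)" using that by simp
    then obtain h h' where h: "inverse_ar C h h'" "Dom C h = Cod C f" "fst x = h \<cdot> f" "snd x = h \<cdot> g"
      unfolding cospan_class_mem[OF assms] by blast
    then show ?thesis using assms inverse_arD[OF h(1)] by simp
  qed
  then have "(\<lambda>x. Dom C (fst x)) ` cospan_class C (f, g) = (\<lambda>_. Dom C f) ` cospan_class C (f, g)"
    "(\<lambda>x. Dom C (snd x)) ` cospan_class C (f, g) = (\<lambda>_. Dom C g) ` cospan_class C (f, g)"
    by (auto intro!: image_cong simp del: image_constant_conv)
  moreover have "cospan_class C (f, g) \<noteq> {}"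
    using cospan_class_self[OF assms] by blast
  ultimately have "(\<lambda>x. Dom C (fst x)) ` cospan_class C (f, g) = {Dom C f}"
    "(\<lambda>x. Dom C (snd x)) ` cospan_class C (f, g) = {Dom C g}"
    by (simp_all add: image_constant_conv)
  then show "cospan_class C (f, g) \<in> Ar W" "Dom W (cospan_class C (f, g)) = Dom C f"
    "Cod W (cospan_class C (f, g)) = Dom C g"
    using assms by (auto simp: cospan_cat_def cospans_def)
qed

lemma cospan_cat_HomI:
  assumes "f \<in> Ar C" "g \<in> Ar C" "Cod C f = Cod C g" "Dom C f = A" "Dom C g = B"
  shows "cospan_class C (f, g) \<in> Hom W A B"
  using cospan_cat_Ar[OF assms(1-3)] assms(4,5) by (simp add: Hom_def)

lemma cospan_cat_HomE:
  assumes "c \<in> Hom W A B"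
  obtains f g where "f \<in> Ar C" "g \<in> Ar C" "Cod C f = Cod C g" "Dom C f = A" "Dom C g = B"
    "c = cospan_class C (f, g)"
proof -
  have "c \<in> cospan_class C ` cospans C"
    using assms by (simp add: Hom_def cospan_cat_def)
  then obtain f g where fg: "f \<in> Ar C" "g \<in> Ar C" "Cod C f = Cod C g" "c = cospan_class C (f, g)"
    by (auto simp: cospans_def)
  moreover have "Dom C f = A" "Dom C g = B"
    using assms cospan_cat_Ar[OF fg(1-3)] fg(4) by (simp_all add: Hom_def)
  ultimately show ?thesis using that by blast
qed

text \<open>The set of all composites, over all representatives and all pushouts, is the class of
  the composite computed from one choice. A change of representatives transports the pushout by
  \<open>is_pushout_change_apex\<close>, and two pushouts of one span differ by an isomorphism of
  apexes, which is an isomorphism of the composite cospans.\<close>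

lemma cospan_comp:
  assumes f: "f \<in> Ar C" "Cod C f = Cod C f'" and g: "g \<in> Ar C" "Cod C g = Cod C g'"
    and po: "is_pushout C f' g' i j"
  shows "cospan_class C (g', g) \<cdot>\<^bsub>W\<^esub> cospan_class C (f, f') = cospan_class C (i \<cdot> f, j \<cdot> g)"
    (is "?l = ?r")
proof -
  note [simp] = is_pushoutD[OF po]
  have cf: "f \<in> Ar C" "f' \<in> Ar C" "Cod C f = Cod C f'" and cg: "g' \<in> Ar C" "g \<in> Ar C" "Cod C g' = Cod C g"
    using f g by simp_all
  have cr: "i \<cdot> f \<in> Ar C" "j \<cdot> g \<in> Ar C" "Cod C (i \<cdot> f) = Cod C (j \<cdot> g)"
    using f g by simp_all
  \<comment> \<open>The comprehension binds the names \<open>f\<close>, \<open>f'\<close>,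
    \<open>g'\<close>, \<open>g\<close>; the outer arrows of the same names enter it through the
    renamed copies.\<close>
  have l: "?l = {(i \<cdot> f, j \<cdot> g) | f f' g' g i j.
        (f, f') \<in> cospan_class C (cf, cf') \<and> (g', g) \<in> cospan_class C (cg', cg) \<and> is_pushout C f' g' i j}"
    if "cf = f" "cf' = f'" "cg' = g'" "cg = g" for cf cf' cg' cg
    using that by (simp add: cospan_cat_def)
  show ?thesis
  proof
    show "?l \<subseteq> ?r"
    proof
      fix x assume "x \<in> ?l"
      then obtain f1 f1' g1' g1 i1 j1 where x: "x = (i1 \<cdot> f1, j1 \<cdot> g1)"
        and f1: "(f1, f1') \<in> cospan_class C (f, f')" and g1: "(g1', g1) \<in> cospan_class C (g', g)"
        and po1: "is_pushout C f1' g1' i1 j1"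
        unfolding l[OF refl refl refl refl] by blast
      obtain h h' where h: "inverse_ar C h h'" "Dom C h = Cod C f" "f1 = h \<cdot> f" "f1' = h \<cdot> f'"
        using f1 unfolding cospan_class_mem[OF cf] by blast
      obtain k k' where k: "inverse_ar C k k'" "Dom C k = Cod C g'" "g1' = k \<cdot> g'" "g1 = k \<cdot> g"
        using g1 unfolding cospan_class_mem[OF cg] by blast
      note hD = inverse_arD[OF h(1)] and kD = inverse_arD[OF k(1)]
      have po2: "is_pushout C f1' g1' (i \<cdot> h') (j \<cdot> k')"
        using is_pushout_change_apex[OF po h(1) _ k(1,2)] h f k(3) by simp
      obtain m m' where m: "inverse_ar C m m'" "Dom C m = Cod C (i \<cdot> h')" "m \<cdot> i \<cdot> h' = i1" "m \<cdot> j \<cdot> k' = j1"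
        using is_pushout_unique[OF po2 po1] by metis
      note mD = inverse_arD[OF m(1)]
      have "i1 \<cdot> f1 = m \<cdot> i \<cdot> f"
        unfolding m(3)[symmetric] h(3) using m(2) mD hD h(2) cf inverse_ar_cancel[OF h(1), of f] by simp
      moreover have "j1 \<cdot> g1 = m \<cdot> j \<cdot> g"
        unfolding m(4)[symmetric] k(4) using m(2) mD hD h(2) kD k(2) cf cg inverse_ar_cancel[OF k(1), of g] by simp
      moreover have "Dom C m = Cod C (i \<cdot> f)"
        using m(2) hD h(2) cf by simp
      ultimately show "x \<in> ?r"
        unfolding x cospan_class_mem[OF cr] using m(1) by blast
    qed
    show "?r \<subseteq> ?l"
    proof (rule subrelI)
      fix u v assume "(u, v) \<in> ?r"
      then obtain m m' where m: "inverse_ar C m m'" "Dom C m = Cod C (i \<cdot> f)" "u = m \<cdot> i \<cdot> f" "v = m \<cdot> j \<cdot> g"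
        unfolding cospan_class_mem[OF cr] by blast
      note mD = inverse_arD[OF m(1)]
      \<comment> \<open>An isomorphic copy of the composite needs no other representatives: the
        isomorphism is absorbed into the pushout.\<close>
      have "is_pushout C f' g' (m \<cdot> i) (m \<cdot> j)"
        using is_pushout_inverse_ar[OF po m(1)] m(2) cf by simp
      moreover have "u = (m \<cdot> i) \<cdot> f" "v = (m \<cdot> j) \<cdot> g"
        using m(2-4) mD cf cg by simp_all
      ultimately show "(u, v) \<in> ?l"
        unfolding l[OF refl refl refl refl] using cospan_class_self[OF cf] cospan_class_self[OF cg] by blast
    qed
  qed
qed

text \<open>Isomorphisms of the two cospans add up to one of their sums, so all sets in the union
  defining \<open>tens_ar\<close> coincide.\<close>

lemma cospan_tens:
  assumes f: "f \<in> Ar C" "f' \<in> Ar C" "Cod C f = Cod C f'" and g: "g \<in> Ar C" "g' \<in> Ar C" "Cod C g = Cod C g'"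
  shows "cospan_class C (f, f') \<boxtimes>\<^bsub>W\<^esub> cospan_class C (g, g')
    = cospan_class C (sum_ar C S f g, sum_ar C S f' g')"
proof -
  have "cospan_class C (sum_ar C S f1 g1, sum_ar C S f1' g1') = cospan_class C (sum_ar C S f g, sum_ar C S f' g')"
    if f1: "(f1, f1') \<in> cospan_class C (f, f')" and g1: "(g1, g1') \<in> cospan_class C (g, g')" for f1 f1' g1 g1'
  proof -
    obtain h h' where h: "inverse_ar C h h'" "Dom C h = Cod C f" "f1 = h \<cdot> f" "f1' = h \<cdot> f'"
      using f1 unfolding cospan_class_mem[OF f] by blast
    obtain k k' where k: "inverse_ar C k k'" "Dom C k = Cod C g" "g1 = k \<cdot> g" "g1' = k \<cdot> g'"
      using g1 unfolding cospan_class_mem[OF g] by blast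
    note hD = inverse_arD[OF h(1)] and kD = inverse_arD[OF k(1)]
    show ?thesis
      by (rule cospan_class_eqI[symmetric, OF _ _ _ inverse_ar_sum[OF h(1) k(1)]])
        (use f g h k hD kD in \<open>simp_all add: sum_ar_comp\<close>)
  qed
  then have "(\<Union>(f1, f1') \<in> cospan_class C (f, f'). \<Union>(g1, g1') \<in> cospan_class C (g, g').
      cospan_class C (sum_ar C S f1 g1, sum_ar C S f1' g1')) = cospan_class C (sum_ar C S f g, sum_ar C S f' g')"
    using cospan_class_self[OF f] cospan_class_self[OF g] by blast
  then show ?thesis
    by (simp add: cospan_cat_def)
qed

section \<open>Calculus of \<open>vec\<close> and \<open>opp\<close>\<close>

lemma vec_Ar [simp]:
  assumes "f \<in> Ar C"
  shows "vec C f \<in> Ar W" "Dom W (vec C f) = Dom C f" "Cod W (vec C f) = Cod C f"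
  using assms cospan_cat_Ar[of f "ident C (Cod C f)"] by (simp_all add: vec_def)

lemma opp_Ar [simp]:
  assumes "f \<in> Ar C"
  shows "opp C f \<in> Ar W" "Dom W (opp C f) = Cod C f" "Cod W (opp C f) = Dom C f"
  using assms cospan_cat_Ar[of "ident C (Cod C f)" f] by (simp_all add: opp_def)

text \<open>The span in the middle has an identity leg, so only the left leg of the cospan changes;
  \<open>opp_comp_cospan\<close> is the dual statement for the right leg.\<close>

lemma cospan_comp_vec:
  assumes "f \<in> Ar C" "g \<in> Ar C" "Cod C f = Cod C g" "k \<in> Ar C" "Cod C k = Dom C f"
  shows "cospan_class C (f, g) \<cdot>\<^bsub>W\<^esub> vec C k = cospan_class C (f \<cdot> k, g)"
proof -
  have po: "is_pushout C (ident C (Cod C k)) f f (ident C (Cod C f))"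
    using is_pushout_ident_left[OF assms(1)] assms(5) by simp
  then show ?thesis
    unfolding vec_def using assms by (subst cospan_comp[OF _ _ _ _ po]) simp_all
qed

lemma opp_comp_cospan:
  assumes "f \<in> Ar C" "g \<in> Ar C" "Cod C f = Cod C g" "k \<in> Ar C" "Cod C k = Dom C g"
  shows "opp C k \<cdot>\<^bsub>W\<^esub> cospan_class C (f, g) = cospan_class C (f, g \<cdot> k)"
proof -
  have po: "is_pushout C g (ident C (Cod C k)) (ident C (Cod C g)) g"
    using is_pushout_ident_right[OF assms(2)] assms(5) by simp
  then show ?thesis
    unfolding opp_def using assms by (subst cospan_comp[OF _ _ _ _ po]) simp_all
qed

text \<open>The one order of composition in which a genuine pushout must be known; in the opposite
  order, \<open>opp_comp_vec\<close> just assembles a cospan from its legs.\<close>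

lemma vec_comp_opp:
  assumes "is_pushout C f g i j"
  shows "vec C g \<cdot>\<^bsub>W\<^esub> opp C f = cospan_class C (i, j)"
  unfolding vec_def opp_def using is_pushoutD[OF assms] by (subst cospan_comp[OF _ _ _ _ assms]) simp_all

lemma opp_comp_vec:
  assumes "f \<in> Ar C" "g \<in> Ar C" "Cod C f = Cod C g"
  shows "opp C g \<cdot>\<^bsub>W\<^esub> vec C f = cospan_class C (f, g)"
  unfolding vec_def using assms by (subst opp_comp_cospan) simp_all

lemma vec_vec:
  assumes "f \<in> Ar C" "g \<in> Ar C" "Dom C g = Cod C f"
  shows "vec C g \<cdot>\<^bsub>W\<^esub> vec C f = vec C (g \<cdot> f)"
  using cospan_comp_vec[of g "ident C (Cod C g)" f] assms by (simp add: vec_def)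

lemma opp_opp:
  assumes "f \<in> Ar C" "g \<in> Ar C" "Dom C g = Cod C f"
  shows "opp C f \<cdot>\<^bsub>W\<^esub> opp C g = opp C (g \<cdot> f)"
  using opp_comp_cospan[of "ident C (Cod C g)" g f] assms by (simp add: opp_def)

lemma vec_tens: "f \<in> Ar C \<Longrightarrow> g \<in> Ar C \<Longrightarrow> vec C f \<boxtimes>\<^bsub>W\<^esub> vec C g = vec C (sum_ar C S f g)"
  unfolding vec_def by (subst cospan_tens) (simp_all add: sum_ar_ident)

lemma opp_tens: "f \<in> Ar C \<Longrightarrow> g \<in> Ar C \<Longrightarrow> opp C f \<boxtimes>\<^bsub>W\<^esub> opp C g = opp C (sum_ar C S f g)"
  unfolding opp_def by (subst cospan_tens) (simp_all add: sum_ar_ident)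

text \<open>The isomorphism \<open>g\<close> carries one cospan to the other. A structure
  isomorphism can therefore be written as \<open>vec\<close> or as \<open>opp\<close>, whichever
  composes without a pushout.\<close>

lemma vec_eq_opp:
  assumes "inverse_ar C f g"
  shows "vec C f = opp C g"
  unfolding vec_def opp_def
  by (rule cospan_class_eqI[OF _ _ _ inverse_ar_sym[OF assms]]) (use inverse_arD[OF assms] in simp_all)

lemma vec_ident: "A \<in> Ob C \<Longrightarrow> vec C (ident C A) = opp C (ident C A)"
  by (rule vec_eq_opp[OF inverse_ar_ident])

lemma inverse_ar_vec:
  assumes "inverse_ar C f g"
  shows "inverse_ar W (vec C f) (vec C g)"
  unfolding inverse_ar_def Hom_def using inverse_arD[OF assms] by (simp add: vec_vec)

lemma iso_vec: "inverse_ar C f g \<Longrightarrow> iso W (vec C f)"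
  using inverse_ar_vec by (auto simp: iso_def)

text \<open>Transfers naturality to cospans. Here \<open>k\<close>, \<open>l\<close> and
  \<open>h\<close> are the components of a transformation at the domain foot, the codomain foot and
  the apex, and the last two hypotheses are its naturality squares at the two legs. Writing
  \<open>vec C l\<close> as \<open>opp C l'\<close> leaves two cospans with the same feet, and
  \<open>h\<close> is the isomorphism between them.\<close>

lemma vec_comp_natural:
  assumes "f \<in> Ar C" "g \<in> Ar C" "Cod C f = Cod C g" "f' \<in> Ar C" "g' \<in> Ar C" "Cod C f' = Cod C g'"
    and k: "k \<in> Ar C" and l: "inverse_ar C l l'" and h: "inverse_ar C h h'"
    and "Dom C h = Cod C f" "Cod C k = Dom C f'" "Dom C l = Dom C g" "Cod C l = Dom C g'"
    and fk: "h \<cdot> f = f' \<cdot> k" and gl: "h \<cdot> g = g' \<cdot> l"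
  shows "vec C l \<cdot>\<^bsub>W\<^esub> cospan_class C (f, g) = cospan_class C (f', g') \<cdot>\<^bsub>W\<^esub> vec C k"
proof -
  note [simp] = inverse_arD[OF l] inverse_arD[OF h]
  have "h \<cdot> g \<cdot> l' = g' \<cdot> l \<cdot> l'"
    by (rule comp_swap[OF gl]) (use assms in simp_all)
  then have "h \<cdot> g \<cdot> l' = g'"
    using assms(5,13) by simp
  then have "cospan_class C (f, g \<cdot> l') = cospan_class C (f' \<cdot> k, g')"
    by (rule_tac cospan_class_eqI[OF _ _ _ h]) (use assms in simp_all)
  then show ?thesis
    unfolding vec_eq_opp[OF l] using assms by (simp add: opp_comp_cospan cospan_comp_vec)
qed

end

text \<open>Existence of pushouts keeps composites in the category: without a pushout the composite
  would be the empty set, which is no class of cospans.\<close>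

locale finitely_cocomplete = category_with_sums C S
  for C :: "('o, 'a, 'z) cat_scheme" (structure) and S +
  assumes pushouts: "f \<in> Ar C \<Longrightarrow> g \<in> Ar C \<Longrightarrow> Dom C f = Dom C g \<Longrightarrow> \<exists>i j. is_pushout C f g i j"
begin

lemma cospan_category: "category W"
proof
  show "Dom W c \<in> Ob W" "Cod W c \<in> Ob W" if "c \<in> Ar W" for c
  proof -
    have "c \<in> Hom W (Dom W c) (Cod W c)" using that by (simp add: Hom_def)
    then show "Dom W c \<in> Ob W" "Cod W c \<in> Ob W" by (auto elim!: cospan_cat_HomE simp: cospan_cat_Ar)
  qed
  show "ident W A \<in> Hom W A A" if "A \<in> Ob W" for A
    using that by (simp add: Hom_def)
  show "d \<cdot>\<^bsub>W\<^esub> c \<in> Hom W A D" if c: "c \<in> Hom W A B" and d: "d \<in> Hom W B D" for c d A B D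
  proof -
    obtain f f' where f: "f \<in> Ar C" "f' \<in> Ar C" "Cod C f = Cod C f'" "Dom C f = A" "Dom C f' = B"
      "c = cospan_class C (f, f')" using c by (rule cospan_cat_HomE)
    obtain g' g where g: "g' \<in> Ar C" "g \<in> Ar C" "Cod C g' = Cod C g" "Dom C g' = B" "Dom C g = D"
      "d = cospan_class C (g', g)" using d by (rule cospan_cat_HomE)
    obtain i j where po: "is_pushout C f' g' i j"
      using pushouts[of f' g'] f g by auto
    show ?thesis
      unfolding f(6) g(6) using f g is_pushoutD[OF po] cospan_comp[OF _ _ _ _ po, of f g]
      by (simp add: cospan_cat_HomI)
  qed
  show "c \<cdot>\<^bsub>W\<^esub> ident W A = c" "ident W B \<cdot>\<^bsub>W\<^esub> c = c" if c: "c \<in> Hom W A B" for c A B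
  proof -
    obtain f f' where f: "f \<in> Ar C" "f' \<in> Ar C" "Cod C f = Cod C f'" "Dom C f = A" "Dom C f' = B"
      "c = cospan_class C (f, f')" using c by (rule cospan_cat_HomE)
    have "A \<in> Ob C" "B \<in> Ob C" using f by auto
    then show "c \<cdot>\<^bsub>W\<^esub> ident W A = c" "ident W B \<cdot>\<^bsub>W\<^esub> c = c"
      using f by (simp add: cospan_comp_vec, simp add: vec_ident opp_comp_cospan)
  qed
  show "(e \<cdot>\<^bsub>W\<^esub> d) \<cdot>\<^bsub>W\<^esub> c = e \<cdot>\<^bsub>W\<^esub> d \<cdot>\<^bsub>W\<^esub> c"
    if c: "c \<in> Hom W A B" and d: "d \<in> Hom W B D" and e: "e \<in> Hom W D F" for c d e A B D F
  proof -
    obtain f f' where f: "f \<in> Ar C" "f' \<in> Ar C" "Cod C f = Cod C f'" "Dom C f = A" "Dom C f' = B"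
      "c = cospan_class C (f, f')" using c by (rule cospan_cat_HomE)
    obtain g g' where g: "g \<in> Ar C" "g' \<in> Ar C" "Cod C g = Cod C g'" "Dom C g = B" "Dom C g' = D"
      "d = cospan_class C (g, g')" using d by (rule cospan_cat_HomE)
    obtain h h' where h: "h \<in> Ar C" "h' \<in> Ar C" "Cod C h = Cod C h'" "Dom C h = D" "Dom C h' = F"
      "e = cospan_class C (h, h')" using e by (rule cospan_cat_HomE)
    obtain i j where p: "is_pushout C f' g i j"
      using pushouts[of f' g] f g by auto
    obtain i' j' where p': "is_pushout C g' h i' j'"
      using pushouts[of g' h] g h by auto
    note pD = is_pushoutD[OF p] and pD' = is_pushoutD[OF p']
    \<comment> \<open>A third pushout, of the inner legs of the first two. Pasting it onto either of
      them yields the pushout required by one of the two bracketings, so both bracketings are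
      computed with the same \<open>k\<close> and \<open>l\<close>.\<close>
    obtain k l where q: "is_pushout C j i' k l"
      using pushouts[of j i'] pD pD' g by auto
    note qD = is_pushoutD[OF q]
    have q1: "is_pushout C (j \<cdot> g') h k (l \<cdot> j')"
      by (rule is_pushout_sym[OF is_pushout_paste[OF is_pushout_sym[OF p'] is_pushout_sym[OF q]]])
    have q2: "is_pushout C f' (i' \<cdot> g) (k \<cdot> i) l"
      by (rule is_pushout_paste[OF p q])
    have "e \<cdot>\<^bsub>W\<^esub> d \<cdot>\<^bsub>W\<^esub> c = cospan_class C (k \<cdot> i \<cdot> f, (l \<cdot> j') \<cdot> h')"
      unfolding f(6) g(6) h(6)
      by (subst cospan_comp[OF _ _ _ _ p], use f g in simp_all)
        (subst cospan_comp[OF _ _ _ _ q1], use f g h pD pD' in simp_all)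
    moreover have "(e \<cdot>\<^bsub>W\<^esub> d) \<cdot>\<^bsub>W\<^esub> c = cospan_class C ((k \<cdot> i) \<cdot> f, l \<cdot> j' \<cdot> h')"
      unfolding f(6) g(6) h(6)
      by (subst cospan_comp[OF _ _ _ _ p'], use f g h in simp_all)
        (subst cospan_comp[OF _ _ _ _ q2], use f g h pD pD' in simp_all)
    ultimately show ?thesis
      using f g h pD pD' qD by simp
  qed
qed

lemma cospan_symmetric_monoidal: "symmetric_monoidal_category W"
proof (rule symmetric_monoidal_category.intro[OF cospan_category], unfold_locales)
  show "tunit W \<in> Ob W" by simp
  show "A \<otimes>\<^bsub>W\<^esub> B \<in> Ob W" if "A \<in> Ob W" "B \<in> Ob W" for A B
    using that by simp
  show "c \<boxtimes>\<^bsub>W\<^esub> d \<in> Hom W (A \<otimes>\<^bsub>W\<^esub> A') (B \<otimes>\<^bsub>W\<^esub> B')" if "c \<in> Hom W A B" "d \<in> Hom W A' B'" for c d A B A' B'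
    using that by (auto elim!: cospan_cat_HomE simp: cospan_tens intro!: cospan_cat_HomI)
  show "ident W A \<boxtimes>\<^bsub>W\<^esub> ident W B = ident W (A \<otimes>\<^bsub>W\<^esub> B)" if "A \<in> Ob W" "B \<in> Ob W" for A B
    using that by (simp add: vec_tens sum_ar_ident)
  show "(d \<cdot>\<^bsub>W\<^esub> c) \<boxtimes>\<^bsub>W\<^esub> (d' \<cdot>\<^bsub>W\<^esub> c') = (d \<boxtimes>\<^bsub>W\<^esub> d') \<cdot>\<^bsub>W\<^esub> (c \<boxtimes>\<^bsub>W\<^esub> c')"
    if c: "c \<in> Hom W A B" and d: "d \<in> Hom W B D" and c': "c' \<in> Hom W A' B'" and d': "d' \<in> Hom W B' D'"
    for c d c' d' A B D A' B' D'
  proof -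
    obtain f g where f: "f \<in> Ar C" "g \<in> Ar C" "Cod C f = Cod C g" "Dom C f = A" "Dom C g = B"
      "c = cospan_class C (f, g)" using c by (rule cospan_cat_HomE)
    obtain h k where h: "h \<in> Ar C" "k \<in> Ar C" "Cod C h = Cod C k" "Dom C h = B" "Dom C k = D"
      "d = cospan_class C (h, k)" using d by (rule cospan_cat_HomE)
    obtain f' g' where f': "f' \<in> Ar C" "g' \<in> Ar C" "Cod C f' = Cod C g'" "Dom C f' = A'" "Dom C g' = B'"
      "c' = cospan_class C (f', g')" using c' by (rule cospan_cat_HomE)
    obtain h' k' where h': "h' \<in> Ar C" "k' \<in> Ar C" "Cod C h' = Cod C k'" "Dom C h' = B'" "Dom C k' = D'"
      "d' = cospan_class C (h', k')" using d' by (rule cospan_cat_HomE)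
    obtain i j where p: "is_pushout C g h i j"
      using pushouts[of g h] f h by auto
    obtain i' j' where p': "is_pushout C g' h' i' j'"
      using pushouts[of g' h'] f' h' by auto
    note pD = is_pushoutD[OF p] and pD' = is_pushoutD[OF p']
    have "(d \<cdot>\<^bsub>W\<^esub> c) \<boxtimes>\<^bsub>W\<^esub> (d' \<cdot>\<^bsub>W\<^esub> c')
        = cospan_class C (i \<cdot> f, j \<cdot> k) \<boxtimes>\<^bsub>W\<^esub> cospan_class C (i' \<cdot> f', j' \<cdot> k')"
      unfolding f(6) h(6) f'(6) h'(6)
      using f h f' h' cospan_comp[OF _ _ _ _ p, of f k] cospan_comp[OF _ _ _ _ p', of f' k'] by simp
    also have "\<dots> = cospan_class C (sum_ar C S i i' \<cdot> sum_ar C S f f', sum_ar C S j j' \<cdot> sum_ar C S k k')"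
      using f h f' h' pD pD' by (simp add: cospan_tens sum_ar_comp)
    also have "\<dots> = (d \<boxtimes>\<^bsub>W\<^esub> d') \<cdot>\<^bsub>W\<^esub> (c \<boxtimes>\<^bsub>W\<^esub> c')"
      unfolding f(6) h(6) f'(6) h'(6) using f h f' h'
      by (simp add: cospan_tens cospan_comp[OF _ _ _ _ is_pushout_sum[OF p p']])
    finally show ?thesis .
  qed
  show "assoc W A B D \<in> Hom W ((A \<otimes>\<^bsub>W\<^esub> B) \<otimes>\<^bsub>W\<^esub> D) (A \<otimes>\<^bsub>W\<^esub> (B \<otimes>\<^bsub>W\<^esub> D)) \<and> iso W (assoc W A B D)"
    if "A \<in> Ob W" "B \<in> Ob W" "D \<in> Ob W" for A B D
    using that iso_vec[OF sum_assoc_inverse] by (simp add: Hom_def)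
  show "lunit W A \<in> Hom W (tunit W \<otimes>\<^bsub>W\<^esub> A) A \<and> iso W (lunit W A)"
    "runit W A \<in> Hom W (A \<otimes>\<^bsub>W\<^esub> tunit W) A \<and> iso W (runit W A)"
    if "A \<in> Ob W" for A
    using that iso_vec[OF sum_lunit_inverse] iso_vec[OF sum_runit_inverse] by (simp_all add: Hom_def)
  show "symm W A B \<in> Hom W (A \<otimes>\<^bsub>W\<^esub> B) (B \<otimes>\<^bsub>W\<^esub> A)" if "A \<in> Ob W" "B \<in> Ob W" for A B
    using that by (simp add: Hom_def)
  show "assoc W A' B' D' \<cdot>\<^bsub>W\<^esub> ((c \<boxtimes>\<^bsub>W\<^esub> d) \<boxtimes>\<^bsub>W\<^esub> e) = (c \<boxtimes>\<^bsub>W\<^esub> (d \<boxtimes>\<^bsub>W\<^esub> e)) \<cdot>\<^bsub>W\<^esub> assoc W A B D"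
    if c: "c \<in> Hom W A A'" and d: "d \<in> Hom W B B'" and e: "e \<in> Hom W D D'" for c d e A A' B B' D D'
  proof -
    obtain f f' where f: "f \<in> Ar C" "f' \<in> Ar C" "Cod C f = Cod C f'" "Dom C f = A" "Dom C f' = A'"
      "c = cospan_class C (f, f')" using c by (rule cospan_cat_HomE)
    obtain g g' where g: "g \<in> Ar C" "g' \<in> Ar C" "Cod C g = Cod C g'" "Dom C g = B" "Dom C g' = B'"
      "d = cospan_class C (g, g')" using d by (rule cospan_cat_HomE)
    obtain h h' where h: "h \<in> Ar C" "h' \<in> Ar C" "Cod C h = Cod C h'" "Dom C h = D" "Dom C h' = D'"
      "e = cospan_class C (h, h')" using e by (rule cospan_cat_HomE)
    have o: "A \<in> Ob C" "B \<in> Ob C" "D \<in> Ob C" "A' \<in> Ob C" "B' \<in> Ob C" "D' \<in> Ob C"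
      using f g h by auto
    show ?thesis
      unfolding f(6) g(6) h(6) using f(1-3) g(1-3) h(1-3)
      by (simp add: cospan_tens)
        (rule vec_comp_natural[OF _ _ _ _ _ _ _ sum_assoc_inverse
            sum_assoc_inverse[of "Cod C f" "Cod C g" "Cod C h"]],
         use f g h o sum_assoc_natural[of f g h] sum_assoc_natural[of f' g' h'] in simp_all)
  qed
  show "lunit W B \<cdot>\<^bsub>W\<^esub> (ident W (tunit W) \<boxtimes>\<^bsub>W\<^esub> c) = c \<cdot>\<^bsub>W\<^esub> lunit W A"
    "runit W B \<cdot>\<^bsub>W\<^esub> (c \<boxtimes>\<^bsub>W\<^esub> ident W (tunit W)) = c \<cdot>\<^bsub>W\<^esub> runit W A"
    if c: "c \<in> Hom W A B" for c A B
  proof -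
    obtain f f' where f: "f \<in> Ar C" "f' \<in> Ar C" "Cod C f = Cod C f'" "Dom C f = A" "Dom C f' = B"
      "c = cospan_class C (f, f')" using c by (rule cospan_cat_HomE)
    have o: "A \<in> Ob C" "B \<in> Ob C" using f by auto
    \<comment> \<open>The identity written as an explicit cospan, so that \<open>cospan_tens\<close>
      applies to its tensor with an arbitrary \<open>c\<close>.\<close>
    have i: "ident W (tunit W) = cospan_class C (ident C (zero_ob S), ident C (zero_ob S))"
      by (simp add: vec_def)
    show "lunit W B \<cdot>\<^bsub>W\<^esub> (ident W (tunit W) \<boxtimes>\<^bsub>W\<^esub> c) = c \<cdot>\<^bsub>W\<^esub> lunit W A"
      unfolding f(6) i using f(1-3)
      by (simp add: cospan_tens)
        (rule vec_comp_natural[OF _ _ _ _ _ _ _ sum_lunit_inverse sum_lunit_inverse[of "Cod C f"]],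
         use f o sum_lunit_natural[of f] sum_lunit_natural[of f'] in simp_all)
    show "runit W B \<cdot>\<^bsub>W\<^esub> (c \<boxtimes>\<^bsub>W\<^esub> ident W (tunit W)) = c \<cdot>\<^bsub>W\<^esub> runit W A"
      unfolding f(6) i using f(1-3)
      by (simp add: cospan_tens)
        (rule vec_comp_natural[OF _ _ _ _ _ _ _ sum_runit_inverse sum_runit_inverse[of "Cod C f"]],
         use f o sum_runit_natural[of f] sum_runit_natural[of f'] in simp_all)
  qed
  show "symm W A' B' \<cdot>\<^bsub>W\<^esub> (c \<boxtimes>\<^bsub>W\<^esub> d) = (d \<boxtimes>\<^bsub>W\<^esub> c) \<cdot>\<^bsub>W\<^esub> symm W A B"
    if c: "c \<in> Hom W A A'" and d: "d \<in> Hom W B B'" for c d A A' B B'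
  proof -
    obtain f f' where f: "f \<in> Ar C" "f' \<in> Ar C" "Cod C f = Cod C f'" "Dom C f = A" "Dom C f' = A'"
      "c = cospan_class C (f, f')" using c by (rule cospan_cat_HomE)
    obtain g g' where g: "g \<in> Ar C" "g' \<in> Ar C" "Cod C g = Cod C g'" "Dom C g = B" "Dom C g' = B'"
      "d = cospan_class C (g, g')" using d by (rule cospan_cat_HomE)
    have o: "A \<in> Ob C" "B \<in> Ob C" "A' \<in> Ob C" "B' \<in> Ob C"
      using f g by auto
    show ?thesis
      unfolding f(6) g(6) using f(1-3) g(1-3)
      by (simp add: cospan_tens)
        (rule vec_comp_natural[OF _ _ _ _ _ _ _ sum_symm_inverse sum_symm_inverse[of "Cod C f" "Cod C g"]],
         use f g o sum_symm_natural[of f g] sum_symm_natural[of f' g'] in simp_all)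
  qed
  show "assoc W A B (D \<otimes>\<^bsub>W\<^esub> F) \<cdot>\<^bsub>W\<^esub> assoc W (A \<otimes>\<^bsub>W\<^esub> B) D F
      = (ident W A \<boxtimes>\<^bsub>W\<^esub> assoc W B D F) \<cdot>\<^bsub>W\<^esub> assoc W A (B \<otimes>\<^bsub>W\<^esub> D) F \<cdot>\<^bsub>W\<^esub> (assoc W A B D \<boxtimes>\<^bsub>W\<^esub> ident W F)"
    if "A \<in> Ob W" "B \<in> Ob W" "D \<in> Ob W" "F \<in> Ob W" for A B D F
    using that by (simp add: vec_vec vec_tens sum_pentagon)
  show "(ident W A \<boxtimes>\<^bsub>W\<^esub> lunit W B) \<cdot>\<^bsub>W\<^esub> assoc W A (tunit W) B = runit W A \<boxtimes>\<^bsub>W\<^esub> ident W B"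
    if "A \<in> Ob W" "B \<in> Ob W" for A B
    using that by (simp add: vec_vec vec_tens sum_triangle)
  show "assoc W B D A \<cdot>\<^bsub>W\<^esub> symm W A (B \<otimes>\<^bsub>W\<^esub> D) \<cdot>\<^bsub>W\<^esub> assoc W A B D
        = (ident W B \<boxtimes>\<^bsub>W\<^esub> symm W A D) \<cdot>\<^bsub>W\<^esub> assoc W B A D \<cdot>\<^bsub>W\<^esub> (symm W A B \<boxtimes>\<^bsub>W\<^esub> ident W D)"
    if "A \<in> Ob W" "B \<in> Ob W" "D \<in> Ob W" for A B D
    using that by (simp add: vec_vec vec_tens sum_hexagon)
  show "symm W B A \<cdot>\<^bsub>W\<^esub> symm W A B = ident W (A \<otimes>\<^bsub>W\<^esub> B)" if "A \<in> Ob W" "B \<in> Ob W" for A B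
    using that by (simp add: vec_vec sum_symm_symm)
qed

lemma cospan_wscc: "wscc_category W"
proof (rule wscc_category.intro[OF cospan_symmetric_monoidal], unfold_locales)
  fix A assume "A \<in> Ob W"
  then have A: "A \<in> Ob C" by simp
  note [simp] = A vec_vec vec_tens opp_opp opp_tens
  note inv_D = inverse_arD[OF sum_assoc_inverse[OF A A A]] inverse_arD[OF sum_lunit_inverse[OF A]]
    inverse_arD[OF sum_runit_inverse[OF A]] inverse_arD[OF sum_symm_inverse[OF A A]]
  show "bang W A \<in> Hom W (tunit W) A" "nabla W A \<in> Hom W (A \<otimes>\<^bsub>W\<^esub> A) A"
    "cobang W A \<in> Hom W A (tunit W)" "delta W A \<in> Hom W A (A \<otimes>\<^bsub>W\<^esub> A)"
    by (simp_all add: Hom_def)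
  show "nabla W A \<cdot>\<^bsub>W\<^esub> (nabla W A \<boxtimes>\<^bsub>W\<^esub> ident W A)
        = nabla W A \<cdot>\<^bsub>W\<^esub> (ident W A \<boxtimes>\<^bsub>W\<^esub> nabla W A) \<cdot>\<^bsub>W\<^esub> assoc W A A A"
    by (simp add: codiag_assoc)
  show "nabla W A \<cdot>\<^bsub>W\<^esub> (bang W A \<boxtimes>\<^bsub>W\<^esub> ident W A) = lunit W A"
    "nabla W A \<cdot>\<^bsub>W\<^esub> (ident W A \<boxtimes>\<^bsub>W\<^esub> bang W A) = runit W A"
    "nabla W A \<cdot>\<^bsub>W\<^esub> symm W A A = nabla W A"
    by (simp_all add: codiag_lunit codiag_runit codiag_comm)
  \<comment> \<open>The comonoid laws are the monoid laws under the contravariant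
    \<open>opp\<close>. The associativity becomes \<open>opp\<close> of its inverse, so
    \<open>codiag_assoc\<close> is needed with that inverse moved to the left side; the unit laws
    below are treated alike.\<close>
  have "(codiag C S A \<cdot> sum_ar C S (codiag C S A) (ident C A)) \<cdot> sum_unassoc A A A
      = codiag C S A \<cdot> sum_ar C S (ident C A) (codiag C S A)"
    unfolding codiag_assoc[OF A] using inv_D by simp
  then show "assoc W A A A \<cdot>\<^bsub>W\<^esub> (delta W A \<boxtimes>\<^bsub>W\<^esub> ident W A) \<cdot>\<^bsub>W\<^esub> delta W A
        = (ident W A \<boxtimes>\<^bsub>W\<^esub> delta W A) \<cdot>\<^bsub>W\<^esub> delta W A"
    by (simp add: vec_ident vec_eq_opp[OF sum_assoc_inverse])
  have "(codiag C S A \<cdot> sum_ar C S (from_zero C S A) (ident C A)) \<cdot> inj2 S (zero_ob S) A = ident C A"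
    unfolding codiag_lunit[OF A] using inv_D by simp
  then show "lunit W A \<cdot>\<^bsub>W\<^esub> (cobang W A \<boxtimes>\<^bsub>W\<^esub> ident W A) \<cdot>\<^bsub>W\<^esub> delta W A = ident W A"
    by (simp add: vec_ident vec_eq_opp[OF sum_lunit_inverse])
  have "(codiag C S A \<cdot> sum_ar C S (ident C A) (from_zero C S A)) \<cdot> inj1 S A (zero_ob S) = ident C A"
    unfolding codiag_runit[OF A] using inv_D by simp
  then show "runit W A \<cdot>\<^bsub>W\<^esub> (ident W A \<boxtimes>\<^bsub>W\<^esub> cobang W A) \<cdot>\<^bsub>W\<^esub> delta W A = ident W A"
    by (simp add: vec_ident vec_eq_opp[OF sum_runit_inverse])
  show "symm W A A \<cdot>\<^bsub>W\<^esub> delta W A = delta W A"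
    by (simp add: vec_eq_opp[OF sum_symm_inverse] codiag_comm)
  have d: "delta W A \<boxtimes>\<^bsub>W\<^esub> ident W A = opp C (sum_ar C S (codiag C S A) (ident C A))"
    "ident W A \<boxtimes>\<^bsub>W\<^esub> delta W A = opp C (sum_ar C S (ident C A) (codiag C S A))"
    by (simp_all add: vec_ident)
  have nd: "delta W A \<cdot>\<^bsub>W\<^esub> nabla W A = cospan_class C (codiag C S A, codiag C S A)"
    by (simp add: opp_comp_vec)
  interpret CW: category W by (rule cospan_category)
  \<comment> \<open>The right side is a plain cospan by \<open>nd\<close>; read backwards,
    \<open>vec_comp_opp\<close> splits it along the Frobenius square. What is left is to group the
    two covariant factors on the left into one \<open>vec\<close>.\<close>
  show "(ident W A \<boxtimes>\<^bsub>W\<^esub> nabla W A) \<cdot>\<^bsub>W\<^esub> assoc W A A A \<cdot>\<^bsub>W\<^esub> (delta W A \<boxtimes>\<^bsub>W\<^esub> ident W A)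
        = delta W A \<cdot>\<^bsub>W\<^esub> nabla W A"
    unfolding d nd vec_comp_opp[OF is_pushout_frobenius[OF A], symmetric]
    by (subst CW.arr_assoc[symmetric]) simp_all
  have u: "inv_ar W (assoc W A A A) = vec C (sum_unassoc A A A)"
    using CW.inv_ar_eq[OF inverse_ar_vec[OF sum_assoc_inverse[OF A A A]]] by simp
  show "(nabla W A \<boxtimes>\<^bsub>W\<^esub> ident W A) \<cdot>\<^bsub>W\<^esub> inv_ar W (assoc W A A A) \<cdot>\<^bsub>W\<^esub> (ident W A \<boxtimes>\<^bsub>W\<^esub> delta W A)
        = delta W A \<cdot>\<^bsub>W\<^esub> nabla W A"
    unfolding d nd u vec_comp_opp[OF is_pushout_frobenius'[OF A], symmetric]
    by (subst CW.arr_assoc[symmetric]) simp_all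
  show "nabla W A \<cdot>\<^bsub>W\<^esub> delta W A = ident W A"
    by (simp add: vec_comp_opp[OF is_pushout_codiag]) (simp add: vec_def)
qed

end

section \<open>Full subcategories\<close>

lemma full_sub_simps:
  "A \<in> Ob (full_sub C P) \<longleftrightarrow> A \<in> Ob C \<and> A \<in> P"
  "f \<in> Ar (full_sub C P) \<longleftrightarrow> f \<in> Ar C \<and> Dom C f \<in> P \<and> Cod C f \<in> P"
  "f \<in> Hom (full_sub C P) A B \<longleftrightarrow> f \<in> Hom C A B \<and> A \<in> P \<and> B \<in> P"
  "Dom (full_sub C P) = Dom C" "Cod (full_sub C P) = Cod C" "ident (full_sub C P) = ident C"
  "comp (full_sub C P) = comp C"
  by (auto simp: full_sub_def Hom_def)

lemma full_sub_wscc_simps: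
  "tens (full_sub V P) = tens V" "tens_ar (full_sub V P) = tens_ar V" "tunit (full_sub V P) = tunit V"
  "assoc (full_sub V P) = assoc V" "lunit (full_sub V P) = lunit V" "runit (full_sub V P) = runit V"
  "symm (full_sub V P) = symm V" "bang (full_sub V P) = bang V" "nabla (full_sub V P) = nabla V"
  "cobang (full_sub V P) = cobang V" "delta (full_sub V P) = delta V"
  by (simp_all add: full_sub_def)

text \<open>An inverse runs between the same two objects, so fullness puts it into the
  subcategory.\<close>

lemma inverse_ar_full_sub:
  "Dom C f \<in> P \<Longrightarrow> Cod C f \<in> P \<Longrightarrow> inverse_ar (full_sub C P) f g \<longleftrightarrow> inverse_ar C f g"
  by (auto simp: inverse_ar_def full_sub_simps)

lemma iso_full_sub: "Dom C f \<in> P \<Longrightarrow> Cod C f \<in> P \<Longrightarrow> iso (full_sub C P) f \<longleftrightarrow> iso C f"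
  by (simp add: iso_def inverse_ar_full_sub)

lemma inv_ar_full_sub: "Dom C f \<in> P \<Longrightarrow> Cod C f \<in> P \<Longrightarrow> inv_ar (full_sub C P) f = inv_ar C f"
  by (simp add: inv_ar_def inverse_ar_full_sub)

text \<open>Most axioms are universal statements about arrows and restrict as they stand, once
  \<open>P\<close> contains the unit and is closed under the tensor. Only those that mention
  \<open>iso\<close> or \<open>inv_ar\<close> need an argument, because these notions refer to the
  ambient category.\<close>

lemma wscc_full_sub:
  assumes "wscc_category V" and unit: "tunit V \<in> P"
    and tens: "\<And>A B. A \<in> Ob V \<Longrightarrow> B \<in> Ob V \<Longrightarrow> A \<in> P \<Longrightarrow> B \<in> P \<Longrightarrow> tens V A B \<in> P"
  shows "wscc_category (full_sub V P)"
proof -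
  interpret V: wscc_category V by fact
  have iso: "iso (full_sub V P) f \<longleftrightarrow> iso V f" if "f \<in> Hom V A B \<and> iso V f" "A \<in> P" "B \<in> P" for f A B
    using that by (intro iso_full_sub) (auto simp: Hom_def)
  have inv: "inv_ar (full_sub V P) (assoc V A A A) = inv_ar V (assoc V A A A)" if "A \<in> Ob V" "A \<in> P" for A
    using that V.assoc_in[of A A A] by (intro inv_ar_full_sub) (auto simp: Hom_def intro: tens V.tens_in)
  note facts = V.Dom_in V.Cod_in V.ident_in V.comp_in V.comp_ident V.ident_comp V.comp_assoc
    V.tunit_in V.tens_in V.tens_ar_in V.tens_ident V.tens_comp
    V.symm_in V.assoc_natural V.lunit_natural V.runit_natural V.symm_natural V.pentagon V.triangle
    V.hexagon V.symm_symm V.bang_in V.nabla_in V.cobang_in V.delta_in V.nabla_assoc V.nabla_lunit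
    V.nabla_runit V.nabla_comm V.delta_assoc V.delta_lunit V.delta_runit V.delta_comm
    V.frobenius_left V.separable
  have obs: "A \<in> Ob V" "B \<in> Ob V" if "f \<in> Hom V A B" for f A B
    using that V.Dom_in V.Cod_in by (auto simp: Hom_def)
  note simps = full_sub_simps full_sub_wscc_simps
  show ?thesis
  proof
    fix A B D
    assume "A \<in> Ob (full_sub V P)" "B \<in> Ob (full_sub V P)" "D \<in> Ob (full_sub V P)"
    then have o: "A \<in> Ob V" "B \<in> Ob V" "D \<in> Ob V" "A \<in> P" "B \<in> P" "D \<in> P"
      by (simp_all add: full_sub_simps)
    have t: "tens V (tens V A B) D \<in> P" "tens V A (tens V B D) \<in> P"
      by (intro tens V.tens_in o)+
    show "assoc (full_sub V P) A B D \<in> Hom (full_sub V P)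
        ((A \<otimes>\<^bsub>full_sub V P\<^esub> B) \<otimes>\<^bsub>full_sub V P\<^esub> D) (A \<otimes>\<^bsub>full_sub V P\<^esub> (B \<otimes>\<^bsub>full_sub V P\<^esub> D)) \<and>
        iso (full_sub V P) (assoc (full_sub V P) A B D)"
      using V.assoc_in[OF o(1-3)] iso[OF V.assoc_in[OF o(1-3)] t] t by (simp add: simps)
  next
    fix A assume "A \<in> Ob (full_sub V P)"
    then have o: "A \<in> Ob V" "A \<in> P"
      by (simp_all add: full_sub_simps)
    have t: "tens V (tunit V) A \<in> P" "tens V A (tunit V) \<in> P"
      by (intro tens V.tens_in V.tunit_in unit o)+
    show "lunit (full_sub V P) A \<in> Hom (full_sub V P) (tunit (full_sub V P) \<otimes>\<^bsub>full_sub V P\<^esub> A) A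
        \<and> iso (full_sub V P) (lunit (full_sub V P) A)"
      using V.lunit_in[OF o(1)] iso[OF V.lunit_in[OF o(1)] t(1) o(2)] t o by (simp add: simps)
    show "runit (full_sub V P) A \<in> Hom (full_sub V P) (A \<otimes>\<^bsub>full_sub V P\<^esub> tunit (full_sub V P)) A
        \<and> iso (full_sub V P) (runit (full_sub V P) A)"
      using V.runit_in[OF o(1)] iso[OF V.runit_in[OF o(1)] t(2) o(2)] t o by (simp add: simps)
    show "(nabla (full_sub V P) A \<boxtimes>\<^bsub>full_sub V P\<^esub> ident (full_sub V P) A)
      \<cdot>\<^bsub>full_sub V P\<^esub> inv_ar (full_sub V P) (assoc (full_sub V P) A A A)
      \<cdot>\<^bsub>full_sub V P\<^esub> (ident (full_sub V P) A \<boxtimes>\<^bsub>full_sub V P\<^esub> delta (full_sub V P) A)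
        = delta (full_sub V P) A \<cdot>\<^bsub>full_sub V P\<^esub> nabla (full_sub V P) A"
      using V.frobenius_right[OF o(1)] inv[OF o] by (simp only: simps)
  qed (unfold simps; (elim conjE)?; (intro conjI)?;
      (assumption | (rule facts; assumption) | (blast intro: facts tens unit dest: obs)))+
qed

lemma wscc_functor_full_sub:
  assumes "wscc_functor V U F \<mu> \<eta>" "wscc_category (full_sub V P)"
  shows "wscc_functor (full_sub V P) U F \<mu> \<eta>"
proof -
  interpret wscc_functor V U F \<mu> \<eta> by fact
  interpret VP: wscc_category "full_sub V P" by fact
  note facts = obj_in ar_in map_ident map_comp mu_in eta_in mu_natural map_assoc map_lunit map_runit
    map_symm map_bang map_nabla map_cobang map_delta
  show ?thesis
    by (unfold_locales; unfold full_sub_simps full_sub_wscc_simps; (elim conjE)?;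
        (rule facts; assumption))
qed

section \<open>Functors preserving finite colimits\<close>

text \<open>Counterpart of \<open>sum_eqI\<close> for a sum that is not the chosen one, such as the
  image of a sum under a functor.\<close>

lemma (in category) binary_sum_eqI:
  assumes "is_binary_sum C A B P i j" "f \<in> Ar C" "g \<in> Ar C" "Dom C f = P" "Dom C g = P" "Cod C f = Cod C g"
    "f \<cdot> i = g \<cdot> i" "f \<cdot> j = g \<cdot> j"
  shows "f = g"
proof -
  have i: "i \<in> Hom C A P" "j \<in> Hom C B P"
    using assms(1) by (simp_all add: is_binary_sum_def)
  then have "f \<cdot> i \<in> Hom C A (Cod C f) \<and> f \<cdot> j \<in> Hom C B (Cod C f)"
    using assms(2-4) by (simp add: Hom_def)
  then have "\<exists>!h. h \<in> Hom C P (Cod C f) \<and> h \<cdot> i = f \<cdot> i \<and> h \<cdot> j = f \<cdot> j"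
    using assms(1) unfolding is_binary_sum_def by blast
  moreover have "f \<in> Hom C P (Cod C f)" "g \<in> Hom C P (Cod C f)"
    using assms(2-6) by (simp_all add: Hom_def)
  ultimately show ?thesis
    using assms(7,8) by metis
qed

text \<open>Initial object and sums enter through the chosen ones, which define the tensor. Pushouts
  are never chosen, so the condition on them concerns all pushout squares.\<close>

locale finite_colimit_functor = S: finitely_cocomplete C SC + T: finitely_cocomplete D SD + cat_functor C D F
  for C :: "('o, 'a, 'z) cat_scheme" and SC and D :: "('p, 'b, 'y) cat_scheme" and SD and F +
  assumes preserves_initial: "is_initial D (obj_map F (zero_ob SC))"
    and preserves_sum: "A \<in> Ob C \<Longrightarrow> B \<in> Ob C \<Longrightarrow>
      is_binary_sum D (obj_map F A) (obj_map F B) (obj_map F (sum_ob SC A B))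
        (ar_map F (inj1 SC A B)) (ar_map F (inj2 SC A B))"
    and preserves_pushout: "is_pushout C f g i j \<Longrightarrow>
      is_pushout D (ar_map F f) (ar_map F g) (ar_map F i) (ar_map F j)"
begin

lemma map_ob [simp]: "A \<in> Ob C \<Longrightarrow> obj_map F A \<in> Ob D"
  by (rule obj_in)

lemma map_Ar [simp]:
  assumes "f \<in> Ar C"
  shows "ar_map F f \<in> Ar D" "Dom D (ar_map F f) = obj_map F (Dom C f)"
    "Cod D (ar_map F f) = obj_map F (Cod C f)"
  using ar_in[of f "Dom C f" "Cod C f"] assms by (simp_all add: Hom_def)

lemma map_ident_Ar [simp]: "A \<in> Ob C \<Longrightarrow> ar_map F (ident C A) = ident D (obj_map F A)"
  by (rule map_ident)

text \<open>Oriented so that composites of images collapse to the image of a composite; coherence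
  equations are thereby reduced inside \<open>C\<close>, where the rules for injections
  apply.\<close>

lemma comp_map [simp]:
  assumes "f \<in> Ar C" "g \<in> Ar C" "Dom C g = Cod C f"
  shows "ar_map F g \<cdot>\<^bsub>D\<^esub> ar_map F f = ar_map F (g \<cdot>\<^bsub>C\<^esub> f)"
  using map_comp[of f "Dom C f" "Cod C f" g "Cod C g"] assms by (simp add: Hom_def)

lemma comp_map_comp [simp]:
  assumes "f \<in> Ar C" "g \<in> Ar C" "Dom C g = Cod C f" "x \<in> Ar D" "Cod D x = obj_map F (Dom C f)"
  shows "ar_map F g \<cdot>\<^bsub>D\<^esub> ar_map F f \<cdot>\<^bsub>D\<^esub> x = ar_map F (g \<cdot>\<^bsub>C\<^esub> f) \<cdot>\<^bsub>D\<^esub> x"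
  using assms T.arr_assoc[of x "ar_map F f" "ar_map F g"] by simp

lemma map_inverse_ar: "inverse_ar C f g \<Longrightarrow> inverse_ar D (ar_map F f) (ar_map F g)"
  using S.inverse_arD[of f g] by (intro T.inverse_arI) simp_all

text \<open>The union runs over all representatives, which avoids choosing one; by
  \<open>cospan_map_class\<close> all of them contribute the same class.\<close>

definition cospan_map :: "('o, ('a \<times> 'a) set, 'p, ('b \<times> 'b) set) cat_map" where
  "cospan_map = \<lparr>obj_map = obj_map F,
     ar_map = (\<lambda>c. \<Union>(f, g) \<in> c. cospan_class D (ar_map F f, ar_map F g))\<rparr>"

definition can :: "'o \<Rightarrow> 'o \<Rightarrow> 'b" where
  "can A B = copair D SD (ar_map F (inj1 SC A B)) (ar_map F (inj2 SC A B))"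

definition can0 :: "'b" where
  "can0 = from_zero D SD (obj_map F (zero_ob SC))"

lemma cospan_map_obj [simp]: "obj_map cospan_map A = obj_map F A"
  by (simp add: cospan_map_def)

lemma cospan_map_class:
  assumes "f \<in> Ar C" "g \<in> Ar C" "Cod C f = Cod C g"
  shows "ar_map cospan_map (cospan_class C (f, g)) = cospan_class D (ar_map F f, ar_map F g)"
proof -
  have "cospan_class D (ar_map F f', ar_map F g') = cospan_class D (ar_map F f, ar_map F g)"
    if fg': "(f', g') \<in> cospan_class C (f, g)" for f' g'
  proof -
    obtain h h' where h: "inverse_ar C h h'" "Dom C h = Cod C f" "f' = h \<cdot>\<^bsub>C\<^esub> f" "g' = h \<cdot>\<^bsub>C\<^esub> g"
      using fg' unfolding S.cospan_class_mem[OF assms] by blast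
    show ?thesis
      by (rule T.cospan_class_eqI[symmetric, OF _ _ _ map_inverse_ar[OF h(1)]])
        (use assms h S.inverse_arD[OF h(1)] in simp_all)
  qed
  then have "(\<Union>(f', g') \<in> cospan_class C (f, g). cospan_class D (ar_map F f', ar_map F g'))
      = (\<Union>_ \<in> cospan_class C (f, g). cospan_class D (ar_map F f, ar_map F g))"
    by (intro SUP_cong refl) blast
  also have "\<dots> = cospan_class D (ar_map F f, ar_map F g)"
    using S.cospan_class_self[OF assms] by blast
  finally show ?thesis
    by (simp add: cospan_map_def)
qed

lemma cospan_map_vec: "f \<in> Ar C \<Longrightarrow> ar_map cospan_map (vec C f) = vec D (ar_map F f)"
  by (simp add: vec_def cospan_map_class)

lemma cospan_map_opp: "f \<in> Ar C \<Longrightarrow> ar_map cospan_map (opp C f) = opp D (ar_map F f)"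
  by (simp add: opp_def cospan_map_class)

lemma can_in [simp]:
  assumes "A \<in> Ob C" "B \<in> Ob C"
  shows "can A B \<in> Ar D" "Dom D (can A B) = sum_ob SD (obj_map F A) (obj_map F B)"
    "Cod D (can A B) = obj_map F (sum_ob SC A B)"
  using assms by (simp_all add: can_def)

lemma can_inj [simp]:
  assumes "A \<in> Ob C" "B \<in> Ob C"
  shows "A' = obj_map F A \<Longrightarrow> B' = obj_map F B \<Longrightarrow> can A B \<cdot>\<^bsub>D\<^esub> inj1 SD A' B' = ar_map F (inj1 SC A B)"
    "A' = obj_map F A \<Longrightarrow> B' = obj_map F B \<Longrightarrow> can A B \<cdot>\<^bsub>D\<^esub> inj2 SD A' B' = ar_map F (inj2 SC A B)"
    "A' = obj_map F A \<Longrightarrow> B' = obj_map F B \<Longrightarrow> x \<in> Ar D \<Longrightarrow> Cod D x = obj_map F A \<Longrightarrow>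
      can A B \<cdot>\<^bsub>D\<^esub> inj1 SD A' B' \<cdot>\<^bsub>D\<^esub> x = ar_map F (inj1 SC A B) \<cdot>\<^bsub>D\<^esub> x"
    "A' = obj_map F A \<Longrightarrow> B' = obj_map F B \<Longrightarrow> x \<in> Ar D \<Longrightarrow> Cod D x = obj_map F B \<Longrightarrow>
      can A B \<cdot>\<^bsub>D\<^esub> inj2 SD A' B' \<cdot>\<^bsub>D\<^esub> x = ar_map F (inj2 SC A B) \<cdot>\<^bsub>D\<^esub> x"
  using assms by (simp_all add: can_def)

text \<open>Both \<open>F A + F B\<close> and \<open>F (A + B)\<close> are sums of the same two
  objects, the latter by preservation, and \<open>can\<close> is the comparison between
  them.\<close>

lemma can_inverse:
  assumes "A \<in> Ob C" "B \<in> Ob C"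
  obtains h where "inverse_ar D (can A B) h"
proof -
  have "\<exists>!h. h \<in> Hom D (obj_map F (sum_ob SC A B)) (sum_ob SD (obj_map F A) (obj_map F B)) \<and>
    h \<cdot>\<^bsub>D\<^esub> ar_map F (inj1 SC A B) = inj1 SD (obj_map F A) (obj_map F B) \<and>
    h \<cdot>\<^bsub>D\<^esub> ar_map F (inj2 SC A B) = inj2 SD (obj_map F A) (obj_map F B)"
    using preserves_sum[OF assms] T.binary_sum[OF map_ob map_ob, OF assms] unfolding is_binary_sum_def by blast
  then obtain h where h: "h \<in> Ar D" "Dom D h = obj_map F (sum_ob SC A B)"
    "Cod D h = sum_ob SD (obj_map F A) (obj_map F B)"
    "h \<cdot>\<^bsub>D\<^esub> ar_map F (inj1 SC A B) = inj1 SD (obj_map F A) (obj_map F B)"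
    "h \<cdot>\<^bsub>D\<^esub> ar_map F (inj2 SC A B) = inj2 SD (obj_map F A) (obj_map F B)"
    by (auto simp: Hom_def)
  have "h \<cdot>\<^bsub>D\<^esub> can A B = ident D (Dom D (can A B))"
    by (rule T.sum_eqI[of _ "obj_map F A" "obj_map F B"]) (use assms h in simp_all)
  \<comment> \<open>Arrows out of \<open>F (A + B)\<close> are compared here, which is a sum but not
    the chosen one.\<close>
  moreover have "can A B \<cdot>\<^bsub>D\<^esub> h = ident D (Cod D (can A B))"
    by (rule T.binary_sum_eqI[OF preserves_sum[OF assms]]) (use assms h in simp_all)
  ultimately show ?thesis
    using assms h by (intro that[of h] T.inverse_arI) simp_all
qed

lemma can0_in [simp]: "can0 \<in> Ar D" "Dom D can0 = zero_ob SD" "Cod D can0 = obj_map F (zero_ob SC)"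
  by (simp_all add: can0_def)

lemma map_zero_eqI:
  assumes "f \<in> Ar D" "g \<in> Ar D" "Dom D f = obj_map F (zero_ob SC)" "Dom D g = obj_map F (zero_ob SC)"
    "Cod D f = Cod D g"
  shows "f = g"
proof -
  have "\<exists>!h. h \<in> Hom D (obj_map F (zero_ob SC)) (Cod D f)"
    using preserves_initial assms by (simp add: is_initial_def)
  then show ?thesis
    using assms by (auto simp: Hom_def)
qed

lemma can0_inverse:
  obtains h where "inverse_ar D can0 h"
proof -
  obtain h where h: "h \<in> Ar D" "Dom D h = obj_map F (zero_ob SC)" "Cod D h = zero_ob SD"
    using preserves_initial T.zero_in by (fastforce simp: is_initial_def Hom_def)
  have "h \<cdot>\<^bsub>D\<^esub> can0 = ident D (Dom D can0)"
    by (rule T.zero_eqI) (use h in simp_all)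
  moreover have "can0 \<cdot>\<^bsub>D\<^esub> h = ident D (Cod D can0)"
    by (rule map_zero_eqI) (use h in simp_all)
  ultimately show ?thesis
    using h by (intro that[of h] T.inverse_arI) simp_all
qed

lemma can_natural:
  assumes "f \<in> Ar C" "g \<in> Ar C"
  shows "ar_map F (sum_ar C SC f g) \<cdot>\<^bsub>D\<^esub> can (Dom C f) (Dom C g)
    = can (Cod C f) (Cod C g) \<cdot>\<^bsub>D\<^esub> sum_ar D SD (ar_map F f) (ar_map F g)"
  by (rule T.sum_eqI[of _ "obj_map F (Dom C f)" "obj_map F (Dom C g)"]) (use assms in simp_all)

lemma can_assoc:
  assumes "A \<in> Ob C" "B \<in> Ob C" "H \<in> Ob C"
  shows "ar_map F (sum_assoc C SC A B H) \<cdot>\<^bsub>D\<^esub> can (sum_ob SC A B) H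
      \<cdot>\<^bsub>D\<^esub> sum_ar D SD (can A B) (ident D (obj_map F H))
    = can A (sum_ob SC B H) \<cdot>\<^bsub>D\<^esub> sum_ar D SD (ident D (obj_map F A)) (can B H)
      \<cdot>\<^bsub>D\<^esub> sum_assoc D SD (obj_map F A) (obj_map F B) (obj_map F H)"
  by (rule T.sum_eqI[of _ "sum_ob SD (obj_map F A) (obj_map F B)" "obj_map F H"],
      rule T.sum_eqI[of _ "obj_map F A" "obj_map F B"])
    (use assms in \<open>simp_all add: sum_assoc_def\<close>)

lemma map_from_zero:
  assumes "A \<in> Ob C"
  shows "ar_map F (from_zero C SC A) \<cdot>\<^bsub>D\<^esub> can0 = from_zero D SD (obj_map F A)"
  by (rule T.zero_eqI) (use assms in simp_all)

lemma can_lunit: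
  assumes "A \<in> Ob C"
  shows "ar_map F (sum_lunit C SC A) \<cdot>\<^bsub>D\<^esub> can (zero_ob SC) A \<cdot>\<^bsub>D\<^esub> sum_ar D SD can0 (ident D (obj_map F A))
    = sum_lunit D SD (obj_map F A)"
  by (rule T.sum_eqI[of _ "zero_ob SD" "obj_map F A"])
    (use assms in \<open>simp_all add: sum_lunit_def map_from_zero\<close>)

lemma can_runit:
  assumes "A \<in> Ob C"
  shows "ar_map F (sum_runit C SC A) \<cdot>\<^bsub>D\<^esub> can A (zero_ob SC) \<cdot>\<^bsub>D\<^esub> sum_ar D SD (ident D (obj_map F A)) can0
    = sum_runit D SD (obj_map F A)"
  by (rule T.sum_eqI[of _ "obj_map F A" "zero_ob SD"])
    (use assms in \<open>simp_all add: sum_runit_def map_from_zero\<close>)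

lemma can_symm:
  assumes "A \<in> Ob C" "B \<in> Ob C"
  shows "ar_map F (sum_symm C SC A B) \<cdot>\<^bsub>D\<^esub> can A B
    = can B A \<cdot>\<^bsub>D\<^esub> sum_symm D SD (obj_map F A) (obj_map F B)"
  by (rule T.sum_eqI[of _ "obj_map F A" "obj_map F B"]) (use assms in \<open>simp_all add: sum_symm_def\<close>)

lemma can_codiag:
  assumes "A \<in> Ob C"
  shows "ar_map F (codiag C SC A) \<cdot>\<^bsub>D\<^esub> can A A = codiag D SD (obj_map F A)"
  by (rule T.sum_eqI[of _ "obj_map F A" "obj_map F A"]) (use assms in simp_all)

text \<open>Composition is respected because the image of the pushout used to compose in
  \<open>C\<close> is again a pushout, and \<open>cospan_comp\<close> accepts any pushout.\<close>

lemma cospan_functor: "cat_functor S.W T.W cospan_map"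
proof (rule cat_functor.intro[OF S.cospan_category T.cospan_category], unfold_locales)
  show "obj_map cospan_map A \<in> Ob T.W" if "A \<in> Ob S.W" for A
    using that by simp
  show "ar_map cospan_map c \<in> Hom T.W (obj_map cospan_map A) (obj_map cospan_map B)"
    if "c \<in> Hom S.W A B" for c A B
    using that by (auto elim!: S.cospan_cat_HomE simp: cospan_map_class intro!: T.cospan_cat_HomI)
  show "ar_map cospan_map (ident S.W A) = ident T.W (obj_map cospan_map A)" if "A \<in> Ob S.W" for A
    using that by (simp add: cospan_map_vec)
  show "ar_map cospan_map (d \<cdot>\<^bsub>S.W\<^esub> c) = ar_map cospan_map d \<cdot>\<^bsub>T.W\<^esub> ar_map cospan_map c"
    if c: "c \<in> Hom S.W A B" and d: "d \<in> Hom S.W B E" for c d A B E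
  proof -
    obtain f f' where f: "f \<in> Ar C" "f' \<in> Ar C" "Cod C f = Cod C f'" "Dom C f = A" "Dom C f' = B"
      "c = cospan_class C (f, f')" using c by (rule S.cospan_cat_HomE)
    obtain g' g where g: "g' \<in> Ar C" "g \<in> Ar C" "Cod C g' = Cod C g" "Dom C g' = B" "Dom C g = E"
      "d = cospan_class C (g', g)" using d by (rule S.cospan_cat_HomE)
    obtain i j where po: "is_pushout C f' g' i j"
      using S.pushouts[of f' g'] f g by auto
    note [simp] = S.is_pushoutD[OF po]
    have "d \<cdot>\<^bsub>S.W\<^esub> c = cospan_class C (i \<cdot>\<^bsub>C\<^esub> f, j \<cdot>\<^bsub>C\<^esub> g)"
      unfolding f(6) g(6) using f g S.cospan_comp[OF _ _ _ _ po, of f g] by simp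
    then show ?thesis
      unfolding f(6) g(6) using f(1-5) g(1-5)
      by (simp add: cospan_map_class T.cospan_comp[OF _ _ _ _ preserves_pushout[OF po]])
  qed
qed

lemma cospan_wscc_functor: "wscc_functor S.W T.W cospan_map (\<lambda>A B. vec D (can A B)) (vec D can0)"
proof (rule wscc_functor.intro[OF cospan_functor S.cospan_wscc T.cospan_wscc], unfold_locales)
  show "vec D (can A B) \<in> Hom T.W (obj_map cospan_map A \<otimes>\<^bsub>T.W\<^esub> obj_map cospan_map B)
      (obj_map cospan_map (A \<otimes>\<^bsub>S.W\<^esub> B)) \<and> iso T.W (vec D (can A B))"
    if "A \<in> Ob S.W" "B \<in> Ob S.W" for A B
    using that can_inverse[of A B] T.iso_vec by (auto simp: Hom_def)
  show "vec D can0 \<in> Hom T.W (tunit T.W) (obj_map cospan_map (tunit S.W)) \<and> iso T.W (vec D can0)"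
    using can0_inverse T.iso_vec by (auto simp: Hom_def)
  show "ar_map cospan_map (c \<boxtimes>\<^bsub>S.W\<^esub> d) \<cdot>\<^bsub>T.W\<^esub> vec D (can A B)
      = vec D (can A' B') \<cdot>\<^bsub>T.W\<^esub> (ar_map cospan_map c \<boxtimes>\<^bsub>T.W\<^esub> ar_map cospan_map d)"
    if c: "c \<in> Hom S.W A A'" and d: "d \<in> Hom S.W B B'" for c d A A' B B'
  proof -
    obtain f f' where f: "f \<in> Ar C" "f' \<in> Ar C" "Cod C f = Cod C f'" "Dom C f = A" "Dom C f' = A'"
      "c = cospan_class C (f, f')" using c by (rule S.cospan_cat_HomE)
    obtain g g' where g: "g \<in> Ar C" "g' \<in> Ar C" "Cod C g = Cod C g'" "Dom C g = B" "Dom C g' = B'"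
      "d = cospan_class C (g, g')" using d by (rule S.cospan_cat_HomE)
    have o: "A \<in> Ob C" "B \<in> Ob C" "A' \<in> Ob C" "B' \<in> Ob C"
      using f g by auto
    \<comment> \<open>For \<open>vec_comp_natural\<close> the comparison must be invertible at the
      codomain feet and at the apexes.\<close>
    obtain h where h: "inverse_ar D (can A' B') h"
      using can_inverse o by blast
    obtain k where k: "inverse_ar D (can (Cod C f) (Cod C g)) k"
      using can_inverse[of "Cod C f" "Cod C g"] f g by auto
    show ?thesis
      unfolding f(6) g(6) using f(1-3) g(1-3)
      by (simp add: S.cospan_tens T.cospan_tens cospan_map_class)
        (rule T.vec_comp_natural[symmetric, OF _ _ _ _ _ _ _ h k],
         use f g o can_natural[of f g] can_natural[of f' g'] in simp_all)
  qed
  show "ar_map cospan_map (assoc S.W A B H) \<cdot>\<^bsub>T.W\<^esub> vec D (can (A \<otimes>\<^bsub>S.W\<^esub> B) H)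
        \<cdot>\<^bsub>T.W\<^esub> (vec D (can A B) \<boxtimes>\<^bsub>T.W\<^esub> ident T.W (obj_map cospan_map H))
      = vec D (can A (B \<otimes>\<^bsub>S.W\<^esub> H)) \<cdot>\<^bsub>T.W\<^esub> (ident T.W (obj_map cospan_map A) \<boxtimes>\<^bsub>T.W\<^esub> vec D (can B H))
        \<cdot>\<^bsub>T.W\<^esub> assoc T.W (obj_map cospan_map A) (obj_map cospan_map B) (obj_map cospan_map H)"
    if "A \<in> Ob S.W" "B \<in> Ob S.W" "H \<in> Ob S.W" for A B H
    using that by (simp add: cospan_map_vec T.vec_vec T.vec_tens can_assoc)
  show "ar_map cospan_map (lunit S.W A) \<cdot>\<^bsub>T.W\<^esub> vec D (can (tunit S.W) A)
        \<cdot>\<^bsub>T.W\<^esub> (vec D can0 \<boxtimes>\<^bsub>T.W\<^esub> ident T.W (obj_map cospan_map A)) = lunit T.W (obj_map cospan_map A)"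
    "ar_map cospan_map (runit S.W A) \<cdot>\<^bsub>T.W\<^esub> vec D (can A (tunit S.W))
        \<cdot>\<^bsub>T.W\<^esub> (ident T.W (obj_map cospan_map A) \<boxtimes>\<^bsub>T.W\<^esub> vec D can0) = runit T.W (obj_map cospan_map A)"
    "ar_map cospan_map (bang S.W A) \<cdot>\<^bsub>T.W\<^esub> vec D can0 = bang T.W (obj_map cospan_map A)"
    "ar_map cospan_map (nabla S.W A) \<cdot>\<^bsub>T.W\<^esub> vec D (can A A) = nabla T.W (obj_map cospan_map A)"
    if "A \<in> Ob S.W" for A
    using that by (simp_all add: cospan_map_vec T.vec_vec T.vec_tens can_lunit can_runit map_from_zero can_codiag)
  show "ar_map cospan_map (symm S.W A B) \<cdot>\<^bsub>T.W\<^esub> vec D (can A B)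
      = vec D (can B A) \<cdot>\<^bsub>T.W\<^esub> symm T.W (obj_map cospan_map A) (obj_map cospan_map B)"
    if "A \<in> Ob S.W" "B \<in> Ob S.W" for A B
    using that by (simp add: cospan_map_vec T.vec_vec can_symm)
  show "ar_map cospan_map (cobang S.W A) = vec D can0 \<cdot>\<^bsub>T.W\<^esub> cobang T.W (obj_map cospan_map A)"
    if "A \<in> Ob S.W" for A
  proof -
    obtain h where h: "inverse_ar D can0 h" by (rule can0_inverse)
    \<comment> \<open>Since \<open>vec D can0\<close> is \<open>opp D h\<close>, the right side of
      the claim is \<open>opp\<close> of an arrow followed after \<open>h\<close>. By
      \<open>map_from_zero\<close> this identity says that the arrow is the image of
      \<open>from_zero\<close>. The case of \<open>delta\<close> runs in the same way.\<close>
    have "(ar_map F (from_zero C SC A) \<cdot>\<^bsub>D\<^esub> can0) \<cdot>\<^bsub>D\<^esub> h = ar_map F (from_zero C SC A)"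
      using that T.inverse_arD[OF h] by simp
    then show ?thesis
      using that T.inverse_arD[OF h] by (simp add: cospan_map_opp T.vec_eq_opp[OF h] T.opp_opp map_from_zero)
  qed
  show "ar_map cospan_map (delta S.W A) = vec D (can A A) \<cdot>\<^bsub>T.W\<^esub> delta T.W (obj_map cospan_map A)"
    if "A \<in> Ob S.W" for A
  proof -
    have A: "A \<in> Ob C" using that by simp
    obtain h where h: "inverse_ar D (can A A) h" using can_inverse A by blast
    have "(ar_map F (codiag C SC A) \<cdot>\<^bsub>D\<^esub> can A A) \<cdot>\<^bsub>D\<^esub> h = ar_map F (codiag C SC A)"
      using A T.inverse_arD[OF h] by simp
    then show ?thesis
      using A T.inverse_arD[OF h] by (simp add: cospan_map_opp T.vec_eq_opp[OF h] T.opp_opp can_codiag)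
  qed
qed

end

section \<open>Preservation of colimits by local classification\<close>

text \<open>If any finite set of arrows \<open>F A \<rightarrow> X\<close> factors through a single \<open>t : F G \<rightarrow> X\<close> with unique
  lifts, then \<open>F\<close> preserves every finite colimit that exists in \<open>C\<close>: \<open>G\<close> plays the role that the
  value of a right adjoint at \<open>X\<close> would play.\<close>

locale locally_left_adjoint = cat_functor +
  assumes classify: "finite U \<Longrightarrow> X \<in> Ob D \<Longrightarrow>
    (\<And>A u. (A, u) \<in> U \<Longrightarrow> A \<in> Ob C \<and> u \<in> Hom D (obj_map F A) X) \<Longrightarrow>
    \<exists>G t. G \<in> Ob C \<and> t \<in> Hom D (obj_map F G) X \<and>
      (\<forall>(A, u) \<in> U. \<exists>f \<in> Hom C A G. t \<cdot>\<^bsub>D\<^esub> ar_map F f = u) \<and>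
      (\<forall>A. \<forall>f \<in> Hom C A G. \<forall>g \<in> Hom C A G. t \<cdot>\<^bsub>D\<^esub> ar_map F f = t \<cdot>\<^bsub>D\<^esub> ar_map F g \<longrightarrow> f = g)"
begin

text \<open>Two-element instance of \<open>classify\<close>. It serves existence, with arrows out of
  two different objects, and uniqueness, with two arrows out of the same object.\<close>

lemma classify_pair:
  assumes "A \<in> Ob C" "B \<in> Ob C" "u \<in> Hom D (obj_map F A) X" "v \<in> Hom D (obj_map F B) X"
  obtains G t f g where "t \<in> Hom D (obj_map F G) X" "f \<in> Hom C A G" "g \<in> Hom C B G"
    "t \<cdot>\<^bsub>D\<^esub> ar_map F f = u" "t \<cdot>\<^bsub>D\<^esub> ar_map F g = v"
    "\<And>A f g. f \<in> Hom C A G \<Longrightarrow> g \<in> Hom C A G \<Longrightarrow> t \<cdot>\<^bsub>D\<^esub> ar_map F f = t \<cdot>\<^bsub>D\<^esub> ar_map F g \<Longrightarrow> f = g"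
proof -
  have "X \<in> Ob D" using assms(3) T.Cod_in by (auto simp: Hom_def)
  then have "\<exists>G t. G \<in> Ob C \<and> t \<in> Hom D (obj_map F G) X \<and>
      (\<forall>(A, u) \<in> {(A, u), (B, v)}. \<exists>f \<in> Hom C A G. t \<cdot>\<^bsub>D\<^esub> ar_map F f = u) \<and>
      (\<forall>A. \<forall>f \<in> Hom C A G. \<forall>g \<in> Hom C A G. t \<cdot>\<^bsub>D\<^esub> ar_map F f = t \<cdot>\<^bsub>D\<^esub> ar_map F g \<longrightarrow> f = g)"
    by (intro classify) (use assms in auto)
  then show ?thesis
    using that by fastforce
qed

lemma map_triangle:
  assumes "f \<in> Hom C A B" "g \<in> Hom C B G" "t \<in> Hom D (obj_map F G) X"
  shows "t \<cdot>\<^bsub>D\<^esub> ar_map F (g \<cdot>\<^bsub>C\<^esub> f) = (t \<cdot>\<^bsub>D\<^esub> ar_map F g) \<cdot>\<^bsub>D\<^esub> ar_map F f"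
  unfolding map_comp[OF assms(1,2)]
  by (rule T.comp_assoc[symmetric, OF ar_in[OF assms(1)] ar_in[OF assms(2)] assms(3)])

text \<open>Pattern of all three preservation proofs: lift the given arrows along \<open>t\<close>
  to arrows into \<open>G\<close>, use the universal property in \<open>C\<close>, and compose with
  \<open>t\<close> again. For existence the empty family already supplies a \<open>G\<close> to map
  into.\<close>

lemma initial_preserved:
  assumes "is_initial C Z"
  shows "is_initial D (obj_map F Z)"
  unfolding is_initial_def
proof (intro conjI ballI)
  have Z: "Z \<in> Ob C" "\<And>B. B \<in> Ob C \<Longrightarrow> \<exists>!h. h \<in> Hom C Z B"
    using assms by (auto simp: is_initial_def)
  show "obj_map F Z \<in> Ob D" using Z obj_in by blast
  fix X assume X: "X \<in> Ob D"
  show "\<exists>!h. h \<in> Hom D (obj_map F Z) X"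
  proof (rule ex_ex1I)
    have "\<exists>G t. G \<in> Ob C \<and> t \<in> Hom D (obj_map F G) X"
      using classify[of "{}" X] X by auto
    then obtain G t where "G \<in> Ob C" "t \<in> Hom D (obj_map F G) X" by blast
    moreover obtain h where "h \<in> Hom C Z G" using Z(2) \<open>G \<in> Ob C\<close> by blast
    ultimately show "\<exists>h. h \<in> Hom D (obj_map F Z) X"
      using T.comp_in ar_in by blast
  next
    fix h k assume "h \<in> Hom D (obj_map F Z) X" "k \<in> Hom D (obj_map F Z) X"
    then obtain G t f g where *: "t \<in> Hom D (obj_map F G) X" "f \<in> Hom C Z G" "g \<in> Hom C Z G"
      "t \<cdot>\<^bsub>D\<^esub> ar_map F f = h" "t \<cdot>\<^bsub>D\<^esub> ar_map F g = k"
      using classify_pair[OF Z(1) Z(1)] by metis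
    have "G \<in> Ob C" using *(2) S.Cod_in by (auto simp: Hom_def)
    then have "f = g" using Z(2) *(2,3) by blast
    then show "h = k" using * by simp
  qed
qed

lemma binary_sum_preserved:
  assumes sum: "is_binary_sum C A B P i j" and AB: "A \<in> Ob C" "B \<in> Ob C"
  shows "is_binary_sum D (obj_map F A) (obj_map F B) (obj_map F P) (ar_map F i) (ar_map F j)"
  unfolding is_binary_sum_def
proof (intro conjI allI impI)
  have P: "P \<in> Ob C" and i: "i \<in> Hom C A P" and j: "j \<in> Hom C B P"
    and univ: "\<And>X f g. f \<in> Hom C A X \<Longrightarrow> g \<in> Hom C B X \<Longrightarrow> \<exists>!h. h \<in> Hom C P X \<and> h \<cdot>\<^bsub>C\<^esub> i = f \<and> h \<cdot>\<^bsub>C\<^esub> j = g"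
    using sum by (auto simp: is_binary_sum_def)
  show "obj_map F P \<in> Ob D" "ar_map F i \<in> Hom D (obj_map F A) (obj_map F P)"
    "ar_map F j \<in> Hom D (obj_map F B) (obj_map F P)"
    using P i j obj_in ar_in by blast+
  fix X u v assume uv: "u \<in> Hom D (obj_map F A) X \<and> v \<in> Hom D (obj_map F B) X"
  show "\<exists>!h. h \<in> Hom D (obj_map F P) X \<and> h \<cdot>\<^bsub>D\<^esub> ar_map F i = u \<and> h \<cdot>\<^bsub>D\<^esub> ar_map F j = v"
  proof (rule ex_ex1I)
    obtain G t f g where *: "t \<in> Hom D (obj_map F G) X" "f \<in> Hom C A G" "g \<in> Hom C B G"
      "t \<cdot>\<^bsub>D\<^esub> ar_map F f = u" "t \<cdot>\<^bsub>D\<^esub> ar_map F g = v"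
      using classify_pair[OF AB] uv by metis
    obtain h where h: "h \<in> Hom C P G" "h \<cdot>\<^bsub>C\<^esub> i = f" "h \<cdot>\<^bsub>C\<^esub> j = g"
      using univ[OF *(2,3)] by blast
    have "t \<cdot>\<^bsub>D\<^esub> ar_map F h \<in> Hom D (obj_map F P) X"
      using T.comp_in ar_in h(1) *(1) by blast
    then show "\<exists>h. h \<in> Hom D (obj_map F P) X \<and> h \<cdot>\<^bsub>D\<^esub> ar_map F i = u \<and> h \<cdot>\<^bsub>D\<^esub> ar_map F j = v"
      using map_triangle[OF i h(1) *(1)] map_triangle[OF j h(1) *(1)] h * by auto
  next
    fix h k
    assume "h \<in> Hom D (obj_map F P) X \<and> h \<cdot>\<^bsub>D\<^esub> ar_map F i = u \<and> h \<cdot>\<^bsub>D\<^esub> ar_map F j = v"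
      "k \<in> Hom D (obj_map F P) X \<and> k \<cdot>\<^bsub>D\<^esub> ar_map F i = u \<and> k \<cdot>\<^bsub>D\<^esub> ar_map F j = v"
    then have h: "h \<in> Hom D (obj_map F P) X" "h \<cdot>\<^bsub>D\<^esub> ar_map F i = u" "h \<cdot>\<^bsub>D\<^esub> ar_map F j = v"
      and k: "k \<in> Hom D (obj_map F P) X" "k \<cdot>\<^bsub>D\<^esub> ar_map F i = u" "k \<cdot>\<^bsub>D\<^esub> ar_map F j = v"
      by blast+
    obtain G t f g where *: "t \<in> Hom D (obj_map F G) X" "f \<in> Hom C P G" "g \<in> Hom C P G"
      "t \<cdot>\<^bsub>D\<^esub> ar_map F f = h" "t \<cdot>\<^bsub>D\<^esub> ar_map F g = k"
      and un: "\<And>A f g. f \<in> Hom C A G \<Longrightarrow> g \<in> Hom C A G \<Longrightarrow> t \<cdot>\<^bsub>D\<^esub> ar_map F f = t \<cdot>\<^bsub>D\<^esub> ar_map F g \<Longrightarrow> f = g"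
      by (rule classify_pair[OF P P h(1) k(1)], rule that)
    \<comment> \<open>The two composites lift the same arrow \<open>u\<close>, and lifts are unique;
      likewise for \<open>j\<close> and \<open>v\<close>. So the lifts \<open>f\<close> and
      \<open>g\<close> agree on the sum in \<open>C\<close>.\<close>
    have "f \<cdot>\<^bsub>C\<^esub> i = g \<cdot>\<^bsub>C\<^esub> i"
      by (rule un[OF S.comp_in[OF i *(2)] S.comp_in[OF i *(3)]])
        (use h k in \<open>simp add: map_triangle[OF i _ *(1)] *\<close>)
    moreover have "f \<cdot>\<^bsub>C\<^esub> j = g \<cdot>\<^bsub>C\<^esub> j"
      by (rule un[OF S.comp_in[OF j *(2)] S.comp_in[OF j *(3)]])
        (use h k in \<open>simp add: map_triangle[OF j _ *(1)] *\<close>)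
    ultimately have "f = g"
      using univ[OF S.comp_in[OF i *(2)] S.comp_in[OF j *(2)]] *(2,3) by metis
    then show "h = k" using * by simp
  qed
qed

lemma pushout_preserved:
  assumes po: "is_pushout C f g i j"
  shows "is_pushout D (ar_map F f) (ar_map F g) (ar_map F i) (ar_map F j)"
proof -
  note pD = S.is_pushoutD[OF po]
  define A B B' P where "A = Dom C f" and "B = Cod C f" and "B' = Cod C g" and "P = Cod C i"
  have f: "f \<in> Hom C A B" and g: "g \<in> Hom C A B'" and i: "i \<in> Hom C B P" and j: "j \<in> Hom C B' P"
    using pD by (simp_all add: Hom_def A_def B_def B'_def P_def)
  have o: "B \<in> Ob C" "B' \<in> Ob C" "P \<in> Ob C"
    using pD S.Cod_in by (auto simp: B_def B'_def P_def)
  have mf: "ar_map F f \<in> Hom D (obj_map F A) (obj_map F B)" and mg: "ar_map F g \<in> Hom D (obj_map F A) (obj_map F B')"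
    and mi: "ar_map F i \<in> Hom D (obj_map F B) (obj_map F P)" and mj: "ar_map F j \<in> Hom D (obj_map F B') (obj_map F P)"
    using f g i j ar_in by blast+
  show ?thesis
  proof (rule T.is_pushoutI)
    show "ar_map F i \<cdot>\<^bsub>D\<^esub> ar_map F f = ar_map F j \<cdot>\<^bsub>D\<^esub> ar_map F g"
      using map_comp[OF f i] map_comp[OF g j] pD(9) by simp
  next
    fix u v assume uv: "u \<in> Ar D" "v \<in> Ar D" "Dom D u = Cod D (ar_map F f)" "Dom D v = Cod D (ar_map F g)"
      "Cod D u = Cod D v" "u \<cdot>\<^bsub>D\<^esub> ar_map F f = v \<cdot>\<^bsub>D\<^esub> ar_map F g"
    have u: "u \<in> Hom D (obj_map F B) (Cod D u)" and v: "v \<in> Hom D (obj_map F B') (Cod D u)"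
      using uv mf mg by (simp_all add: Hom_def)
    obtain G t a b where *: "t \<in> Hom D (obj_map F G) (Cod D u)" "a \<in> Hom C B G" "b \<in> Hom C B' G"
      "t \<cdot>\<^bsub>D\<^esub> ar_map F a = u" "t \<cdot>\<^bsub>D\<^esub> ar_map F b = v"
      and un: "\<And>A f g. f \<in> Hom C A G \<Longrightarrow> g \<in> Hom C A G \<Longrightarrow> t \<cdot>\<^bsub>D\<^esub> ar_map F f = t \<cdot>\<^bsub>D\<^esub> ar_map F g \<Longrightarrow> f = g"
      by (rule classify_pair[OF o(1,2) u v], rule that)
    \<comment> \<open>The lifts form a cocone on the span in \<open>C\<close>: both sides lift the
      common composite of \<open>uv(6)\<close>, so uniqueness of lifts applies.\<close>
    have "a \<cdot>\<^bsub>C\<^esub> f = b \<cdot>\<^bsub>C\<^esub> g"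
      by (rule un[OF S.comp_in[OF f *(2)] S.comp_in[OF g *(3)]])
        (simp add: map_triangle[OF f *(2,1)] map_triangle[OF g *(3,1)] * uv(6))
    then obtain h where h: "h \<in> Ar C" "Dom C h = P" "Cod C h = G" "h \<cdot>\<^bsub>C\<^esub> i = a" "h \<cdot>\<^bsub>C\<^esub> j = b"
      using S.is_pushout_ex[OF po, of a b] *(2,3) by (auto simp: Hom_def B_def B'_def P_def)
    then have hH: "h \<in> Hom C P G" by (simp add: Hom_def)
    have "t \<cdot>\<^bsub>D\<^esub> ar_map F h \<in> Hom D (obj_map F P) (Cod D u)"
      by (rule T.comp_in[OF ar_in[OF hH] *(1)])
    moreover have "(t \<cdot>\<^bsub>D\<^esub> ar_map F h) \<cdot>\<^bsub>D\<^esub> ar_map F i = u" "(t \<cdot>\<^bsub>D\<^esub> ar_map F h) \<cdot>\<^bsub>D\<^esub> ar_map F j = v"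
      by (simp_all only: map_triangle[OF i hH *(1), symmetric] map_triangle[OF j hH *(1), symmetric] h *)
    ultimately show "\<exists>h. h \<in> Ar D \<and> Dom D h = Cod D (ar_map F i) \<and> Cod D h = Cod D u \<and>
        h \<cdot>\<^bsub>D\<^esub> ar_map F i = u \<and> h \<cdot>\<^bsub>D\<^esub> ar_map F j = v"
      using mi by (intro exI[of _ "t \<cdot>\<^bsub>D\<^esub> ar_map F h"]) (auto simp only: Hom_def mem_Collect_eq)
  next
    fix h k assume hk: "h \<in> Ar D" "k \<in> Ar D" "Dom D h = Cod D (ar_map F i)" "Dom D k = Cod D (ar_map F i)"
      "Cod D h = Cod D k" "h \<cdot>\<^bsub>D\<^esub> ar_map F i = k \<cdot>\<^bsub>D\<^esub> ar_map F i" "h \<cdot>\<^bsub>D\<^esub> ar_map F j = k \<cdot>\<^bsub>D\<^esub> ar_map F j"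
    have h: "h \<in> Hom D (obj_map F P) (Cod D h)" and k: "k \<in> Hom D (obj_map F P) (Cod D h)"
      using hk(1-5) mi by (simp_all add: Hom_def)
    obtain G t a b where *: "t \<in> Hom D (obj_map F G) (Cod D h)" "a \<in> Hom C P G" "b \<in> Hom C P G"
      "t \<cdot>\<^bsub>D\<^esub> ar_map F a = h" "t \<cdot>\<^bsub>D\<^esub> ar_map F b = k"
      and un: "\<And>A f g. f \<in> Hom C A G \<Longrightarrow> g \<in> Hom C A G \<Longrightarrow> t \<cdot>\<^bsub>D\<^esub> ar_map F f = t \<cdot>\<^bsub>D\<^esub> ar_map F g \<Longrightarrow> f = g"
      by (rule classify_pair[OF o(3,3) h k], rule that)
    have "a \<cdot>\<^bsub>C\<^esub> i = b \<cdot>\<^bsub>C\<^esub> i"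
      by (rule un[OF S.comp_in[OF i *(2)] S.comp_in[OF i *(3)]])
        (simp add: map_triangle[OF i _ *(1)] * hk(6))
    moreover have "a \<cdot>\<^bsub>C\<^esub> j = b \<cdot>\<^bsub>C\<^esub> j"
      by (rule un[OF S.comp_in[OF j *(2)] S.comp_in[OF j *(3)]])
        (simp add: map_triangle[OF j _ *(1)] * hk(7))
    ultimately have "a = b"
      by (rule S.is_pushout_eqI[OF po, rotated -2]) (use *(2,3) in \<open>simp_all add: Hom_def P_def\<close>)
    then show "h = k" using * by simp
  qed (use mf mg mi mj in \<open>simp_all add: Hom_def\<close>)
qed

end

text \<open>A pushout is a coequalizer of the two composites into the sum. The assumptions state the
  coequalizer property of \<open>q\<close> piecewise, in the form in which it will be available for
  diagrams.\<close>

lemma (in category_with_sums) is_pushout_coequalizer: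
  assumes f: "f \<in> Ar C" "g \<in> Ar C" "Dom C f = Dom C g"
    and q: "q \<in> Ar C" "Dom C q = sum_ob S (Cod C f) (Cod C g)"
    and eq: "q \<cdot> inj1 S (Cod C f) (Cod C g) \<cdot> f = q \<cdot> inj2 S (Cod C f) (Cod C g) \<cdot> g"
    and ex: "\<And>k. k \<in> Ar C \<Longrightarrow> Dom C k = sum_ob S (Cod C f) (Cod C g) \<Longrightarrow>
      k \<cdot> inj1 S (Cod C f) (Cod C g) \<cdot> f = k \<cdot> inj2 S (Cod C f) (Cod C g) \<cdot> g \<Longrightarrow>
      \<exists>h \<in> Hom C (Cod C q) (Cod C k). h \<cdot> q = k"
    and epi: "\<And>h k. h \<in> Ar C \<Longrightarrow> k \<in> Ar C \<Longrightarrow> Dom C h = Cod C q \<Longrightarrow> Dom C k = Cod C q \<Longrightarrow>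
      Cod C h = Cod C k \<Longrightarrow> h \<cdot> q = k \<cdot> q \<Longrightarrow> h = k"
  shows "is_pushout C f g (q \<cdot> inj1 S (Cod C f) (Cod C g)) (q \<cdot> inj2 S (Cod C f) (Cod C g))"
    (is "is_pushout C f g (q \<cdot> ?i) (q \<cdot> ?j)")
proof (rule is_pushoutI)
  show "(q \<cdot> ?i) \<cdot> f = (q \<cdot> ?j) \<cdot> g"
    using f q eq by simp
next
  fix u v assume u: "u \<in> Ar C" "v \<in> Ar C" "Dom C u = Cod C f" "Dom C v = Cod C g"
       "Cod C u = Cod C v" "u \<cdot> f = v \<cdot> g"
  have "\<exists>h \<in> Hom C (Cod C q) (Cod C (copair C S u v)). h \<cdot> q = copair C S u v"
    by (rule ex) (use f u in simp_all)
  then obtain h where h: "h \<in> Ar C" "Dom C h = Cod C q" "Cod C h = Cod C u" "h \<cdot> q = copair C S u v"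
    using u by (auto simp: Hom_def)
  have "(h \<cdot> q) \<cdot> ?i = u" "(h \<cdot> q) \<cdot> ?j = v"
    unfolding h(4) using f u by simp_all
  then show "\<exists>h. h \<in> Ar C \<and> Dom C h = Cod C (q \<cdot> ?i) \<and> Cod C h = Cod C u \<and> h \<cdot> q \<cdot> ?i = u \<and> h \<cdot> q \<cdot> ?j = v"
    using h(1-3) f q by (intro exI[of _ h]) simp
next
  fix h k assume h: "h \<in> Ar C" "k \<in> Ar C" "Dom C h = Cod C (q \<cdot> ?i)" "Dom C k = Cod C (q \<cdot> ?i)"
       "Cod C h = Cod C k" "h \<cdot> q \<cdot> ?i = k \<cdot> q \<cdot> ?i" "h \<cdot> q \<cdot> ?j = k \<cdot> q \<cdot> ?j"
  have "h \<cdot> q = k \<cdot> q"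
    by (rule sum_eqI[of _ "Cod C f" "Cod C g"]) (use h f q in simp_all)
  then show "h = k"
    by (rule_tac epi) (use h f q in simp_all)
qed (use f q in simp_all)

section \<open>The category of diagrams\<close>

lemma diagram_cat_simps [simp]:
  "Ob (diagram_cat E) = {D. is_diagram E D}" "Dom (diagram_cat E) (D, \<phi>, D') = D"
  "Cod (diagram_cat E) (D, \<phi>, D') = D'" "ident (diagram_cat E) D = (D, gident (shape D), D)"
  "(D1, \<psi>, D2) \<cdot>\<^bsub>diagram_cat E\<^esub> (D, \<phi>, D') = (D, gcomp (shape D) \<psi> \<phi>, D2)"
  by (simp_all add: diagram_cat_def)

text \<open>Labellings are extensional functions, so the equation of composites in the definition
  amounts to pointwise agreement on vertices and edges.\<close>

lemma diagram_cat_Ar: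
  "(D, \<phi>, D') \<in> Ar (diagram_cat E) \<longleftrightarrow> is_diagram E D \<and> is_diagram E D' \<and>
    graph_morphism (shape D) (shape D') \<phi> \<and>
    (\<forall>x \<in> verts (shape D). on_v (lab D') (on_v \<phi> x) = on_v (lab D) x) \<and>
    (\<forall>\<alpha> \<in> edges (shape D). on_e (lab D') (on_e \<phi> \<alpha>) = on_e (lab D) \<alpha>)"
proof -
  have "gcomp (shape D) (lab D') \<phi> = lab D \<longleftrightarrow>
    (\<forall>x \<in> verts (shape D). on_v (lab D') (on_v \<phi> x) = on_v (lab D) x) \<and>
    (\<forall>\<alpha> \<in> edges (shape D). on_e (lab D') (on_e \<phi> \<alpha>) = on_e (lab D) \<alpha>)" if "is_diagram E D"
  proof -
    have "on_v (lab D) \<in> extensional (verts (shape D))" "on_e (lab D) \<in> extensional (edges (shape D))"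
      using that by (auto simp: is_diagram_def graph_morphism_def PiE_def)
    then have "compose (verts (shape D)) (on_v (lab D')) (on_v \<phi>) = on_v (lab D) \<longleftrightarrow>
        (\<forall>x \<in> verts (shape D). on_v (lab D') (on_v \<phi> x) = on_v (lab D) x)"
      "compose (edges (shape D)) (on_e (lab D')) (on_e \<phi>) = on_e (lab D) \<longleftrightarrow>
        (\<forall>x \<in> edges (shape D). on_e (lab D') (on_e \<phi> x) = on_e (lab D) x)"
      by (auto simp: fun_eq_iff compose_def restrict_def extensional_def)
    then show ?thesis
      unfolding gcomp_def by (cases "lab D") simp
  qed
  then show ?thesis
    by (auto simp: diagram_cat_def)
qed

lemma diagram_HomE:
  assumes "f \<in> Hom (diagram_cat E) A B"
  obtains \<phi> where "f = (A, \<phi>, B)" "(A, \<phi>, B) \<in> Ar (diagram_cat E)"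
  using assms by (cases f) (auto simp: Hom_def)

lemma graph_morphism_eqI:
  assumes "graph_morphism G H \<phi>" "graph_morphism G H' \<psi>"
    "\<And>x. x \<in> verts G \<Longrightarrow> on_v \<phi> x = on_v \<psi> x" "\<And>\<alpha>. \<alpha> \<in> edges G \<Longrightarrow> on_e \<phi> \<alpha> = on_e \<psi> \<alpha>"
  shows "\<phi> = \<psi>"
proof -
  have "on_v \<phi> \<in> extensional (verts G)" "on_v \<psi> \<in> extensional (verts G)"
    "on_e \<phi> \<in> extensional (edges G)" "on_e \<psi> \<in> extensional (edges G)"
    using assms(1,2) by (auto simp: graph_morphism_def PiE_def)
  then have "on_v \<phi> = on_v \<psi>" "on_e \<phi> = on_e \<psi>"
    using assms(3,4) by (auto intro: extensionalityI)
  then show ?thesis by (cases \<phi>; cases \<psi>) simp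
qed

lemma graph_morphism_gcomp:
  assumes "finite_graph G" "graph_morphism G H \<phi>" "graph_morphism H I \<psi>"
  shows "graph_morphism G I (gcomp G \<psi> \<phi>)"
  using assms unfolding graph_morphism_def gcomp_def finite_graph_def
  by (auto simp: compose_def Pi_iff PiE_iff)

lemma graph_morphism_gident: "finite_graph G \<Longrightarrow> graph_morphism G G (gident G)"
  by (auto simp: graph_morphism_def gident_def finite_graph_def)

lemma gcomp_apply [simp]:
  "x \<in> verts G \<Longrightarrow> on_v (gcomp G \<psi> \<phi>) x = on_v \<psi> (on_v \<phi> x)"
  "\<alpha> \<in> edges G \<Longrightarrow> on_e (gcomp G \<psi> \<phi>) \<alpha> = on_e \<psi> (on_e \<phi> \<alpha>)"
  by (simp_all add: gcomp_def compose_def)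

lemma gident_apply [simp]:
  "x \<in> verts G \<Longrightarrow> on_v (gident G) x = x" "\<alpha> \<in> edges G \<Longrightarrow> on_e (gident G) \<alpha> = \<alpha>"
  by (simp_all add: gident_def)

lemma graph_morphism_mem:
  assumes "graph_morphism G H \<phi>"
  shows "x \<in> verts G \<Longrightarrow> on_v \<phi> x \<in> verts H" "\<alpha> \<in> edges G \<Longrightarrow> on_e \<phi> \<alpha> \<in> edges H"
    "\<alpha> \<in> edges G \<Longrightarrow> src H (on_e \<phi> \<alpha>) = on_v \<phi> (src G \<alpha>)"
    "\<alpha> \<in> edges G \<Longrightarrow> tgt H (on_e \<phi> \<alpha>) = on_v \<phi> (tgt G \<alpha>)"
  using assms by (auto simp: graph_morphism_def)

lemma diagram_mem:
  assumes "is_diagram E D"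
  shows "x \<in> verts (shape D) \<Longrightarrow> on_v (lab D) x \<in> Ob E"
    "\<alpha> \<in> edges (shape D) \<Longrightarrow>
      on_e (lab D) \<alpha> \<in> Hom E (on_v (lab D) (src (shape D) \<alpha>)) (on_v (lab D) (tgt (shape D) \<alpha>))"
    "\<alpha> \<in> edges (shape D) \<Longrightarrow> src (shape D) \<alpha> \<in> verts (shape D)"
    "\<alpha> \<in> edges (shape D) \<Longrightarrow> tgt (shape D) \<alpha> \<in> verts (shape D)"
    "finite (verts (shape D))" "finite (edges (shape D))"
  using assms
  by (auto simp: is_diagram_def graph_morphism_def finite_graph_def underlying_graph_def Hom_def)

lemma diagram_category:
  fixes E :: "('o, 'a, 'z) cat_scheme"
  shows "category (diagram_cat E :: (('v, 'e, 'o, 'a) diagram, ('v, 'e, 'o, 'a) diagram_ar) cat)"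
proof
  let ?C = "diagram_cat E :: (('v, 'e, 'o, 'a) diagram, ('v, 'e, 'o, 'a) diagram_ar) cat"
  show "Dom ?C f \<in> Ob ?C" "Cod ?C f \<in> Ob ?C" if "f \<in> Ar ?C" for f
    using that by (cases f; simp add: diagram_cat_Ar)+
  show "ident ?C A \<in> Hom ?C A A" if "A \<in> Ob ?C" for A
    using that by (simp add: Hom_def diagram_cat_Ar)
      (auto simp: graph_morphism_def gident_def is_diagram_def finite_graph_def)
  show "g \<cdot>\<^bsub>?C\<^esub> f \<in> Hom ?C A D" if ar: "f \<in> Hom ?C A B" "g \<in> Hom ?C B D" for f g A B D
  proof -
    obtain \<phi> \<psi> where *: "f = (A, \<phi>, B)" "g = (B, \<psi>, D)"
      using ar by (metis diagram_HomE)
    then have "(A, \<phi>, B) \<in> Ar ?C" "(B, \<psi>, D) \<in> Ar ?C"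
      using ar by (simp_all add: Hom_def)
    then show ?thesis
      unfolding * by (auto simp: Hom_def diagram_cat_Ar graph_morphism_mem is_diagram_def
          intro: graph_morphism_gcomp)
  qed
  show "f \<cdot>\<^bsub>?C\<^esub> ident ?C A = f" "ident ?C B \<cdot>\<^bsub>?C\<^esub> f = f" if ar: "f \<in> Hom ?C A B" for f A B
  proof -
    obtain \<phi> where *: "f = (A, \<phi>, B)"
      using ar by (rule diagram_HomE)
    then have m: "graph_morphism (shape A) (shape B) \<phi>" "finite_graph (shape A)" "finite_graph (shape B)"
      using ar by (simp_all add: Hom_def diagram_cat_Ar is_diagram_def)
    have "gcomp (shape A) \<phi> (gident (shape A)) = \<phi>"
      by (rule graph_morphism_eqI[OF graph_morphism_gcomp[OF m(2) graph_morphism_gident[OF m(2)] m(1)] m(1)]) simp_all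
    moreover have "gcomp (shape A) (gident (shape B)) \<phi> = \<phi>"
      by (rule graph_morphism_eqI[OF graph_morphism_gcomp[OF m(2) m(1) graph_morphism_gident[OF m(3)]] m(1)])
        (simp_all add: graph_morphism_mem[OF m(1)])
    ultimately show "f \<cdot>\<^bsub>?C\<^esub> ident ?C A = f" "ident ?C B \<cdot>\<^bsub>?C\<^esub> f = f"
      unfolding * by simp_all
  qed
  show "(h \<cdot>\<^bsub>?C\<^esub> g) \<cdot>\<^bsub>?C\<^esub> f = h \<cdot>\<^bsub>?C\<^esub> g \<cdot>\<^bsub>?C\<^esub> f"
    if ar: "f \<in> Hom ?C A B" "g \<in> Hom ?C B D" "h \<in> Hom ?C D H" for f g h A B D H
  proof -
    obtain \<phi> \<psi> \<chi> where *: "f = (A, \<phi>, B)" "g = (B, \<psi>, D)" "h = (D, \<chi>, H)"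
      using ar by (metis diagram_HomE)
    then have m: "graph_morphism (shape A) (shape B) \<phi>" "graph_morphism (shape B) (shape D) \<psi>"
      "graph_morphism (shape D) (shape H) \<chi>" "finite_graph (shape A)" "finite_graph (shape B)"
      using ar by (simp_all add: Hom_def diagram_cat_Ar is_diagram_def)
    have "gcomp (shape A) (gcomp (shape B) \<chi> \<psi>) \<phi> = gcomp (shape A) \<chi> (gcomp (shape A) \<psi> \<phi>)"
      by (rule graph_morphism_eqI[of "shape A" "shape H" _ "shape H"])
        (simp_all add: m graph_morphism_mem[OF m(1)] graph_morphism_gcomp[of _ "shape B"]
          graph_morphism_gcomp[of _ "shape D"])
    then show ?thesis
      unfolding * by simp
  qed
qed

text \<open>The value \<open>undefined\<close> is forced: source, target and edge labelling are
  extensional functions on an empty set of edges.\<close>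

definition strip_edges :: "('v, 'e, 'o, 'a) diagram \<Rightarrow> ('v, 'e, 'o, 'a) diagram" where
  "strip_edges D = \<lparr>shape = \<lparr>verts = verts (shape D), edges = {}, src = (\<lambda>_. undefined), tgt = (\<lambda>_. undefined)\<rparr>,
     lab = \<lparr>on_v = on_v (lab D), on_e = (\<lambda>_. undefined)\<rparr>\<rparr>"

lemma strip_edges_diagram: "is_diagram E D \<Longrightarrow> is_diagram E (strip_edges D)"
  by (auto simp: is_diagram_def strip_edges_def finite_graph_def graph_morphism_def underlying_graph_def)

text \<open>Out of a discrete diagram a morphism has an empty edge part, so the same vertex map also
  lands in the edgeless part of its target.\<close>

lemma strip_edges_arrow:
  assumes "(X, \<phi>, D) \<in> Ar (diagram_cat E)" "X \<in> discrete_diagrams"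
  shows "(X, \<phi>, strip_edges D) \<in> Ar (diagram_cat E)"
  using assms strip_edges_diagram[of E D]
  by (auto simp: diagram_cat_Ar discrete_diagrams_def graph_morphism_def strip_edges_def)

text \<open>An edge of \<open>D\<close> would need an image among no edges at all.\<close>

lemma arrow_to_strip_edges:
  assumes "(D, \<phi>, strip_edges D') \<in> Ar (diagram_cat E)"
  shows "D \<in> discrete_diagrams"
  using assms by (auto simp: diagram_cat_Ar discrete_diagrams_def graph_morphism_def strip_edges_def)

text \<open>The choice \<open>T\<close> reveals nothing about the shape of its values, so
  discreteness is read off from an arrow into an edgeless diagram, which the universal property
  provides.\<close>

lemma chosen_sums_discrete:
  fixes T :: "(('v, 'e, 'o, 'a) diagram, ('v, 'e, 'o, 'a) diagram_ar) sum_choice"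
  assumes "chosen_sums (diagram_cat E) T"
  shows "zero_ob T \<in> discrete_diagrams"
    "is_diagram E X \<Longrightarrow> is_diagram E Y \<Longrightarrow> X \<in> discrete_diagrams \<Longrightarrow> Y \<in> discrete_diagrams \<Longrightarrow>
      sum_ob T X Y \<in> discrete_diagrams"
proof -
  let ?C = "diagram_cat E :: (('v, 'e, 'o, 'a) diagram, ('v, 'e, 'o, 'a) diagram_ar) cat"
  interpret category_with_sums ?C T
    by (intro category_with_sums.intro category_with_sums_axioms.intro diagram_category assms)
  have "strip_edges (zero_ob T) \<in> Ob ?C"
    using zero_in strip_edges_diagram by auto
  then have "from_zero ?C T (strip_edges (zero_ob T)) \<in> Hom ?C (zero_ob T) (strip_edges (zero_ob T))"
    by (simp add: Hom_def del: diagram_cat_simps)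
  then show "zero_ob T \<in> discrete_diagrams"
    by (auto elim!: diagram_HomE intro: arrow_to_strip_edges)
  assume o: "is_diagram E X" "is_diagram E Y" and d: "X \<in> discrete_diagrams" "Y \<in> discrete_diagrams"
  then have X: "X \<in> Ob ?C" "Y \<in> Ob ?C" by simp_all
  let ?P = "sum_ob T X Y"
  have "inj1 T X Y \<in> Hom ?C X ?P" "inj2 T X Y \<in> Hom ?C Y ?P"
    using X by (simp_all add: Hom_def del: diagram_cat_simps)
  then obtain \<phi> \<psi> where "(X, \<phi>, ?P) \<in> Ar ?C" "(Y, \<psi>, ?P) \<in> Ar ?C"
    by (metis diagram_HomE)
  then have "(X, \<phi>, strip_edges ?P) \<in> Ar ?C" "(Y, \<psi>, strip_edges ?P) \<in> Ar ?C"
    using d strip_edges_arrow by blast+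
  \<comment> \<open>The injections, viewed as arrows into the edgeless part, induce an arrow from
    the sum to its own edgeless part.\<close>
  then have "copair ?C T (X, \<phi>, strip_edges ?P) (Y, \<psi>, strip_edges ?P) \<in> Hom ?C ?P (strip_edges ?P)"
    by (simp add: Hom_def)
  then show "?P \<in> discrete_diagrams"
    by (auto elim!: diagram_HomE intro: arrow_to_strip_edges)
qed

text \<open>Two vertices (or two edges) of \<open>B\<close> are identified in the coequalizer when they carry the same
  label and every arrow out of \<open>B\<close> that equalizes the given pair identifies them. Choosing
  representatives keeps the quotient inside the given types of vertices and edges.\<close>

lemma diagram_coequalizer:
  fixes a b :: "('v, 'e, 'o, 'a) diagram_ar" and E :: "('o, 'a, 'z) cat_scheme"
  defines "C \<equiv> diagram_cat E"
  assumes a: "a \<in> Hom C A B" and b: "b \<in> Hom C A B"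
  obtains q Z where "q \<in> Hom C B Z" "q \<cdot>\<^bsub>C\<^esub> a = q \<cdot>\<^bsub>C\<^esub> b"
    "\<And>c H. c \<in> Hom C B H \<Longrightarrow> c \<cdot>\<^bsub>C\<^esub> a = c \<cdot>\<^bsub>C\<^esub> b \<Longrightarrow> \<exists>h \<in> Hom C Z H. h \<cdot>\<^bsub>C\<^esub> q = c"
    "\<And>h k H. h \<in> Hom C Z H \<Longrightarrow> k \<in> Hom C Z H \<Longrightarrow> h \<cdot>\<^bsub>C\<^esub> q = k \<cdot>\<^bsub>C\<^esub> q \<Longrightarrow> h = k"
proof -
  obtain \<phi> where \<phi>: "a = (A, \<phi>, B)" "(A, \<phi>, B) \<in> Ar C"
    using a unfolding C_def by (rule diagram_HomE)
  obtain \<psi> where \<psi>: "b = (A, \<psi>, B)" "(A, \<psi>, B) \<in> Ar C"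
    using b unfolding C_def by (rule diagram_HomE)
  have arD: "is_diagram E D \<and> is_diagram E D' \<and> graph_morphism (shape D) (shape D') \<omega> \<and>
    (\<forall>x \<in> verts (shape D). on_v (lab D') (on_v \<omega> x) = on_v (lab D) x) \<and>
    (\<forall>\<alpha> \<in> edges (shape D). on_e (lab D') (on_e \<omega> \<alpha>) = on_e (lab D) \<alpha>)"
    if "(D, \<omega>, D') \<in> Ar C" for D \<omega> D'
    using that unfolding C_def diagram_cat_Ar .
  have AB: "is_diagram E A" "is_diagram E B"
    using arD[OF \<phi>(2)] by simp_all
  note B = diagram_mem[OF AB(2)]
  let ?V = "verts (shape B)" and ?E = "edges (shape B)"
  \<comment> \<open>All arrows out of \<open>B\<close> that equalize \<open>a\<close> and
    \<open>b\<close>. Agreement under all of them is an equivalence relation by its form, in place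
    of one generated by the pairs to be identified, and each competitor factors because it is itself
    a member of \<open>Q\<close>.\<close>
  define Q where "Q = {(\<chi>, H). (B, \<chi>, H) \<in> Ar C \<and> (B, \<chi>, H) \<cdot>\<^bsub>C\<^esub> a = (B, \<chi>, H) \<cdot>\<^bsub>C\<^esub> b}"
  \<comment> \<open>The key of a vertex: equal keys mean identified vertices. The label is a
    component of the key, so labels are constant on classes whatever \<open>Q\<close>
    contains.\<close>
  define kv where "kv x = (on_v (lab B) x, \<lambda>(\<chi>, H) \<in> Q. on_v \<chi> x)" for x
  define ke where "ke x = (on_e (lab B) x, \<lambda>(\<chi>, H) \<in> Q. on_e \<chi> x)" for x
  have kv_iff: "kv x = kv y \<longleftrightarrow> on_v (lab B) x = on_v (lab B) y \<and> (\<forall>(\<chi>, H) \<in> Q. on_v \<chi> x = on_v \<chi> y)" for x y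
    unfolding kv_def by (auto simp: fun_eq_iff restrict_def split: if_splits)
  have ke_iff: "ke x = ke y \<longleftrightarrow> on_e (lab B) x = on_e (lab B) y \<and> (\<forall>(\<chi>, H) \<in> Q. on_e \<chi> x = on_e \<chi> y)" for x y
    unfolding ke_def by (auto simp: fun_eq_iff restrict_def split: if_splits)
  \<comment> \<open>One representative per class, picked by inverting the key; the quotient then
    lives on a subset of the vertices of \<open>B\<close>.\<close>
  define cv where "cv x = inv_into ?V kv (kv x)" for x
  define ce where "ce x = inv_into ?E ke (ke x)" for x
  have cv: "cv x \<in> ?V" "kv (cv x) = kv x" if "x \<in> ?V" for x
    using that by (simp_all add: cv_def inv_into_into f_inv_into_f)
  have ce: "ce x \<in> ?E" "ke (ce x) = ke x" if "x \<in> ?E" for x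
    using that by (simp_all add: ce_def inv_into_into f_inv_into_f)
  have cv_eq: "cv x = cv y" if "kv x = kv y" for x y using that by (simp add: cv_def)
  have ce_eq: "ce x = ce y" if "ke x = ke y" for x y using that by (simp add: ce_def)
  have lab_cv: "on_v (lab B) (cv x) = on_v (lab B) x" if "x \<in> ?V" for x
    using cv[OF that] by (simp add: kv_iff)
  have lab_ce: "on_e (lab B) (ce x) = on_e (lab B) x" if "x \<in> ?E" for x
    using ce[OF that] by (simp add: ke_iff)
  have Q_cv: "on_v \<chi> (cv x) = on_v \<chi> x" if "(\<chi>, H) \<in> Q" "x \<in> ?V" for \<chi> H x
    using cv[OF that(2)] that(1) by (auto simp: kv_iff)
  have Q_ce: "on_e \<chi> (ce x) = on_e \<chi> x" if "(\<chi>, H) \<in> Q" "x \<in> ?E" for \<chi> H x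
    using ce[OF that(2)] that(1) by (auto simp: ke_iff)
  have Q_Ar: "(B, \<chi>, H) \<in> Ar C" if "(\<chi>, H) \<in> Q" for \<chi> H
    using that by (simp add: Q_def)
  \<comment> \<open>Source and target descend to classes of edges: members of \<open>Q\<close> send
    identified edges to one edge, hence their ends to the same ends, and the labels of the ends are
    the domain and codomain of the common edge label.\<close>
  have ends: "kv (src (shape B) \<alpha>) = kv (src (shape B) \<beta>) \<and> kv (tgt (shape B) \<alpha>) = kv (tgt (shape B) \<beta>)"
    if \<alpha>: "\<alpha> \<in> ?E" and \<beta>: "\<beta> \<in> ?E" and "ke \<alpha> = ke \<beta>" for \<alpha> \<beta>
  proof -
    have "on_v \<chi> (src (shape B) \<alpha>) = on_v \<chi> (src (shape B) \<beta>) \<and>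
        on_v \<chi> (tgt (shape B) \<alpha>) = on_v \<chi> (tgt (shape B) \<beta>)" if "(\<chi>, H) \<in> Q" for \<chi> H
    proof -
      have "graph_morphism (shape B) (shape H) \<chi>"
        using arD[OF Q_Ar[OF that]] by simp
      moreover have "on_e \<chi> \<alpha> = on_e \<chi> \<beta>"
        using \<open>ke \<alpha> = ke \<beta>\<close> that by (auto simp: ke_iff)
      ultimately show ?thesis
        using graph_morphism_mem(3,4)[of "shape B" "shape H" \<chi>] \<alpha> \<beta> by metis
    qed
    moreover have "on_e (lab B) \<alpha> = on_e (lab B) \<beta>"
      using \<open>ke \<alpha> = ke \<beta>\<close> by (simp add: ke_iff)
    ultimately show ?thesis
      using B(2)[OF \<alpha>] B(2)[OF \<beta>] by (auto simp: kv_iff Hom_def)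
  qed
  define Z where "Z = \<lparr>shape = \<lparr>verts = cv ` ?V, edges = ce ` ?E,
      src = (\<lambda>e \<in> ce ` ?E. cv (src (shape B) e)), tgt = (\<lambda>e \<in> ce ` ?E. cv (tgt (shape B) e))\<rparr>,
    lab = \<lparr>on_v = restrict (on_v (lab B)) (cv ` ?V), on_e = restrict (on_e (lab B)) (ce ` ?E)\<rparr>\<rparr>"
  have Z: "is_diagram E Z"
  proof -
    have sE: "e \<in> ?E" if "e \<in> ce ` ?E" for e
      using that ce(1) by blast
    have sV: "x \<in> ?V" if "x \<in> cv ` ?V" for x
      using that cv(1) by blast
    have "finite_graph (shape Z)"
      unfolding finite_graph_def Z_def using B(3-6) sE by (simp add: restrict_PiE_iff)
    moreover have "on_v (lab Z) \<in> verts (shape Z) \<rightarrow>\<^sub>E Ob E" "on_e (lab Z) \<in> edges (shape Z) \<rightarrow>\<^sub>E Ar E"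
      unfolding Z_def using B(1,2) sV sE by (simp_all add: restrict_PiE_iff Hom_def lab_cv lab_ce)
    moreover have "Dom E (on_e (lab Z) e) = on_v (lab Z) (src (shape Z) e) \<and>
        Cod E (on_e (lab Z) e) = on_v (lab Z) (tgt (shape Z) e)" if "e \<in> edges (shape Z)" for e
    proof -
      have e: "e \<in> ce ` ?E" "e \<in> ?E" using that sE by (simp_all add: Z_def)
      then show ?thesis
        using B(2)[OF e(2)] B(3,4)[OF e(2)] lab_cv by (simp add: Z_def Hom_def)
    qed
    ultimately show ?thesis
      by (simp add: is_diagram_def graph_morphism_def underlying_graph_def)
  qed
  define \<theta> where "\<theta> = \<lparr>on_v = restrict cv ?V, on_e = restrict ce ?E\<rparr>"
  have \<theta>: "(B, \<theta>, Z) \<in> Ar C"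
    unfolding C_def diagram_cat_Ar graph_morphism_def
  proof (intro conjI ballI)
    fix \<alpha> assume \<alpha>: "\<alpha> \<in> ?E"
    then have "cv (src (shape B) (ce \<alpha>)) = cv (src (shape B) \<alpha>)"
      "cv (tgt (shape B) (ce \<alpha>)) = cv (tgt (shape B) \<alpha>)"
      using ends[OF ce(1) _ ce(2)] cv_eq by blast+
    then show "src (shape Z) (on_e \<theta> \<alpha>) = on_v \<theta> (src (shape B) \<alpha>)"
      "tgt (shape Z) (on_e \<theta> \<alpha>) = on_v \<theta> (tgt (shape B) \<alpha>)"
      using \<alpha> B(3,4) by (simp_all add: Z_def \<theta>_def)
  qed (use AB Z lab_cv lab_ce in \<open>simp_all add: Z_def \<theta>_def restrict_PiE_iff\<close>)
  have \<phi>m: "graph_morphism (shape A) (shape B) \<phi>" and \<psi>m: "graph_morphism (shape A) (shape B) \<psi>"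
    using arD[OF \<phi>(2)] arD[OF \<psi>(2)] by simp_all
  have m: "graph_morphism (shape A) (shape H) (gcomp (shape A) \<chi> \<omega>)"
    if "(B, \<chi>, H) \<in> Ar C" "(A, \<omega>, B) \<in> Ar C" for \<chi> H \<omega>
    using arD[OF that(1)] arD[OF that(2)] graph_morphism_gcomp
    by (auto simp: is_diagram_def)
  have Q_eq: "on_v \<chi> (on_v \<phi> x) = on_v \<chi> (on_v \<psi> x)" if "(\<chi>, H) \<in> Q" "x \<in> verts (shape A)" for \<chi> H x
  proof -
    have "gcomp (shape A) \<chi> \<phi> = gcomp (shape A) \<chi> \<psi>"
      using that(1) by (simp add: Q_def \<phi> \<psi> C_def)
    then show ?thesis using gcomp_apply(1)[OF that(2)] by metis
  qed
  have Q_eq': "on_e \<chi> (on_e \<phi> x) = on_e \<chi> (on_e \<psi> x)" if "(\<chi>, H) \<in> Q" "x \<in> edges (shape A)" for \<chi> H x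
  proof -
    have "gcomp (shape A) \<chi> \<phi> = gcomp (shape A) \<chi> \<psi>"
      using that(1) by (simp add: Q_def \<phi> \<psi> C_def)
    then show ?thesis using gcomp_apply(2)[OF that(2)] by metis
  qed
  have "gcomp (shape A) \<theta> \<phi> = gcomp (shape A) \<theta> \<psi>"
  proof (rule graph_morphism_eqI[OF m[OF \<theta> \<phi>(2)] m[OF \<theta> \<psi>(2)]])
    fix x assume x: "x \<in> verts (shape A)"
    \<comment> \<open>Both images carry the label of \<open>x\<close> in \<open>A\<close>, and
      members of \<open>Q\<close> identify them by definition. Hence \<theta> equalizes the
      pair.\<close>
    have "kv (on_v \<phi> x) = kv (on_v \<psi> x)"
      using arD[OF \<phi>(2)] arD[OF \<psi>(2)] x Q_eq by (auto simp: kv_iff)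
    then have "cv (on_v \<phi> x) = cv (on_v \<psi> x)"
      by (rule cv_eq)
    then show "on_v (gcomp (shape A) \<theta> \<phi>) x = on_v (gcomp (shape A) \<theta> \<psi>) x"
      using x graph_morphism_mem[OF \<phi>m] graph_morphism_mem[OF \<psi>m] by (simp add: \<theta>_def)
  next
    fix x assume x: "x \<in> edges (shape A)"
    have "ke (on_e \<phi> x) = ke (on_e \<psi> x)"
      using arD[OF \<phi>(2)] arD[OF \<psi>(2)] x Q_eq' by (auto simp: ke_iff)
    then have "ce (on_e \<phi> x) = ce (on_e \<psi> x)"
      by (rule ce_eq)
    then show "on_e (gcomp (shape A) \<theta> \<phi>) x = on_e (gcomp (shape A) \<theta> \<psi>) x"
      using x graph_morphism_mem[OF \<phi>m] graph_morphism_mem[OF \<psi>m] by (simp add: \<theta>_def)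
  qed
  then have q_eq: "(B, \<theta>, Z) \<cdot>\<^bsub>C\<^esub> a = (B, \<theta>, Z) \<cdot>\<^bsub>C\<^esub> b"
    by (simp add: C_def \<phi> \<psi>)
  have fin: "finite_graph (shape B)" using AB by (simp add: is_diagram_def)
  have \<theta>m: "graph_morphism (shape B) (shape Z) \<theta>" using arD[OF \<theta>] by simp
  show ?thesis
  proof (rule that[of "(B, \<theta>, Z)" Z])
    show "(B, \<theta>, Z) \<in> Hom C B Z" using \<theta> by (simp add: Hom_def C_def)
    show "(B, \<theta>, Z) \<cdot>\<^bsub>C\<^esub> a = (B, \<theta>, Z) \<cdot>\<^bsub>C\<^esub> b" by (rule q_eq)
  next
    fix c H assume "c \<in> Hom C B H" and ceq: "c \<cdot>\<^bsub>C\<^esub> a = c \<cdot>\<^bsub>C\<^esub> b"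
    then obtain \<chi> where \<chi>: "c = (B, \<chi>, H)" "(B, \<chi>, H) \<in> Ar C"
      unfolding C_def by (elim diagram_HomE)
    have inQ: "(\<chi>, H) \<in> Q" using \<chi> ceq by (simp add: Q_def)
    note \<chi>D = arD[OF \<chi>(2)]
    have \<chi>m: "graph_morphism (shape B) (shape H) \<chi>" using \<chi>D by simp
    \<comment> \<open>Restricting \<chi> to representatives loses nothing, because \<chi> belongs to
      \<open>Q\<close> and is therefore constant on classes.\<close>
    define \<eta> where "\<eta> = \<lparr>on_v = restrict (on_v \<chi>) (cv ` ?V), on_e = restrict (on_e \<chi>) (ce ` ?E)\<rparr>"
    have \<eta>: "(Z, \<eta>, H) \<in> Ar C"
      unfolding C_def diagram_cat_Ar graph_morphism_def
    proof (intro conjI ballI)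
      fix \<alpha> assume "\<alpha> \<in> edges (shape Z)"
      then have \<alpha>: "\<alpha> \<in> ce ` ?E" "\<alpha> \<in> ?E" using ce(1) by (auto simp: Z_def)
      then show "src (shape H) (on_e \<eta> \<alpha>) = on_v \<eta> (src (shape Z) \<alpha>)"
        "tgt (shape H) (on_e \<eta> \<alpha>) = on_v \<eta> (tgt (shape Z) \<alpha>)"
        using graph_morphism_mem(3,4)[OF \<chi>m] B(3,4) Q_cv[OF inQ] by (simp_all add: Z_def \<eta>_def)
      show "on_e (lab H) (on_e \<eta> \<alpha>) = on_e (lab Z) \<alpha>"
        using \<alpha> \<chi>D by (simp add: Z_def \<eta>_def)
    next
      fix x assume "x \<in> verts (shape Z)"
      then have "x \<in> cv ` ?V" "x \<in> ?V" using cv(1) by (auto simp: Z_def)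
      then show "on_v (lab H) (on_v \<eta> x) = on_v (lab Z) x"
        using \<chi>D by (simp add: Z_def \<eta>_def)
    next
      show "on_v \<eta> \<in> verts (shape Z) \<rightarrow>\<^sub>E verts (shape H)" "on_e \<eta> \<in> edges (shape Z) \<rightarrow>\<^sub>E edges (shape H)"
        using graph_morphism_mem(1,2)[OF \<chi>m] cv(1) ce(1)
        by (simp_all add: Z_def \<eta>_def Pi_iff)
    qed (use Z \<chi>D in simp_all)
    then have \<eta>m: "graph_morphism (shape Z) (shape H) \<eta>" using arD by simp
    have "gcomp (shape B) \<eta> \<theta> = \<chi>"
      by (rule graph_morphism_eqI[OF graph_morphism_gcomp[OF fin \<theta>m \<eta>m] \<chi>m])
        (simp_all add: \<eta>_def \<theta>_def Q_cv[OF inQ] Q_ce[OF inQ])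
    then have "(Z, \<eta>, H) \<cdot>\<^bsub>C\<^esub> (B, \<theta>, Z) = c" by (simp add: \<chi> C_def)
    then show "\<exists>h \<in> Hom C Z H. h \<cdot>\<^bsub>C\<^esub> (B, \<theta>, Z) = c"
      using \<eta> by (intro bexI[of _ "(Z, \<eta>, H)"]) (simp_all add: Hom_def C_def)
  next
    fix h k H assume h: "h \<in> Hom C Z H" and k: "k \<in> Hom C Z H" and e: "h \<cdot>\<^bsub>C\<^esub> (B, \<theta>, Z) = k \<cdot>\<^bsub>C\<^esub> (B, \<theta>, Z)"
    obtain \<eta> where \<eta>: "h = (Z, \<eta>, H)" "(Z, \<eta>, H) \<in> Ar C"
      using h unfolding C_def by (rule diagram_HomE)
    obtain \<kappa> where \<kappa>: "k = (Z, \<kappa>, H)" "(Z, \<kappa>, H) \<in> Ar C"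
      using k unfolding C_def by (rule diagram_HomE)
    have e': "gcomp (shape B) \<eta> \<theta> = gcomp (shape B) \<kappa> \<theta>"
      using e by (simp add: \<eta> \<kappa> C_def)
    have "\<eta> = \<kappa>"
    proof (rule graph_morphism_eqI)
      show "graph_morphism (shape Z) (shape H) \<eta>" "graph_morphism (shape Z) (shape H) \<kappa>"
        using arD[OF \<eta>(2)] arD[OF \<kappa>(2)] by simp_all
      fix x assume "x \<in> verts (shape Z)"
      \<comment> \<open>Every vertex of \<open>Z\<close> is a representative, hence in the image of
        \<theta>; so \<theta> is epic.\<close>
      then obtain y where "y \<in> ?V" "x = cv y" by (auto simp: Z_def)
      then show "on_v \<eta> x = on_v \<kappa> x"
        using arg_cong[OF e', of "\<lambda>c. on_v c y"] by (simp add: \<theta>_def)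
    next
      fix x assume "x \<in> edges (shape Z)"
      then obtain y where "y \<in> ?E" "x = ce y" by (auto simp: Z_def)
      then show "on_e \<eta> x = on_e \<kappa> x"
        using arg_cong[OF e', of "\<lambda>c. on_e c y"] by (simp add: \<theta>_def)
    qed
    then show "h = k" by (simp add: \<eta> \<kappa>)
  qed
qed

lemma diagram_finitely_cocomplete:
  fixes T :: "(('v, 'e, 'o, 'a) diagram, ('v, 'e, 'o, 'a) diagram_ar) sum_choice"
  assumes "chosen_sums (diagram_cat E) T"
  shows "finitely_cocomplete (diagram_cat E) T"
proof -
  let ?C = "diagram_cat E :: (('v, 'e, 'o, 'a) diagram, ('v, 'e, 'o, 'a) diagram_ar) cat"
  interpret category_with_sums ?C T
    by (intro category_with_sums.intro category_with_sums_axioms.intro diagram_category assms)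
  show ?thesis
  proof (unfold_locales)
    fix f g assume f: "f \<in> Ar ?C" "g \<in> Ar ?C" "Dom ?C f = Dom ?C g"
    let ?B = "sum_ob T (Cod ?C f) (Cod ?C g)" and ?i = "inj1 T (Cod ?C f) (Cod ?C g)" and ?j = "inj2 T (Cod ?C f) (Cod ?C g)"
    have ij: "?i \<cdot>\<^bsub>?C\<^esub> f \<in> Hom ?C (Dom ?C f) ?B" "?j \<cdot>\<^bsub>?C\<^esub> g \<in> Hom ?C (Dom ?C f) ?B"
      using f by (simp_all add: Hom_def del: diagram_cat_simps)
    obtain q Z where q: "q \<in> Hom ?C ?B Z" "q \<cdot>\<^bsub>?C\<^esub> ?i \<cdot>\<^bsub>?C\<^esub> f = q \<cdot>\<^bsub>?C\<^esub> ?j \<cdot>\<^bsub>?C\<^esub> g"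
      and ex: "\<And>c H. c \<in> Hom ?C ?B H \<Longrightarrow> c \<cdot>\<^bsub>?C\<^esub> ?i \<cdot>\<^bsub>?C\<^esub> f = c \<cdot>\<^bsub>?C\<^esub> ?j \<cdot>\<^bsub>?C\<^esub> g \<Longrightarrow>
        \<exists>h \<in> Hom ?C Z H. h \<cdot>\<^bsub>?C\<^esub> q = c"
      and epi: "\<And>h k H. h \<in> Hom ?C Z H \<Longrightarrow> k \<in> Hom ?C Z H \<Longrightarrow> h \<cdot>\<^bsub>?C\<^esub> q = k \<cdot>\<^bsub>?C\<^esub> q \<Longrightarrow> h = k"
      by (rule diagram_coequalizer[OF ij], rule that)
    have "is_pushout ?C f g (q \<cdot>\<^bsub>?C\<^esub> ?i) (q \<cdot>\<^bsub>?C\<^esub> ?j)"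
    proof (rule is_pushout_coequalizer[OF f])
      show "q \<in> Ar ?C" "Dom ?C q = ?B" "q \<cdot>\<^bsub>?C\<^esub> ?i \<cdot>\<^bsub>?C\<^esub> f = q \<cdot>\<^bsub>?C\<^esub> ?j \<cdot>\<^bsub>?C\<^esub> g"
        using q by (simp_all add: Hom_def)
      show "\<exists>h \<in> Hom ?C (Cod ?C q) (Cod ?C k). h \<cdot>\<^bsub>?C\<^esub> q = k"
        if "k \<in> Ar ?C" "Dom ?C k = ?B" "k \<cdot>\<^bsub>?C\<^esub> ?i \<cdot>\<^bsub>?C\<^esub> f = k \<cdot>\<^bsub>?C\<^esub> ?j \<cdot>\<^bsub>?C\<^esub> g" for k
        using ex[of k "Cod ?C k"] that q(1) by (simp add: Hom_def)
      show "h = k" if "h \<in> Ar ?C" "k \<in> Ar ?C" "Dom ?C h = Cod ?C q" "Dom ?C k = Cod ?C q"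
        "Cod ?C h = Cod ?C k" "h \<cdot>\<^bsub>?C\<^esub> q = k \<cdot>\<^bsub>?C\<^esub> q" for h k
        using epi[of h "Cod ?C h" k] that q(1) by (simp add: Hom_def)
    qed
    then show "\<exists>i j. is_pushout ?C f g i j" by blast
  qed
qed

section \<open>Chosen colimits\<close>

text \<open>Encodes finitely many structured values, such as pairs and triples of arrows and
  objects, as vertices or edges of an infinite type.\<close>

lemma ex_inj_on_finite:
  assumes "finite A"
  shows "\<exists>f :: 'b \<Rightarrow> 'c::infinite. inj_on f A"
proof -
  obtain B :: "'c set" where "finite B" "card B = card A"
    using infinite_arbitrarily_large[OF infinite_UNIV, of "card A"] by blast
  then obtain f where "bij_betw f A B"
    using finite_same_card_bij[OF assms] by metis
  then show ?thesis
    by (auto simp: bij_betw_def)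
qed

locale category_with_colimits = category E
  for E :: "('o, 'a, 'z) cat_scheme" (structure) +
  fixes K :: "('v::infinite, 'e::infinite, 'o, 'a) colim_choice"
  assumes colimits: "chosen_colimits E K"
begin

abbreviation Diag :: "(('v, 'e, 'o, 'a) diagram, ('v, 'e, 'o, 'a) diagram_ar) cat" where
  "Diag \<equiv> diagram_cat E"

lemma colimit: "is_diagram E D \<Longrightarrow> is_colimit E D (colim_ob K D) (colim_in K D)"
  using colimits by (simp add: chosen_colimits_def)

lemma colim_cocone: "is_diagram E D \<Longrightarrow> is_cocone E D (colim_ob K D) (colim_in K D)"
  using colimit by (simp add: is_colimit_def)

lemma colim_ob_in [simp]: "is_diagram E D \<Longrightarrow> colim_ob K D \<in> Ob E"
  using colim_cocone by (simp add: is_cocone_def)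

lemma colim_in_Hom:
  assumes "is_diagram E D" "x \<in> verts (shape D)"
  shows "colim_in K D x \<in> Hom E (on_v (lab D) x) (colim_ob K D)"
  using colim_cocone[OF assms(1)] assms(2) by (simp add: is_cocone_def)

lemma colim_ex1:
  assumes "is_diagram E D" "is_cocone E D Y r"
  shows "\<exists>!h. h \<in> Hom E (colim_ob K D) Y \<and> (\<forall>x \<in> verts (shape D). h \<cdot> colim_in K D x = r x)"
  using colimit[OF assms(1)] assms(2) by (simp add: is_colimit_def)

lemma cocone_comp:
  assumes "is_cocone E D X q" "h \<in> Hom E X Y" "is_diagram E D"
  shows "is_cocone E D Y (\<lambda>x. h \<cdot> q x)"
proof -
  have "(h \<cdot> q (tgt (shape D) \<alpha>)) \<cdot> on_e (lab D) \<alpha> = h \<cdot> q (src (shape D) \<alpha>)"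
    if \<alpha>: "\<alpha> \<in> edges (shape D)" for \<alpha>
  proof -
    have "q (tgt (shape D) \<alpha>) \<in> Hom E (on_v (lab D) (tgt (shape D) \<alpha>)) X"
      "q (tgt (shape D) \<alpha>) \<cdot> on_e (lab D) \<alpha> = q (src (shape D) \<alpha>)"
      using assms(1) \<alpha> diagram_mem[OF assms(3)] by (auto simp: is_cocone_def)
    then show ?thesis
      using comp_assoc[OF diagram_mem(2)[OF assms(3) \<alpha>] _ assms(2)] by simp
  qed
  moreover have "Y \<in> Ob E"
    using assms(2) by (auto simp: Hom_def)
  ultimately show ?thesis
    using assms(1,2) comp_in unfolding is_cocone_def by blast
qed

lemma colim_eqI:
  assumes D: "is_diagram E D" and h: "h \<in> Hom E (colim_ob K D) Y" "k \<in> Hom E (colim_ob K D) Y"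
    and eq: "\<And>x. x \<in> verts (shape D) \<Longrightarrow> h \<cdot> colim_in K D x = k \<cdot> colim_in K D x"
  shows "h = k"
  using colim_ex1[OF D cocone_comp[OF colim_cocone[OF D] h(1) D]] h eq by metis

lemma cocone_pullback:
  assumes "(D, \<phi>, D') \<in> Ar Diag" "is_cocone E D' X q"
  shows "is_cocone E D X (\<lambda>x. q (on_v \<phi> x))"
proof -
  have \<phi>: "graph_morphism (shape D) (shape D') \<phi>" "is_diagram E D"
    "\<And>x. x \<in> verts (shape D) \<Longrightarrow> on_v (lab D') (on_v \<phi> x) = on_v (lab D) x"
    "\<And>\<alpha>. \<alpha> \<in> edges (shape D) \<Longrightarrow> on_e (lab D') (on_e \<phi> \<alpha>) = on_e (lab D) \<alpha>"
    using assms(1) by (simp_all add: diagram_cat_Ar)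
  note m = graph_morphism_mem[OF \<phi>(1)]
  show ?thesis
    unfolding is_cocone_def
  proof (intro conjI ballI)
    show "X \<in> Ob E" using assms(2) by (simp add: is_cocone_def)
    show "q (on_v \<phi> x) \<in> Hom E (on_v (lab D) x) X" if "x \<in> verts (shape D)" for x
      using assms(2) m(1)[OF that] \<phi>(3)[OF that] unfolding is_cocone_def by metis
    show "q (on_v \<phi> (tgt (shape D) \<alpha>)) \<cdot> on_e (lab D) \<alpha> = q (on_v \<phi> (src (shape D) \<alpha>))"
      if "\<alpha> \<in> edges (shape D)" for \<alpha>
      using assms(2) m(2-4)[OF that] \<phi>(4)[OF that] unfolding is_cocone_def by metis
  qed
qed

lemma colim_ar_props:
  assumes "(D, \<phi>, D') \<in> Ar Diag"
  shows "colim_ar E K (D, \<phi>, D') \<in> Hom E (colim_ob K D) (colim_ob K D')"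
    "x \<in> verts (shape D) \<Longrightarrow> colim_ar E K (D, \<phi>, D') \<cdot> colim_in K D x = colim_in K D' (on_v \<phi> x)"
proof -
  have D: "is_diagram E D" "is_diagram E D'"
    using assms by (simp_all add: diagram_cat_Ar)
  have "\<exists>!h. h \<in> Hom E (colim_ob K D) (colim_ob K D') \<and>
     (\<forall>x \<in> verts (shape D). h \<cdot> colim_in K D x = colim_in K D' (on_v \<phi> x))"
    by (rule colim_ex1[OF D(1) cocone_pullback[OF assms colim_cocone[OF D(2)]]])
  then have "colim_ar E K (D, \<phi>, D') \<in> Hom E (colim_ob K D) (colim_ob K D') \<and>
     (\<forall>x \<in> verts (shape D). colim_ar E K (D, \<phi>, D') \<cdot> colim_in K D x = colim_in K D' (on_v \<phi> x))"
    unfolding colim_ar_def case_prod_conv by (rule theI')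
  then show "colim_ar E K (D, \<phi>, D') \<in> Hom E (colim_ob K D) (colim_ob K D')"
    "x \<in> verts (shape D) \<Longrightarrow> colim_ar E K (D, \<phi>, D') \<cdot> colim_in K D x = colim_in K D' (on_v \<phi> x)"
    by blast+
qed

lemma comp_colim_ar:
  assumes "(D, \<phi>, D') \<in> Ar Diag" "h \<in> Hom E (colim_ob K D') X" "x \<in> verts (shape D)"
  shows "(h \<cdot> colim_ar E K (D, \<phi>, D')) \<cdot> colim_in K D x = h \<cdot> colim_in K D' (on_v \<phi> x)"
proof -
  have "is_diagram E D" using assms(1) by (simp add: diagram_cat_Ar)
  then show ?thesis
    using comp_assoc[OF colim_in_Hom colim_ar_props(1)[OF assms(1)] assms(2)] assms(3)
      colim_ar_props(2)[OF assms(1,3)] by simp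
qed

section \<open>The colimit functor and its finite classifying diagrams\<close>

lemma colim_functor: "cat_functor Diag E (colim E K)"
proof (rule cat_functor.intro[OF diagram_category category_axioms], unfold_locales)
  show "obj_map (colim E K) A \<in> Ob E" if "A \<in> Ob Diag" for A :: "('v, 'e, 'o, 'a) diagram"
    using that by (simp add: colim_def)
  show "ar_map (colim E K) f \<in> Hom E (obj_map (colim E K) A) (obj_map (colim E K) B)"
    if f: "f \<in> Hom Diag A B" for f and A B :: "('v, 'e, 'o, 'a) diagram"
  proof -
    obtain \<phi> where "f = (A, \<phi>, B)" "(A, \<phi>, B) \<in> Ar Diag" using f by (rule diagram_HomE)
    then show ?thesis using colim_ar_props(1) by (simp add: colim_def)
  qed
  show "ar_map (colim E K) (ident Diag A) = ident E (obj_map (colim E K) A)"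
    if "A \<in> Ob Diag" for A :: "('v, 'e, 'o, 'a) diagram"
  proof -
    have A: "is_diagram E A" using that by simp
    have i: "(A, gident (shape A), A) \<in> Ar Diag"
      using category.ident_in[OF diagram_category that] by (simp add: Hom_def)
    have "colim_ar E K (A, gident (shape A), A) = ident E (colim_ob K A)"
    proof (rule colim_eqI[OF A colim_ar_props(1)[OF i] ident_in[OF colim_ob_in[OF A]]])
      fix x assume x: "x \<in> verts (shape A)"
      show "colim_ar E K (A, gident (shape A), A) \<cdot> colim_in K A x = ident E (colim_ob K A) \<cdot> colim_in K A x"
        using colim_ar_props(2)[OF i x] x ident_comp[OF colim_in_Hom[OF A x]] by simp
    qed
    then show ?thesis by (simp add: colim_def)
  qed
  show "ar_map (colim E K) (g \<cdot>\<^bsub>Diag\<^esub> f) = ar_map (colim E K) g \<cdot> ar_map (colim E K) f"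
    if f: "f \<in> Hom Diag A B" and g: "g \<in> Hom Diag B D" for f g and A B D :: "('v, 'e, 'o, 'a) diagram"
  proof -
    obtain \<phi> where \<phi>: "f = (A, \<phi>, B)" "(A, \<phi>, B) \<in> Ar Diag" using f by (rule diagram_HomE)
    obtain \<psi> where \<psi>: "g = (B, \<psi>, D)" "(B, \<psi>, D) \<in> Ar Diag" using g by (rule diagram_HomE)
    have A: "is_diagram E A" and m: "graph_morphism (shape A) (shape B) \<phi>"
      using \<phi>(2) by (simp_all add: diagram_cat_Ar)
    have c: "(A, gcomp (shape A) \<psi> \<phi>, D) \<in> Ar Diag"
      using category.comp_in[OF diagram_category f g] \<phi> \<psi> by (simp add: Hom_def)
    have "colim_ar E K (A, gcomp (shape A) \<psi> \<phi>, D) = colim_ar E K (B, \<psi>, D) \<cdot> colim_ar E K (A, \<phi>, B)"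
    proof (rule colim_eqI[OF A colim_ar_props(1)[OF c]
          comp_in[OF colim_ar_props(1)[OF \<phi>(2)] colim_ar_props(1)[OF \<psi>(2)]]])
      fix x assume x: "x \<in> verts (shape A)"
      show "colim_ar E K (A, gcomp (shape A) \<psi> \<phi>, D) \<cdot> colim_in K A x
          = (colim_ar E K (B, \<psi>, D) \<cdot> colim_ar E K (A, \<phi>, B)) \<cdot> colim_in K A x"
        unfolding colim_ar_props(2)[OF c x] comp_colim_ar[OF \<phi>(2) colim_ar_props(1)[OF \<psi>(2)] x]
          colim_ar_props(2)[OF \<psi>(2) graph_morphism_mem(1)[OF m x]] using x by simp
    qed
    then show ?thesis by (simp add: colim_def \<phi> \<psi>)
  qed
qed

text \<open>The classifying diagram is the finite part of the forgetful diagram of the slice \<open>E/X\<close> that is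
  hit by the given cocones: vertices are pairs \<open>(A, u : A \<rightarrow> X)\<close>, encoded in \<open>'v\<close>, and edges are
  triples \<open>(p, a, p')\<close> with \<open>a\<close> an arrow over \<open>X\<close> from \<open>p\<close> to \<open>p'\<close>, encoded in \<open>'e\<close>.\<close>

lemma classifying_diagram:
  fixes U :: "(('v, 'e, 'o, 'a) diagram \<times> 'a) set"
  assumes fin: "finite U" and X: "X \<in> Ob E"
    and U: "\<And>D u. (D, u) \<in> U \<Longrightarrow> is_diagram E D \<and> u \<in> Hom E (colim_ob K D) X"
  obtains G t where "is_diagram E G" "t \<in> Hom E (colim_ob K G) X"
    "\<And>D u. (D, u) \<in> U \<Longrightarrow> \<exists>\<phi>. (D, \<phi>, G) \<in> Ar Diag \<and> t \<cdot> colim_ar E K (D, \<phi>, G) = u"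
    "\<And>D \<phi> \<psi>. (D, \<phi>, G) \<in> Ar Diag \<Longrightarrow> (D, \<psi>, G) \<in> Ar Diag \<Longrightarrow>
      t \<cdot> colim_ar E K (D, \<phi>, G) = t \<cdot> colim_ar E K (D, \<psi>, G) \<Longrightarrow> \<phi> = \<psi>"
proof -
  \<comment> \<open>An arrow \<open>u : colim D \<rightarrow> X\<close> is a cocone on
    \<open>D\<close>; its component at \<open>x\<close> is an object over \<open>X\<close>, and that
    is the vertex to which \<open>x\<close> will be sent.\<close>
  define vp where "vp D u x = (on_v (lab D) x, u \<cdot> colim_in K D x)"
    for D :: "('v, 'e, 'o, 'a) diagram" and u x
  define ep where "ep D u \<alpha> = (vp D u (src (shape D) \<alpha>), on_e (lab D) \<alpha>, vp D u (tgt (shape D) \<alpha>))"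
    for D :: "('v, 'e, 'o, 'a) diagram" and u \<alpha>
  define VS where "VS = (\<Union>(D, u) \<in> U. vp D u ` verts (shape D))"
  \<comment> \<open>Only the edges hit by diagrams in \<open>U\<close> are kept. All arrows over
    \<open>X\<close> between two given vertices could be infinitely many.\<close>
  define ES where "ES = (\<Union>(D, u) \<in> U. ep D u ` edges (shape D))"
  have fin_VS: "finite VS" and fin_ES: "finite ES"
    unfolding VS_def ES_def using fin U by (auto intro!: finite_UN_I finite_imageI intro: diagram_mem(5,6))
  have cocone: "is_cocone E D X (\<lambda>x. u \<cdot> colim_in K D x)" if "(D, u) \<in> U" for D u
    using cocone_comp[OF colim_cocone] U[OF that] by blast
  have VS: "fst p \<in> Ob E \<and> snd p \<in> Hom E (fst p) X" if p: "p \<in> VS" for p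
  proof -
    obtain D u x where D: "(D, u) \<in> U" and x: "x \<in> verts (shape D)" and "p = vp D u x"
      using p by (auto simp: VS_def)
    moreover have "is_diagram E D" using U[OF D] by simp
    ultimately show ?thesis
      using cocone[OF D] diagram_mem(1)[of E D x] by (simp add: vp_def is_cocone_def)
  qed
  \<comment> \<open>The cocone equation at an edge of \<open>D\<close> says that its label is an
    arrow over \<open>X\<close>.\<close>
  have ES: "p \<in> VS \<and> p' \<in> VS \<and> a \<in> Hom E (fst p) (fst p') \<and> snd p' \<cdot> a = snd p" if e: "(p, a, p') \<in> ES" for p a p'
  proof -
    obtain D u \<alpha> where D: "(D, u) \<in> U" and \<alpha>: "\<alpha> \<in> edges (shape D)" and e': "(p, a, p') = ep D u \<alpha>"
      using e by (auto simp: ES_def)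
    have D': "is_diagram E D" using U[OF D] by simp
    note m = diagram_mem(2-4)[OF D' \<alpha>]
    have "vp D u (src (shape D) \<alpha>) \<in> VS" "vp D u (tgt (shape D) \<alpha>) \<in> VS"
      unfolding VS_def using D m by blast+
    moreover have "(u \<cdot> colim_in K D (tgt (shape D) \<alpha>)) \<cdot> on_e (lab D) \<alpha> = u \<cdot> colim_in K D (src (shape D) \<alpha>)"
      using cocone[OF D] \<alpha> by (simp add: is_cocone_def)
    ultimately show ?thesis
      using e' m(1) by (simp add: ep_def vp_def)
  qed
  obtain ev :: "'o \<times> 'a \<Rightarrow> 'v" where ev: "inj_on ev VS"
    using ex_inj_on_finite[OF fin_VS] by blast
  obtain ee :: "('o \<times> 'a) \<times> 'a \<times> ('o \<times> 'a) \<Rightarrow> 'e" where ee: "inj_on ee ES"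
    using ex_inj_on_finite[OF fin_ES] by blast
  define dv where "dv = the_inv_into VS ev"
  define de where "de = the_inv_into ES ee"
  have dv: "dv (ev p) = p" if "p \<in> VS" for p
    using the_inv_into_f_f[OF ev that] by (simp add: dv_def)
  have de: "de (ee e) = e" if "e \<in> ES" for e
    using the_inv_into_f_f[OF ee that] by (simp add: de_def)
  define G :: "('v, 'e, 'o, 'a) diagram" where "G = \<lparr>shape = \<lparr>verts = ev ` VS, edges = ee ` ES,
      src = (\<lambda>e \<in> ee ` ES. ev (fst (de e))), tgt = (\<lambda>e \<in> ee ` ES. ev (snd (snd (de e))))\<rparr>,
    lab = \<lparr>on_v = (\<lambda>v \<in> ev ` VS. fst (dv v)), on_e = (\<lambda>e \<in> ee ` ES. fst (snd (de e)))\<rparr>\<rparr>"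
  have verts_G: "verts (shape G) = ev ` VS" and edges_G: "edges (shape G) = ee ` ES"
    by (simp_all add: G_def)
  have lab_v: "on_v (lab G) (ev p) = fst p" if "p \<in> VS" for p
    using that dv by (simp add: G_def)
  have edge: "src (shape G) (ee (p, a, p')) = ev p" "tgt (shape G) (ee (p, a, p')) = ev p'"
    "on_e (lab G) (ee (p, a, p')) = a" if "(p, a, p') \<in> ES" for p a p'
    using that de by (simp_all add: G_def)
  have G: "is_diagram E G"
    unfolding is_diagram_def finite_graph_def graph_morphism_def
  proof (intro conjI ballI)
    show "finite (verts (shape G))" "finite (edges (shape G))"
      using fin_VS fin_ES by (simp_all add: verts_G edges_G)
    show "src (shape G) \<in> edges (shape G) \<rightarrow>\<^sub>E verts (shape G)" "tgt (shape G) \<in> edges (shape G) \<rightarrow>\<^sub>E verts (shape G)"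
      unfolding G_def using ES de by (fastforce simp: restrict_PiE_iff)+
    show "on_v (lab G) \<in> verts (shape G) \<rightarrow>\<^sub>E verts (underlying_graph E)"
      unfolding G_def underlying_graph_def using VS dv by (simp add: Pi_iff)
    show "on_e (lab G) \<in> edges (shape G) \<rightarrow>\<^sub>E edges (underlying_graph E)"
      unfolding G_def underlying_graph_def using ES de by (fastforce simp: restrict_PiE_iff Hom_def)
    fix \<alpha> assume "\<alpha> \<in> edges (shape G)"
    then obtain p a p' where e: "(p, a, p') \<in> ES" "\<alpha> = ee (p, a, p')" by (auto simp: edges_G)
    then show "src (underlying_graph E) (on_e (lab G) \<alpha>) = on_v (lab G) (src (shape G) \<alpha>)"
      "tgt (underlying_graph E) (on_e (lab G) \<alpha>) = on_v (lab G) (tgt (shape G) \<alpha>)"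
      using ES[OF e(1)] by (simp_all add: edge lab_v underlying_graph_def Hom_def)
  qed
  \<comment> \<open>The tautological cocone: each vertex of \<open>G\<close> remembers its arrow to
    \<open>X\<close>. The mediating arrow \<open>t\<close> is the classifying one.\<close>
  have "is_cocone E G X (\<lambda>v. snd (dv v))"
    unfolding is_cocone_def
  proof (intro conjI ballI X)
    show "snd (dv x) \<in> Hom E (on_v (lab G) x) X" if "x \<in> verts (shape G)" for x
      using that VS by (auto simp: verts_G lab_v dv)
    show "snd (dv (tgt (shape G) \<alpha>)) \<cdot> on_e (lab G) \<alpha> = snd (dv (src (shape G) \<alpha>))"
      if \<alpha>: "\<alpha> \<in> edges (shape G)" for \<alpha>
    proof -
      obtain p a p' where e: "(p, a, p') \<in> ES" "\<alpha> = ee (p, a, p')" using \<alpha> by (auto simp: edges_G)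
      then show ?thesis using ES[OF e(1)] by (simp add: edge dv)
    qed
  qed
  then obtain t where t: "t \<in> Hom E (colim_ob K G) X"
    "\<And>x. x \<in> verts (shape G) \<Longrightarrow> t \<cdot> colim_in K G x = snd (dv x)"
    using colim_ex1[OF G] by blast
  show ?thesis
  proof (rule that[OF G t(1)])
    fix D u assume D: "(D, u) \<in> U"
    then have D': "is_diagram E D" and u: "u \<in> Hom E (colim_ob K D) X" using U by auto
    define \<phi> where "\<phi> = \<lparr>on_v = (\<lambda>x \<in> verts (shape D). ev (vp D u x)), on_e = (\<lambda>\<alpha> \<in> edges (shape D). ee (ep D u \<alpha>))\<rparr>"
    have v: "vp D u x \<in> VS" if "x \<in> verts (shape D)" for x
      unfolding VS_def using D that by blast
    have e: "ep D u \<alpha> \<in> ES" if "\<alpha> \<in> edges (shape D)" for \<alpha>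
      unfolding ES_def using D that by blast
    have e': "src (shape G) (ee (ep D u \<alpha>)) = ev (vp D u (src (shape D) \<alpha>))"
      "tgt (shape G) (ee (ep D u \<alpha>)) = ev (vp D u (tgt (shape D) \<alpha>))"
      "on_e (lab G) (ee (ep D u \<alpha>)) = on_e (lab D) \<alpha>" if "\<alpha> \<in> edges (shape D)" for \<alpha>
      using edge e[OF that] by (simp_all add: ep_def)
    have \<phi>: "(D, \<phi>, G) \<in> Ar Diag"
      unfolding diagram_cat_Ar graph_morphism_def
    proof (intro conjI ballI D' G)
      show "on_v \<phi> \<in> verts (shape D) \<rightarrow>\<^sub>E verts (shape G)" "on_e \<phi> \<in> edges (shape D) \<rightarrow>\<^sub>E edges (shape G)"
        unfolding \<phi>_def verts_G edges_G using v e by (simp_all add: Pi_iff)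
      show "on_v (lab G) (on_v \<phi> x) = on_v (lab D) x" if "x \<in> verts (shape D)" for x
        using that lab_v[OF v[OF that]] by (simp add: \<phi>_def vp_def)
      fix \<alpha> assume \<alpha>: "\<alpha> \<in> edges (shape D)"
      then show "src (shape G) (on_e \<phi> \<alpha>) = on_v \<phi> (src (shape D) \<alpha>)"
        "tgt (shape G) (on_e \<phi> \<alpha>) = on_v \<phi> (tgt (shape D) \<alpha>)" "on_e (lab G) (on_e \<phi> \<alpha>) = on_e (lab D) \<alpha>"
        using e'[OF \<alpha>] diagram_mem(3,4)[OF D' \<alpha>] by (simp_all add: \<phi>_def)
    qed
    have "t \<cdot> colim_ar E K (D, \<phi>, G) = u"
    proof (rule colim_eqI[OF D' comp_in[OF colim_ar_props(1)[OF \<phi>] t(1)] u])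
      fix x assume x: "x \<in> verts (shape D)"
      have "on_v \<phi> x = ev (vp D u x)" "on_v \<phi> x \<in> verts (shape G)"
        using x v by (simp_all add: \<phi>_def verts_G)
      then show "(t \<cdot> colim_ar E K (D, \<phi>, G)) \<cdot> colim_in K D x = u \<cdot> colim_in K D x"
        unfolding comp_colim_ar[OF \<phi> t(1) x] using t(2) dv[OF v[OF x]] by (simp add: vp_def)
    qed
    then show "\<exists>\<phi>. (D, \<phi>, G) \<in> Ar Diag \<and> t \<cdot> colim_ar E K (D, \<phi>, G) = u"
      using \<phi> by blast
  next
    fix D \<phi> \<psi> assume \<phi>: "(D, \<phi>, G) \<in> Ar Diag" and \<psi>: "(D, \<psi>, G) \<in> Ar Diag"
      and eq: "t \<cdot> colim_ar E K (D, \<phi>, G) = t \<cdot> colim_ar E K (D, \<psi>, G)"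
    have m: "graph_morphism (shape D) (shape G) \<phi>" "graph_morphism (shape D) (shape G) \<psi>"
      using \<phi> \<psi> by (simp_all add: diagram_cat_Ar)
    have D: "is_diagram E D" using \<phi> by (simp add: diagram_cat_Ar)
    \<comment> \<open>A vertex of \<open>G\<close> is a pair, and both entries of the image of
      \<open>x\<close> are determined: the first by label preservation, the second by composing with
      \<open>t\<close>.\<close>
    have vert: "on_v \<phi> x = on_v \<psi> x" if x: "x \<in> verts (shape D)" for x
    proof -
      obtain p p' where p: "p \<in> VS" "on_v \<phi> x = ev p" "p' \<in> VS" "on_v \<psi> x = ev p'"
        using graph_morphism_mem(1)[OF m(1) x] graph_morphism_mem(1)[OF m(2) x] by (auto simp: verts_G)
      have "t \<cdot> colim_in K G (on_v \<phi> x) = t \<cdot> colim_in K G (on_v \<psi> x)"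
        using comp_colim_ar[OF \<phi> t(1) x] comp_colim_ar[OF \<psi> t(1) x] eq by simp
      then have "snd p = snd p'"
        using p t(2) dv by (simp add: verts_G)
      moreover have "on_v (lab G) (on_v \<phi> x) = on_v (lab G) (on_v \<psi> x)"
        using \<phi> \<psi> x by (simp add: diagram_cat_Ar)
      then have "fst p = fst p'"
        using p lab_v by simp
      ultimately have "p = p'"
        by (simp add: prod_eq_iff)
      then show ?thesis
        using p by simp
    qed
    show "\<phi> = \<psi>"
    proof (rule graph_morphism_eqI[OF m vert])
      fix \<alpha> assume \<alpha>: "\<alpha> \<in> edges (shape D)"
      obtain p a p' where e: "(p, a, p') \<in> ES" "on_e \<phi> \<alpha> = ee (p, a, p')"
        using graph_morphism_mem(2)[OF m(1) \<alpha>] by (auto simp: edges_G)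
      obtain r b r' where f: "(r, b, r') \<in> ES" "on_e \<psi> \<alpha> = ee (r, b, r')"
        using graph_morphism_mem(2)[OF m(2) \<alpha>] by (auto simp: edges_G)
      have "on_e (lab G) (on_e \<phi> \<alpha>) = on_e (lab G) (on_e \<psi> \<alpha>)"
        using \<phi> \<psi> \<alpha> by (simp add: diagram_cat_Ar)
      then have "a = b" using e f edge by simp
      \<comment> \<open>An edge of \<open>G\<close> is determined by its label and its two ends, the
        reason for encoding edges as triples. The ends agree because the vertex maps already
        do.\<close>
      moreover have "ev p = ev r" "ev p' = ev r'"
        using graph_morphism_mem(3,4)[OF m(1) \<alpha>] graph_morphism_mem(3,4)[OF m(2) \<alpha>]
          vert diagram_mem(3,4)[OF D \<alpha>] edge[OF e(1)] edge[OF f(1)] e(2) f(2) by metis+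
      then have "p = r" "p' = r'"
        using ES[OF e(1)] ES[OF f(1)] inj_onD[OF ev] by blast+
      ultimately show "on_e \<phi> \<alpha> = on_e \<psi> \<alpha>"
        using e f by simp
    qed
  qed
qed

lemma colim_locally_left_adjoint: "locally_left_adjoint Diag E (colim E K)"
proof (rule locally_left_adjoint.intro[OF colim_functor], unfold_locales)
  fix U :: "(('v, 'e, 'o, 'a) diagram \<times> 'a) set" and X
  assume fin: "finite U" and X: "X \<in> Ob E"
    and U: "\<And>A u. (A, u) \<in> U \<Longrightarrow> A \<in> Ob Diag \<and> u \<in> Hom E (obj_map (colim E K) A) X"
  have U': "is_diagram E A \<and> u \<in> Hom E (colim_ob K A) X" if "(A, u) \<in> U" for A u
    using U[OF that] by (simp add: colim_def)
  obtain G t where G: "is_diagram E G" and t: "t \<in> Hom E (colim_ob K G) X"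
    and ex: "\<And>D u. (D, u) \<in> U \<Longrightarrow> \<exists>\<phi>. (D, \<phi>, G) \<in> Ar Diag \<and> t \<cdot> colim_ar E K (D, \<phi>, G) = u"
    and un: "\<And>D \<phi> \<psi>. (D, \<phi>, G) \<in> Ar Diag \<Longrightarrow> (D, \<psi>, G) \<in> Ar Diag \<Longrightarrow>
      t \<cdot> colim_ar E K (D, \<phi>, G) = t \<cdot> colim_ar E K (D, \<psi>, G) \<Longrightarrow> \<phi> = \<psi>"
    by (rule classifying_diagram[OF fin X U'], assumption, rule that)
  have "\<exists>f \<in> Hom Diag D G. t \<cdot> ar_map (colim E K) f = u" if Du: "(D, u) \<in> U" for D u
  proof -
    obtain \<phi> where "(D, \<phi>, G) \<in> Ar Diag" "t \<cdot> colim_ar E K (D, \<phi>, G) = u"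
      using ex[OF Du] by blast
    then show ?thesis
      by (intro bexI[of _ "(D, \<phi>, G)"]) (simp_all add: Hom_def colim_def)
  qed
  moreover have "f = g" if f: "f \<in> Hom Diag D G" and g: "g \<in> Hom Diag D G"
    and eq: "t \<cdot> ar_map (colim E K) f = t \<cdot> ar_map (colim E K) g" for D f g
  proof -
    obtain \<phi> where \<phi>: "f = (D, \<phi>, G)" "(D, \<phi>, G) \<in> Ar Diag" using f by (rule diagram_HomE)
    obtain \<psi> where \<psi>: "g = (D, \<psi>, G)" "(D, \<psi>, G) \<in> Ar Diag" using g by (rule diagram_HomE)
    show ?thesis using un[OF \<phi>(2) \<psi>(2)] eq by (simp add: \<phi>(1) \<psi>(1) colim_def)
  qed
  moreover have "G \<in> Ob Diag" "t \<in> Hom E (obj_map (colim E K) G) X"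
    using G t by (simp_all add: colim_def)
  ultimately show "\<exists>G t. G \<in> Ob Diag \<and> t \<in> Hom E (obj_map (colim E K) G) X \<and>
      (\<forall>(A, u) \<in> U. \<exists>f \<in> Hom Diag A G. t \<cdot> ar_map (colim E K) f = u) \<and>
      (\<forall>A. \<forall>f \<in> Hom Diag A G. \<forall>g \<in> Hom Diag A G.
        t \<cdot> ar_map (colim E K) f = t \<cdot> ar_map (colim E K) g \<longrightarrow> f = g)"
    by blast
qed

text \<open>The span is realized as a diagram with three vertices and two edges, and its colimit is
  read as a pushout. Infinite types supply distinct names for the vertices and for the
  edges.\<close>

lemma ex_pushout:
  assumes f: "f \<in> Ar E" and g: "g \<in> Ar E" and fg: "Dom E f = Dom E g"
  shows "\<exists>i j. is_pushout E f g i j"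
proof -
  obtain h :: "nat \<Rightarrow> 'v" where h: "inj_on h {0, 1, 2}"
    using ex_inj_on_finite[of "{0, 1, 2 :: nat}"] by blast
  obtain h' :: "bool \<Rightarrow> 'e" where h': "inj_on h' UNIV"
    using ex_inj_on_finite[of "UNIV :: bool set"] by auto
  define a b c where "a = h 0" and "b = h 1" and "c = h 2"
  define x y where "x = h' True" and "y = h' False"
  have v: "a \<noteq> b" "a \<noteq> c" "b \<noteq> c" "b \<noteq> a" "c \<noteq> a" "c \<noteq> b"
    using h by (auto simp: a_def b_def c_def inj_on_def)
  have e: "x \<noteq> y" "y \<noteq> x"
    using h' by (auto simp: x_def y_def inj_on_def)
  define D :: "('v, 'e, 'o, 'a) diagram" where "D = \<lparr>shape = \<lparr>verts = {a, b, c}, edges = {x, y},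
      src = (\<lambda>e \<in> {x, y}. a), tgt = (\<lambda>e \<in> {x, y}. if e = x then b else c)\<rparr>,
    lab = \<lparr>on_v = (\<lambda>v \<in> {a, b, c}. if v = a then Dom E f else if v = b then Cod E f else Cod E g),
      on_e = (\<lambda>e \<in> {x, y}. if e = x then f else g)\<rparr>\<rparr>"
  have D: "is_diagram E D"
    using f g fg v e by (simp add: is_diagram_def D_def finite_graph_def graph_morphism_def underlying_graph_def)
  have cocone_iff: "is_cocone E D X q \<longleftrightarrow> X \<in> Ob E \<and> q a \<in> Hom E (Dom E f) X \<and> q b \<in> Hom E (Cod E f) X \<and>
      q c \<in> Hom E (Cod E g) X \<and> q b \<cdot> f = q a \<and> q c \<cdot> g = q a" for X q
    using v e by (auto simp: is_cocone_def D_def)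
  let ?q = "colim_in K D" and ?P = "colim_ob K D"
  have q: "?q a \<in> Hom E (Dom E f) ?P" "?q b \<in> Hom E (Cod E f) ?P" "?q c \<in> Hom E (Cod E g) ?P"
    "?q b \<cdot> f = ?q a" "?q c \<cdot> g = ?q a"
    using colim_cocone[OF D] by (simp_all add: cocone_iff)
  have V: "verts (shape D) = {a, b, c}" by (simp add: D_def)
  have "is_pushout E f g (?q b) (?q c)"
  proof (rule is_pushoutI)
    fix u w assume u: "u \<in> Ar E" "w \<in> Ar E" "Dom E u = Cod E f" "Dom E w = Cod E g"
      "Cod E u = Cod E w" "u \<cdot> f = w \<cdot> g"
    have "is_cocone E D (Cod E u) (\<lambda>z. if z = a then u \<cdot> f else if z = b then u else w)"
      using u f g fg v by (simp add: cocone_iff Hom_def)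
    from colim_ex1[OF D this] obtain k where "k \<in> Hom E ?P (Cod E u)" "k \<cdot> ?q b = u" "k \<cdot> ?q c = w"
      using v by (auto simp: V)
    then show "\<exists>k. k \<in> Ar E \<and> Dom E k = Cod E (?q b) \<and> Cod E k = Cod E u \<and> k \<cdot> ?q b = u \<and> k \<cdot> ?q c = w"
      using q by (intro exI[of _ k]) (simp add: Hom_def)
  next
    fix k l assume k: "k \<in> Ar E" "l \<in> Ar E" "Dom E k = Cod E (?q b)" "Dom E l = Cod E (?q b)"
      "Cod E k = Cod E l" "k \<cdot> ?q b = l \<cdot> ?q b" "k \<cdot> ?q c = l \<cdot> ?q c"
    \<comment> \<open>A colimit cocone has a third component, at the source \<open>a\<close> of the
      span; agreement there follows from agreement at \<open>b\<close>.\<close>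
    have "k \<cdot> ?q b \<cdot> f = l \<cdot> ?q b \<cdot> f"
      by (rule comp_swap[OF k(6)]) (use k(1-5) q(2) f in \<open>simp_all add: Hom_def\<close>)
    then have "k \<cdot> ?q a = l \<cdot> ?q a"
      by (simp only: q(4))
    then show "k = l"
      by (rule_tac colim_eqI[OF D, of _ "Cod E k"]) (use k q in \<open>auto simp: Hom_def V\<close>)
  qed (use q f g fg in \<open>simp_all add: Hom_def\<close>)
  then show ?thesis by blast
qed

text \<open>Without edges the cocone condition is vacuous, and a cocone is just a family of
  arrows.\<close>

lemma discrete_colimit_is_sum:
  assumes X: "is_diagram E X" "X \<in> discrete_diagrams"
  shows "is_sum E (verts (shape X)) (on_v (lab X)) (colim_ob K X) (colim_in K X)"
  unfolding is_sum_def
proof (intro conjI ballI allI impI)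
  show "colim_ob K X \<in> Ob E" using X by simp
  show "colim_in K X i \<in> Hom E (on_v (lab X) i) (colim_ob K X)" if "i \<in> verts (shape X)" for i
    using colim_in_Hom[OF X(1) that] .
  fix B f assume "B \<in> Ob E" "\<forall>i \<in> verts (shape X). f i \<in> Hom E (on_v (lab X) i) B"
  then have "is_cocone E X B f"
    using X(2) by (simp add: is_cocone_def discrete_diagrams_def)
  then show "\<exists>!h. h \<in> Hom E (colim_ob K X) B \<and> (\<forall>i \<in> verts (shape X). h \<cdot> colim_in K X i = f i)"
    by (rule colim_ex1[OF X(1)])
qed

lemma colim_finite_colimit_functor:
  assumes S: "chosen_sums E S" and T: "chosen_sums Diag T"
  shows "finite_colimit_functor Diag T E S (colim E K)"
proof -
  interpret D: finitely_cocomplete Diag T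
    by (rule diagram_finitely_cocomplete[OF T])
  have "category_with_sums E S"
    by (intro category_with_sums.intro category_with_sums_axioms.intro category_axioms S)
  then have ES: "finitely_cocomplete E S"
    by (intro finitely_cocomplete.intro finitely_cocomplete_axioms.intro ex_pushout)
  interpret L: locally_left_adjoint Diag E "colim E K"
    by (rule colim_locally_left_adjoint)
  show ?thesis
  proof (rule finite_colimit_functor.intro[OF D.finitely_cocomplete_axioms ES colim_functor], unfold_locales)
    show "is_initial E (obj_map (colim E K) (zero_ob T))"
      using T by (intro L.initial_preserved) (simp add: chosen_sums_def)
    show "is_binary_sum E (obj_map (colim E K) A) (obj_map (colim E K) B) (obj_map (colim E K) (sum_ob T A B))
        (ar_map (colim E K) (inj1 T A B)) (ar_map (colim E K) (inj2 T A B))"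
      if "A \<in> Ob Diag" "B \<in> Ob Diag" for A B
      by (rule L.binary_sum_preserved[OF D.binary_sum[OF that] that])
    show "is_pushout E (ar_map (colim E K) f) (ar_map (colim E K) g) (ar_map (colim E K) i) (ar_map (colim E K) j)"
      if "is_pushout Diag f g i j" for f g i j
      by (rule L.pushout_preserved[OF that])
  qed
qed

end

theorem theorem3p1:
  fixes E :: "('o, 'a) cat"
    and K :: "('v::infinite, 'e::infinite, 'o, 'a) colim_choice"
    and S :: "('o, 'a) sum_choice"
    and T :: "(('v, 'e, 'o, 'a) diagram, ('v, 'e, 'o, 'a) diagram_ar) sum_choice"
  assumes "category E"
    and "chosen_colimits E K"
    and "chosen_sums E S"
    and "chosen_sums (diagram_cat E) T"
  shows "cat_functor (diagram_cat E) E (colim E K) \<and>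
    (\<exists>F. wscc_functor (Cspn E T) (cospan_cat E S) F
           (\<lambda>X Y. vec E (colim_sum E S K T X Y))
           (vec E (from_zero E S (colim_ob K (zero_ob T)))) \<and>
         (\<forall>X \<in> Ob (Cspn E T). obj_map F X = colim_ob K X \<and>
            is_sum E (verts (shape X)) (on_v (lab X)) (obj_map F X) (colim_in K X)) \<and>
         (\<forall>(\<alpha>, \<beta>) \<in> cospans (diagram_cat E).
            Dom (diagram_cat E) \<alpha> \<in> discrete_diagrams \<and> Dom (diagram_cat E) \<beta> \<in> discrete_diagrams \<longrightarrow>
            ar_map F (cospan_class (diagram_cat E) (\<alpha>, \<beta>))
              = cospan_class E (colim_ar E K \<alpha>, colim_ar E K \<beta>)))"
proof -
  interpret category_with_colimits E K
    by (intro category_with_colimits.intro category_with_colimits_axioms.intro assms)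
  interpret F: finite_colimit_functor Diag T E S "colim E K"
    by (rule colim_finite_colimit_functor[OF assms(3,4)])
  have colim: "obj_map (colim E K) = colim_ob K" "ar_map (colim E K) = colim_ar E K"
    by (simp_all add: colim_def)
  \<comment> \<open>The functor is built on cospans between all diagrams and only afterwards
    restricted to discrete feet; apexes remain arbitrary diagrams, as composition by pushout
    demands.\<close>
  have "wscc_category (Cspn E T)"
    unfolding Cspn_def
    by (rule wscc_full_sub[OF F.S.cospan_wscc]) (simp_all add: chosen_sums_discrete[OF assms(4)])
  then have "wscc_functor (Cspn E T) (cospan_cat E S) F.cospan_map
      (\<lambda>X Y. vec E (F.can X Y)) (vec E F.can0)"
    unfolding Cspn_def by (rule wscc_functor_full_sub[OF F.cospan_wscc_functor])
  moreover have "F.can X Y = colim_sum E S K T X Y" for X Y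
    by (simp add: F.can_def colim_sum_def colim)
  moreover have "F.can0 = from_zero E S (colim_ob K (zero_ob T))"
    by (simp add: F.can0_def colim)
  moreover have "obj_map F.cospan_map X = colim_ob K X \<and>
      is_sum E (verts (shape X)) (on_v (lab X)) (obj_map F.cospan_map X) (colim_in K X)"
    if "X \<in> Ob (Cspn E T)" for X
    using that discrete_colimit_is_sum[of X] by (simp add: Cspn_def full_sub_simps colim)
  moreover have "ar_map F.cospan_map (cospan_class Diag (\<alpha>, \<beta>)) = cospan_class E (colim_ar E K \<alpha>, colim_ar E K \<beta>)"
    if "(\<alpha>, \<beta>) \<in> cospans Diag" for \<alpha> \<beta>
    using that F.cospan_map_class[of \<alpha> \<beta>] unfolding cospans_def colim by simp
  ultimately show ?thesis
    using colim_functor by (intro conjI exI[of _ F.cospan_map]) (auto simp: colim)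
qed

end
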